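(* Let $R$ be a noetherian graded commutative ring, $\mathsf{T}$ an essentially small $R$-linear triangulated category, and $X$ an object in $\mathsf{T}$. Then $$\operatorname{supp}_RH_X\subseteq\{\mathfrak p\in\operatorname{Spec}R\mid\operatorname{End}^*_{\mathsf{T}}(X)_{\mathfrak p}\neq0\},$$ and equality holds when $\operatorname{End}^*_{\mathsf{T}}(X)$ is finitely generated over $R$.
   Context: A graded commutative ring $R$ is $\mathbb{Z}$-graded with $rs=(-1)^{|r||s|}sr$ for homogeneous $r,s$. $\operatorname{Spec}R$ is the set of homogeneous prime ideals. A triangulated category $\mathsf{T}$ with suspension $\Sigma$ is $R$-linear if there is a given homomorphism of graded rings $R\to Z^*(\mathsf{T})$, where $Z^*(\mathsf{T})=\bigoplus_{n\in\mathbb{Z}}\{\eta\colon \mathrm{Id}_{\mathsf{T}}\to\Sigma^n\mid \eta\Sigma=(-1)^n\Sigma\eta\}$ is the graded centre; then $\operatorname{Hom}^*_{\mathsf{T}}(X,Y)=\bigoplus_n\operatorname{Hom}_{\mathsf{T}}(X,\Sigma^nY)$ is a graded $R$-module, and $\operatorname{End}^*_{\mathsf{T}}(X)=\operatorname{Hom}^*_{\mathsf{T}}(X,X)$. $\operatorname{\mathsf{Coh}}\mathsf{T}$ is the category of cohomological functors $\mathsf{T}^{\mathrm{op}}\to\mathsf{Ab}$ (additive functors taking exact triangles to exact sequences), with natural transformations as morphisms; $H_X=\operatorname{Hom}_{\mathsf{T}}(-,X)$. For $F\in\operatorname{\mathsf{Coh}}\mathsf{T}$, $F^*(X)=\bigoplus_nF(\Sigma^{-n}X)$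 is a graded $R$-module. For an exact functor $f\colon\mathsf{T}\to\mathsf{U}$ of essentially small triangulated categories put $f^*(F)=\operatorname{colim}_{H_X\to F}H_{f(X)}$ for $F\in\operatorname{\mathsf{Coh}}\mathsf{T}$ and $f_*(G)=G\circ f$ for $G\in\operatorname{\mathsf{Coh}}\mathsf{U}$. For $\mathfrak p\in\operatorname{Spec}R$ let $\mathcal V(\mathfrak p)=\{\mathfrak q\in\operatorname{Spec}R\mid\mathfrak p\subseteq\mathfrak q\}$, let $\mathsf{T}_{\mathcal V(\mathfrak p)}=\{X\in\mathsf{T}\mid\operatorname{End}^*_{\mathsf{T}}(X)_{\mathfrak q}=0\text{ for all }\mathfrak q\notin\mathcal V(\mathfrak p)\}$ with inclusion $i\colon\mathsf{T}_{\mathcal V(\mathfrak p)}\to\mathsf{T}$, and set $\varGamma_{\mathcal V(\mathfrak p)}=i^*\circ i_*\colon\operatorname{\mathsf{Coh}}\mathsf{T}\to\operatorname{\mathsf{Coh}}\mathsf{T}$. The functor $F_{\mathfrak p}\in\operatorname{\mathsf{Coh}}\mathsf{T}$ is defined by $(F_{\mathfrak p})^*(X)=F^*(X)_{\mathfrak p}$. Set $\varGamma_{\mathfrak p}F=\varGamma_{\mathcal V(\mathfrak p)}(F_{\mathfrak p})$ and $\operatorname{supp}_RF=\{\mathfrak p\in\operatorname{Spec}R\mid\varGamma_{\mathfrak p}F\neq0\}$. *)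

theory Defs
  imports "HOL-Algebra.Ideal" "HOL-Algebra.Product_Groups"
begin

section \<open>Graded commutative rings and their homogeneous spectrum\<close>

record 'r graded_ring = "'r ring" +
  grade :: "int \<Rightarrow> 'r set"

definition is_decomp :: "'r graded_ring \<Rightarrow> 'r \<Rightarrow> (int \<Rightarrow> 'r) \<Rightarrow> bool" where
  "is_decomp R x c \<longleftrightarrow> (\<forall>n. c n \<in> grade R n) \<and> finite {n. c n \<noteq> \<zero>\<^bsub>R\<^esub>} \<and>
     x = (\<Oplus>\<^bsub>R\<^esub>n\<in>{n. c n \<noteq> \<zero>\<^bsub>R\<^esub>}. c n)"

definition hcomp :: "'r graded_ring \<Rightarrow> 'r \<Rightarrow> int \<Rightarrow> 'r" where
  "hcomp R x = (THE c. is_decomp R x c)"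

locale graded_commutative_ring = ring R for R :: "'r graded_ring" (structure) +
  assumes grade_subgroup: "subgroup (grade R n) (add_monoid R)"
    and grade_decomp: "x \<in> carrier R \<Longrightarrow> \<exists>!c. is_decomp R x c"
    and grade_one: "\<one> \<in> grade R 0"
    and grade_mult: "r \<in> grade R m \<Longrightarrow> s \<in> grade R n \<Longrightarrow> r \<otimes> s \<in> grade R (m + n)"
    and grade_comm: "r \<in> grade R m \<Longrightarrow> s \<in> grade R n \<Longrightarrow>
      r \<otimes> s = (if even (m * n) then s \<otimes> r else \<ominus> (s \<otimes> r))"

definition homogeneous_ideal :: "'r graded_ring \<Rightarrow> 'r set \<Rightarrow> bool" where
  "homogeneous_ideal R I \<longleftrightarrow> ideal I R \<and> (\<forall>x\<in>I. \<forall>n. hcomp R x n \<in> I)"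

text \<open>As usual in the graded setting, only homogeneous ideals are required to be finitely
  generated.\<close>

locale noetherian_graded_commutative_ring = graded_commutative_ring +
  assumes homogeneous_finitely_generated:
    "homogeneous_ideal R I \<Longrightarrow> \<exists>A. finite A \<and> A \<subseteq> carrier R \<and> I = Idl A"

text \<open>For a homogeneous ideal of a \<open>\<int>\<close>-graded ring it suffices to test primeness on homogeneous
  elements. (The library locale \<open>primeideal\<close> is only available for commutative rings.)\<close>

definition Spec :: "'r graded_ring \<Rightarrow> 'r set set" where
  "Spec R = {p. homogeneous_ideal R p \<and> p \<noteq> carrier R \<and>
     (\<forall>m n. \<forall>a\<in>grade R m. \<forall>b\<in>grade R n. a \<otimes>\<^bsub>R\<^esub> b \<in> p \<longrightarrow> a \<in> p \<or> b \<in> p)}"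

definition Vset :: "'r graded_ring \<Rightarrow> 'r set \<Rightarrow> 'r set set" where
  "Vset R p = {q \<in> Spec R. p \<subseteq> q}"


section \<open>Graded modules and localization\<close>

text \<open>Abelian groups are multiplicatively written \<open>monoid\<close> records satisfying \<open>comm_group\<close>.
  A graded left module is given by its homogeneous parts \<open>part M n\<close>;
  \<open>act M d n r x\<close> is the product \<open>r x\<close> for \<open>r\<close> of degree \<open>d\<close> and \<open>x\<close> of degree \<open>n\<close>,
  an element of degree \<open>d + n\<close>.\<close>

record ('r, 'm) graded_module =
  part :: "int \<Rightarrow> 'm monoid"
  act :: "int \<Rightarrow> int \<Rightarrow> 'r \<Rightarrow> 'm \<Rightarrow> 'm"

definition finitely_generated :: "'r graded_ring \<Rightarrow> ('r, 'm) graded_module \<Rightarrow> bool" where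
  "finitely_generated R M \<longleftrightarrow> (\<exists>G. finite G \<and> (\<forall>(k, x)\<in>G. x \<in> carrier (part M k)) \<and>
     (\<forall>n. carrier (part M n) =
        generate (part M n) {act M d k r x | d k r x. (k, x) \<in> G \<and> d + k = n \<and> r \<in> grade R d}))"

text \<open>\<open>M\<^sub>p\<close> is the localization with respect to the homogeneous elements outside \<open>p\<close>. The triple
  \<open>(d, s, x)\<close> stands for the fraction \<open>s\<^sup>-\<^sup>1 x\<close> with \<open>s\<close> of degree \<open>d\<close>. Since homogeneous
  elements commute only up to sign, equality of fractions is that of the (left) Ore localization:
  two fractions agree if they can be expanded to the same one.\<close>

definition fractions ::
  "'r graded_ring \<Rightarrow> 'r set \<Rightarrow> ('r, 'm) graded_module \<Rightarrow> int \<Rightarrow> (int \<times> 'r \<times> 'm) set" where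
  "fractions R p M n = {(d, s, x). s \<in> grade R d \<and> s \<notin> p \<and> x \<in> carrier (part M (d + n))}"

definition fraction_eq ::
  "'r graded_ring \<Rightarrow> 'r set \<Rightarrow> ('r, 'm) graded_module \<Rightarrow> int \<Rightarrow> (int \<times> 'r \<times> 'm) rel" where
  "fraction_eq R p M n = {((d, s, x), (d', s', x')).
     (d, s, x) \<in> fractions R p M n \<and> (d', s', x') \<in> fractions R p M n \<and>
     (\<exists>k k'. \<exists>a\<in>grade R k. \<exists>a'\<in>grade R k'. k + d = k' + d' \<and>
        a \<otimes>\<^bsub>R\<^esub> s = a' \<otimes>\<^bsub>R\<^esub> s' \<and> a \<otimes>\<^bsub>R\<^esub> s \<notin> p \<and>
        act M k (d + n) a x = act M k' (d' + n) a' x')}"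

text \<open>The homogeneous part of degree \<open>n\<close> of \<open>M\<^sub>p\<close>; fractions are added after passing to a common
  denominator. Only the underlying graded abelian group of \<open>M\<^sub>p\<close> is needed.\<close>

definition localization ::
  "'r graded_ring \<Rightarrow> 'r set \<Rightarrow> ('r, 'm) graded_module \<Rightarrow> int \<Rightarrow> (int \<times> 'r \<times> 'm) set monoid" where
  "localization R p M n =
     \<lparr>carrier = fractions R p M n // fraction_eq R p M n,
      monoid.mult = (\<lambda>K L. \<Union>{fraction_eq R p M n `` {(d, s, x \<otimes>\<^bsub>part M (d + n)\<^esub> y)} | d s x y.
                        (d, s, x) \<in> K \<and> (d, s, y) \<in> L}),
      one = fraction_eq R p M n `` {(0, \<one>\<^bsub>R\<^esub>, \<one>\<^bsub>part M n\<^esub>)}\<rparr>"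

definition localization_zero :: "'r graded_ring \<Rightarrow> 'r set \<Rightarrow> ('r, 'm) graded_module \<Rightarrow> bool" where
  "localization_zero R p M \<longleftrightarrow>
     (\<forall>n. carrier (localization R p M n) = {\<one>\<^bsub>localization R p M n\<^esub>})"


section \<open>Triangulated categories\<close>

text \<open>Objects and arrows form sets of the types \<open>'o\<close> and \<open>'a\<close>, so every category
  is small. A triangle \<open>X \<rightarrow> Y \<rightarrow> Z \<rightarrow> \<Sigma>X\<close> is the triple of its arrows.\<close>

record ('o, 'a) tricat =
  Obj :: "'o set"
  Arr :: "'a set"
  Dom :: "'a \<Rightarrow> 'o"
  Cod :: "'a \<Rightarrow> 'o"
  Idt :: "'o \<Rightarrow> 'a"
  Cmp :: "'a \<Rightarrow> 'a \<Rightarrow> 'a"  (infixl \<open>\<bullet>\<index>\<close> 70)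
  Add :: "'a \<Rightarrow> 'a \<Rightarrow> 'a"
  Zer :: "'o \<Rightarrow> 'o \<Rightarrow> 'a"
  SigO :: "'o \<Rightarrow> 'o"
  SigA :: "'a \<Rightarrow> 'a"
  Tri :: "('a \<times> 'a \<times> 'a) set"

definition Hom :: "('o, 'a) tricat \<Rightarrow> 'o \<Rightarrow> 'o \<Rightarrow> 'a monoid" where
  "Hom T X Y = \<lparr>carrier = {f \<in> Arr T. Dom T f = X \<and> Cod T f = Y}, monoid.mult = Add T, one = Zer T X Y\<rparr>"

abbreviation hom_set :: "('o, 'a) tricat \<Rightarrow> 'o \<Rightarrow> 'o \<Rightarrow> 'a set" where
  "hom_set T X Y \<equiv> carrier (Hom T X Y)"

definition Neg :: "('o, 'a) tricat \<Rightarrow> 'a \<Rightarrow> 'a" where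
  "Neg T f = inv\<^bsub>Hom T (Dom T f) (Cod T f)\<^esub> f"

definition is_iso :: "('o, 'a) tricat \<Rightarrow> 'a \<Rightarrow> bool" where
  "is_iso T f \<longleftrightarrow> f \<in> Arr T \<and>
     (\<exists>g\<in>hom_set T (Cod T f) (Dom T f). g \<bullet>\<^bsub>T\<^esub> f = Idt T (Dom T f) \<and> f \<bullet>\<^bsub>T\<^esub> g = Idt T (Cod T f))"

definition is_zero_object :: "('o, 'a) tricat \<Rightarrow> 'o \<Rightarrow> bool" where
  "is_zero_object T Z \<longleftrightarrow> Z \<in> Obj T \<and>
     (\<forall>X\<in>Obj T. (\<exists>!f. f \<in> hom_set T X Z) \<and> (\<exists>!f. f \<in> hom_set T Z X))"

locale category =
  fixes T :: "('o, 'a) tricat" (structure)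
  assumes dom_obj: "f \<in> Arr T \<Longrightarrow> Dom T f \<in> Obj T"
    and cod_obj: "f \<in> Arr T \<Longrightarrow> Cod T f \<in> Obj T"
    and id_hom: "X \<in> Obj T \<Longrightarrow> Idt T X \<in> hom_set T X X"
    and comp_hom: "f \<in> hom_set T X Y \<Longrightarrow> g \<in> hom_set T Y Z \<Longrightarrow> g \<bullet> f \<in> hom_set T X Z"
    and comp_id: "f \<in> hom_set T X Y \<Longrightarrow> f \<bullet> Idt T X = f"
    and id_comp: "f \<in> hom_set T X Y \<Longrightarrow> Idt T Y \<bullet> f = f"
    and comp_assoc: "f \<in> hom_set T X Y \<Longrightarrow> g \<in> hom_set T Y Z \<Longrightarrow> h \<in> hom_set T Z W \<Longrightarrow>
      h \<bullet> (g \<bullet> f) = (h \<bullet> g) \<bullet> f"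

locale additive_category = category +
  assumes hom_group: "X \<in> Obj T \<Longrightarrow> Y \<in> Obj T \<Longrightarrow> comm_group (Hom T X Y)"
    and comp_add_left: "f \<in> hom_set T X Y \<Longrightarrow> g \<in> hom_set T Y Z \<Longrightarrow> g' \<in> hom_set T Y Z \<Longrightarrow>
      Add T g g' \<bullet> f = Add T (g \<bullet> f) (g' \<bullet> f)"
    and comp_add_right: "f \<in> hom_set T X Y \<Longrightarrow> f' \<in> hom_set T X Y \<Longrightarrow> g \<in> hom_set T Y Z \<Longrightarrow>
      g \<bullet> Add T f f' = Add T (g \<bullet> f) (g \<bullet> f')"
    and zero_object: "\<exists>Z. is_zero_object T Z"
    and biproduct: "X \<in> Obj T \<Longrightarrow> Y \<in> Obj T \<Longrightarrow>
      \<exists>P\<in>Obj T. \<exists>i\<in>hom_set T X P. \<exists>j\<in>hom_set T Y P. \<exists>p\<in>hom_set T P X. \<exists>q\<in>hom_set T P Y.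
        p \<bullet> i = Idt T X \<and> q \<bullet> j = Idt T Y \<and> p \<bullet> j = Zer T Y X \<and> q \<bullet> i = Zer T X Y \<and>
        Add T (i \<bullet> p) (j \<bullet> q) = Idt T P"

text \<open>The suspension is an automorphism, so that its powers \<open>\<Sigma>\<^sup>n\<close>, \<open>n \<in> \<int>\<close>, compose strictly.\<close>

locale triangulated_category = additive_category +
  assumes susp_obj_bij: "bij_betw (SigO T) (Obj T) (Obj T)"
    and susp_arr_bij: "bij_betw (SigA T) (Arr T) (Arr T)"
    and susp_hom: "f \<in> hom_set T X Y \<Longrightarrow> SigA T f \<in> hom_set T (SigO T X) (SigO T Y)"
    and susp_id: "X \<in> Obj T \<Longrightarrow> SigA T (Idt T X) = Idt T (SigO T X)"
    and susp_comp: "f \<in> hom_set T X Y \<Longrightarrow> g \<in> hom_set T Y Z \<Longrightarrow>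
      SigA T (g \<bullet> f) = SigA T g \<bullet> SigA T f"
    and susp_add: "f \<in> hom_set T X Y \<Longrightarrow> g \<in> hom_set T X Y \<Longrightarrow>
      SigA T (Add T f g) = Add T (SigA T f) (SigA T g)"
    and tri_arr: "(f, g, h) \<in> Tri T \<Longrightarrow> \<exists>X\<in>Obj T. \<exists>Y\<in>Obj T. \<exists>Z\<in>Obj T.
      f \<in> hom_set T X Y \<and> g \<in> hom_set T Y Z \<and> h \<in> hom_set T Z (SigO T X)"
    and TR1_iso: "(f, g, h) \<in> Tri T \<Longrightarrow>
      f' \<in> hom_set T X' Y' \<Longrightarrow> g' \<in> hom_set T Y' Z' \<Longrightarrow> h' \<in> hom_set T Z' (SigO T X') \<Longrightarrow>
      u \<in> hom_set T (Dom T f) X' \<Longrightarrow> v \<in> hom_set T (Dom T g) Y' \<Longrightarrow> w \<in> hom_set T (Dom T h) Z' \<Longrightarrow>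
      is_iso T u \<Longrightarrow> is_iso T v \<Longrightarrow> is_iso T w \<Longrightarrow>
      v \<bullet> f = f' \<bullet> u \<Longrightarrow> w \<bullet> g = g' \<bullet> v \<Longrightarrow> SigA T u \<bullet> h = h' \<bullet> w \<Longrightarrow>
      (f', g', h') \<in> Tri T"
    and TR1_id: "X \<in> Obj T \<Longrightarrow> is_zero_object T Z \<Longrightarrow>
      (Idt T X, Zer T X Z, Zer T Z (SigO T X)) \<in> Tri T"
    and TR1_cone: "f \<in> Arr T \<Longrightarrow> \<exists>g h. (f, g, h) \<in> Tri T"
    and TR2: "f \<in> hom_set T X Y \<Longrightarrow> g \<in> hom_set T Y Z \<Longrightarrow> h \<in> hom_set T Z (SigO T X) \<Longrightarrow>
      (f, g, h) \<in> Tri T \<longleftrightarrow> (g, h, Neg T (SigA T f)) \<in> Tri T"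
    and TR3: "(f, g, h) \<in> Tri T \<Longrightarrow> (f', g', h') \<in> Tri T \<Longrightarrow>
      u \<in> hom_set T (Dom T f) (Dom T f') \<Longrightarrow> v \<in> hom_set T (Dom T g) (Dom T g') \<Longrightarrow>
      v \<bullet> f = f' \<bullet> u \<Longrightarrow>
      \<exists>w\<in>hom_set T (Dom T h) (Dom T h'). w \<bullet> g = g' \<bullet> v \<and> SigA T u \<bullet> h = h' \<bullet> w"
    and TR4: "f \<in> hom_set T X Y \<Longrightarrow> g \<in> hom_set T Y Z \<Longrightarrow>
      (f, u, u') \<in> Tri T \<Longrightarrow> (g, v, v') \<in> Tri T \<Longrightarrow> (g \<bullet> f, w, w') \<in> Tri T \<Longrightarrow>
      \<exists>a b. (a, b, SigA T u \<bullet> v') \<in> Tri T \<and>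
        a \<in> hom_set T (Cod T u) (Cod T w) \<and> b \<in> hom_set T (Cod T w) (Cod T v) \<and>
        a \<bullet> u = w \<bullet> g \<and> w' \<bullet> a = u' \<and> b \<bullet> w = v \<and> v' \<bullet> b = SigA T f \<bullet> w'"

definition SigO_pow :: "('o, 'a) tricat \<Rightarrow> int \<Rightarrow> 'o \<Rightarrow> 'o" where
  "SigO_pow T n =
     (if 0 \<le> n then SigO T ^^ nat n else inv_into (Obj T) (SigO T) ^^ nat (- n))"

definition SigA_pow :: "('o, 'a) tricat \<Rightarrow> int \<Rightarrow> 'a \<Rightarrow> 'a" where
  "SigA_pow T n =
     (if 0 \<le> n then SigA T ^^ nat n else inv_into (Arr T) (SigA T) ^^ nat (- n))"

definition full_subcategory :: "('o, 'a) tricat \<Rightarrow> 'o set \<Rightarrow> ('o, 'a) tricat" where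
  "full_subcategory T S =
     (let A = {f \<in> Arr T. Dom T f \<in> S \<and> Cod T f \<in> S}
      in T\<lparr>Obj := Obj T \<inter> S, Arr := A, Tri := Tri T \<inter> (A \<times> A \<times> A)\<rparr>)"


section \<open>The graded centre and linear triangulated categories\<close>

text \<open>The degree \<open>n\<close> part of \<open>Z\<^sup>*(T)\<close>: natural transformations \<open>\<eta> : Id \<rightarrow> \<Sigma>\<^sup>n\<close> with
  \<open>\<eta>\<Sigma> = (-1)\<^sup>n \<Sigma>\<eta>\<close>.\<close>

definition center :: "('o, 'a) tricat \<Rightarrow> int \<Rightarrow> ('o \<Rightarrow> 'a) set" where
  "center T n = {\<eta> \<in> (\<Pi>\<^sub>E X\<in>Obj T. hom_set T X (SigO_pow T n X)).
     (\<forall>f\<in>Arr T. SigA_pow T n f \<bullet>\<^bsub>T\<^esub> \<eta> (Dom T f) = \<eta> (Cod T f) \<bullet>\<^bsub>T\<^esub> f) \<and>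
     (\<forall>X\<in>Obj T. \<eta> (SigO T X) = (if even n then SigA T (\<eta> X) else Neg T (SigA T (\<eta> X))))}"

definition center_add :: "('o, 'a) tricat \<Rightarrow> ('o \<Rightarrow> 'a) \<Rightarrow> ('o \<Rightarrow> 'a) \<Rightarrow> 'o \<Rightarrow> 'a" where
  "center_add T \<eta> \<theta> = (\<lambda>X\<in>Obj T. Add T (\<eta> X) (\<theta> X))"

text \<open>The product \<open>\<eta>\<theta>\<close>, where \<open>\<theta>\<close> has degree \<open>n\<close>. It is chosen such that evaluation at \<open>X\<close>
  is a ring homomorphism to \<open>End\<^sup>*(X)\<close> with the product \<open>\<beta>\<alpha> = \<Sigma>\<^sup>n\<beta> \<bullet> \<alpha>\<close> for \<open>\<alpha>\<close> of degree \<open>n\<close>.\<close>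

definition center_mult :: "('o, 'a) tricat \<Rightarrow> int \<Rightarrow> ('o \<Rightarrow> 'a) \<Rightarrow> ('o \<Rightarrow> 'a) \<Rightarrow> 'o \<Rightarrow> 'a" where
  "center_mult T n \<eta> \<theta> = (\<lambda>X\<in>Obj T. SigA_pow T n (\<eta> X) \<bullet>\<^bsub>T\<^esub> \<theta> X)"

text \<open>\<open>\<phi> n\<close> is the degree \<open>n\<close> part of the homomorphism of graded rings \<open>R \<rightarrow> Z\<^sup>*(T)\<close>.\<close>

locale linear_triangulated_category =
  graded_commutative_ring R + triangulated_category T
  for R :: "'r graded_ring" and T :: "('o, 'a) tricat" +
  fixes \<phi> :: "int \<Rightarrow> 'r \<Rightarrow> 'o \<Rightarrow> 'a"
  assumes phi_center: "r \<in> grade R n \<Longrightarrow> \<phi> n r \<in> center T n"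
    and phi_add: "r \<in> grade R n \<Longrightarrow> s \<in> grade R n \<Longrightarrow>
      \<phi> n (r \<oplus>\<^bsub>R\<^esub> s) = center_add T (\<phi> n r) (\<phi> n s)"
    and phi_mult: "r \<in> grade R m \<Longrightarrow> s \<in> grade R n \<Longrightarrow>
      \<phi> (m + n) (r \<otimes>\<^bsub>R\<^esub> s) = center_mult T n (\<phi> m r) (\<phi> n s)"
    and phi_one: "\<phi> 0 \<one>\<^bsub>R\<^esub> = (\<lambda>X\<in>Obj T. Idt T X)"

definition Hom_star ::
  "('o, 'a) tricat \<Rightarrow> (int \<Rightarrow> 'r \<Rightarrow> 'o \<Rightarrow> 'a) \<Rightarrow> 'o \<Rightarrow> 'o \<Rightarrow> ('r, 'a) graded_module" where
  "Hom_star T \<phi> X Y =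
     \<lparr>part = (\<lambda>n. Hom T X (SigO_pow T n Y)),
      act = (\<lambda>d n r \<alpha>. SigA_pow T n (\<phi> d r Y) \<bullet>\<^bsub>T\<^esub> \<alpha>)\<rparr>"

definition End_star ::
  "('o, 'a) tricat \<Rightarrow> (int \<Rightarrow> 'r \<Rightarrow> 'o \<Rightarrow> 'a) \<Rightarrow> 'o \<Rightarrow> ('r, 'a) graded_module" where
  "End_star T \<phi> X = Hom_star T \<phi> X X"


section \<open>Functors to abelian groups\<close>

record ('o, 'a, 'g) ab_functor =
  FObj :: "'o \<Rightarrow> 'g monoid"
  FArr :: "'a \<Rightarrow> 'g \<Rightarrow> 'g"

locale additive_functor = additive_category T
  for T :: "('o, 'a) tricat" and F :: "('o, 'a, 'g) ab_functor" +
  assumes fobj_group: "X \<in> Obj T \<Longrightarrow> comm_group (FObj F X)"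
    and farr_hom: "f \<in> hom_set T X Y \<Longrightarrow> FArr F f \<in> hom (FObj F Y) (FObj F X)"
    and farr_id: "X \<in> Obj T \<Longrightarrow> x \<in> carrier (FObj F X) \<Longrightarrow> FArr F (Idt T X) x = x"
    and farr_comp: "f \<in> hom_set T X Y \<Longrightarrow> g \<in> hom_set T Y Z \<Longrightarrow> x \<in> carrier (FObj F Z) \<Longrightarrow>
      FArr F (g \<bullet>\<^bsub>T\<^esub> f) x = FArr F f (FArr F g x)"
    and farr_add: "f \<in> hom_set T X Y \<Longrightarrow> g \<in> hom_set T X Y \<Longrightarrow> x \<in> carrier (FObj F Y) \<Longrightarrow>
      FArr F (Add T f g) x = FArr F f x \<otimes>\<^bsub>FObj F X\<^esub> FArr F g x"

text \<open>The objects of \<open>Coh T\<close>.\<close>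

locale cohomological_functor = triangulated_category T + additive_functor T F
  for T :: "('o, 'a) tricat" and F :: "('o, 'a, 'g) ab_functor" +
  assumes exact: "(f, g, h) \<in> Tri T \<Longrightarrow>
    kernel (FObj F (Cod T f)) (FObj F (Dom T f)) (FArr F f) = FArr F g ` carrier (FObj F (Cod T g))"

definition is_zero_functor :: "('o, 'a) tricat \<Rightarrow> ('o, 'a, 'g) ab_functor \<Rightarrow> bool" where
  "is_zero_functor T F \<longleftrightarrow> (\<forall>X\<in>Obj T. carrier (FObj F X) = {\<one>\<^bsub>FObj F X\<^esub>})"

definition nat_trans ::
  "('o, 'a) tricat \<Rightarrow> ('o, 'a, 'g) ab_functor \<Rightarrow> ('o, 'a, 'h) ab_functor \<Rightarrow> ('o \<Rightarrow> 'g \<Rightarrow> 'h) set" where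
  "nat_trans T F G =
     {\<tau> \<in> (\<Pi>\<^sub>E X\<in>Obj T. hom (FObj F X) (FObj G X) \<inter> extensional (carrier (FObj F X))).
        \<forall>f\<in>Arr T. \<forall>x\<in>carrier (FObj F (Cod T f)).
          \<tau> (Dom T f) (FArr F f x) = FArr G f (\<tau> (Cod T f) x)}"

definition representable :: "('o, 'a) tricat \<Rightarrow> 'o \<Rightarrow> ('o, 'a, 'a) ab_functor" where
  "representable T X = \<lparr>FObj = (\<lambda>C. Hom T C X), FArr = (\<lambda>f \<alpha>. \<alpha> \<bullet>\<^bsub>T\<^esub> f)\<rparr>"

text \<open>\<open>F\<^sup>*(X) = \<Oplus>\<^sub>n F(\<Sigma>\<^sup>-\<^sup>n X)\<close>. An element \<open>r\<close> of degree \<open>d\<close> acts on \<open>F(\<Sigma>\<^sup>-\<^sup>n X)\<close> through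
  \<open>r : \<Sigma>\<^sup>-\<^sup>n\<^sup>-\<^sup>d X \<rightarrow> \<Sigma>\<^sup>-\<^sup>n X\<close>. By the commutation rule in the centre this is a left action.
  For \<open>F = H\<^sub>Y\<close> the maps \<open>\<alpha> \<mapsto> (-1)\<^sup>n \<Sigma>\<^sup>n\<alpha>\<close> are an isomorphism of graded modules from \<open>F\<^sup>*(X)\<close>
  to \<open>Hom\<^sup>*(X, Y)\<close>.\<close>

definition functor_star ::
  "('o, 'a) tricat \<Rightarrow> (int \<Rightarrow> 'r \<Rightarrow> 'o \<Rightarrow> 'a) \<Rightarrow> ('o, 'a, 'g) ab_functor \<Rightarrow> 'o \<Rightarrow> ('r, 'g) graded_module" where
  "functor_star T \<phi> F X =
     \<lparr>part = (\<lambda>n. FObj F (SigO_pow T (- n) X)),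
      act = (\<lambda>d n r x. FArr F (\<phi> d r (SigO_pow T (- (d + n)) X)) x)\<rparr>"

text \<open>\<open>F\<^sub>p(X)\<close> is the degree \<open>0\<close> part of \<open>F\<^sup>*(X)\<^sub>p\<close>; as \<open>F\<^sup>m(\<Sigma>\<^sup>-\<^sup>n X) = F\<^sup>m\<^sup>+\<^sup>n(X)\<close>, the value
  \<open>F\<^sub>p(\<Sigma>\<^sup>-\<^sup>n X)\<close> is then the degree \<open>n\<close> part. An arrow \<open>f\<close> sends
  \<open>s\<^sup>-\<^sup>1 x\<close>, \<open>s\<close> of degree \<open>d\<close>, to \<open>s\<^sup>-\<^sup>1 F(\<Sigma>\<^sup>-\<^sup>d f)(x)\<close>.\<close>

definition functor_loc ::
  "'r graded_ring \<Rightarrow> ('o, 'a) tricat \<Rightarrow> (int \<Rightarrow> 'r \<Rightarrow> 'o \<Rightarrow> 'a) \<Rightarrow> 'r set \<Rightarrow> ('o, 'a, 'g) ab_functor \<Rightarrow>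
    ('o, 'a, (int \<times> 'r \<times> 'g) set) ab_functor" where
  "functor_loc R T \<phi> p F =
     \<lparr>FObj = (\<lambda>X. localization R p (functor_star T \<phi> F X) 0),
      FArr = (\<lambda>f K. \<Union>(d, s, x)\<in>K.
        fraction_eq R p (functor_star T \<phi> F (Dom T f)) 0 `` {(d, s, FArr F (SigA_pow T (- d) f) x)})\<rparr>"


section \<open>Colimits and the functors \<open>f\<^sup>*\<close>, \<open>f\<^sub>*\<close>\<close>

text \<open>The colimit of a diagram of abelian groups: \<open>I\<close> are the indices, \<open>E\<close> the arrows
  between them, and \<open>D\<close>, \<open>d\<close> the groups and maps. It is the quotient of the direct sum of the groups
  by the subgroup generated by the differences of an element and its image under an arrow.\<close>

definition sum_inj :: "'i set \<Rightarrow> ('i \<Rightarrow> 'g monoid) \<Rightarrow> 'i \<Rightarrow> 'g \<Rightarrow> 'i \<Rightarrow> 'g" where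
  "sum_inj I D i x = (\<lambda>j\<in>I. if j = i then x else \<one>\<^bsub>D j\<^esub>)"

definition colimit_rel ::
  "'i set \<Rightarrow> 'e set \<Rightarrow> ('e \<Rightarrow> 'i) \<Rightarrow> ('e \<Rightarrow> 'i) \<Rightarrow> ('i \<Rightarrow> 'g monoid) \<Rightarrow> ('e \<Rightarrow> 'g \<Rightarrow> 'g) \<Rightarrow> ('i \<Rightarrow> 'g) set" where
  "colimit_rel I E src tgt D d = generate (sum_group I D)
     {sum_inj I D (tgt e) (d e x) \<otimes>\<^bsub>sum_group I D\<^esub> inv\<^bsub>sum_group I D\<^esub> (sum_inj I D (src e) x) |
        e x. e \<in> E \<and> x \<in> carrier (D (src e))}"

definition ab_colimit ::
  "'i set \<Rightarrow> 'e set \<Rightarrow> ('e \<Rightarrow> 'i) \<Rightarrow> ('e \<Rightarrow> 'i) \<Rightarrow> ('i \<Rightarrow> 'g monoid) \<Rightarrow> ('e \<Rightarrow> 'g \<Rightarrow> 'g) \<Rightarrow>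
    ('i \<Rightarrow> 'g) set monoid" where
  "ab_colimit I E src tgt D d = sum_group I D Mod colimit_rel I E src tgt D d"

text \<open>The category of morphisms \<open>H\<^sub>X \<rightarrow> F\<close>; its arrows carry their source and target.\<close>

definition slice_obj ::
  "('o, 'a) tricat \<Rightarrow> ('o, 'a, 'g) ab_functor \<Rightarrow> ('o \<times> ('o \<Rightarrow> 'a \<Rightarrow> 'g)) set" where
  "slice_obj T F = {(X, \<tau>). X \<in> Obj T \<and> \<tau> \<in> nat_trans T (representable T X) F}"

definition slice_arr ::
  "('o, 'a) tricat \<Rightarrow> ('o, 'a, 'g) ab_functor \<Rightarrow>
    (('o \<times> ('o \<Rightarrow> 'a \<Rightarrow> 'g)) \<times> 'a \<times> ('o \<times> ('o \<Rightarrow> 'a \<Rightarrow> 'g))) set" where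
  "slice_arr T F = {((X, \<tau>), \<alpha>, (X', \<tau>')).
     (X, \<tau>) \<in> slice_obj T F \<and> (X', \<tau>') \<in> slice_obj T F \<and> \<alpha> \<in> hom_set T X X' \<and>
     (\<forall>C\<in>Obj T. \<forall>\<beta>\<in>hom_set T C X. \<tau> C \<beta> = \<tau>' C (\<alpha> \<bullet>\<^bsub>T\<^esub> \<beta>))}"

text \<open>\<open>f\<^sup>*(F)\<close> for \<open>f : T \<rightarrow> U\<close> with object map \<open>fo\<close> and arrow map \<open>fa\<close>. Colimits of functors
  are formed objectwise.\<close>

definition upper_star_rel ::
  "('o, 'a) tricat \<Rightarrow> ('p, 'b) tricat \<Rightarrow> ('o \<Rightarrow> 'p) \<Rightarrow> ('a \<Rightarrow> 'b) \<Rightarrow> ('o, 'a, 'g) ab_functor \<Rightarrow> 'p \<Rightarrow>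
    ('o \<times> ('o \<Rightarrow> 'a \<Rightarrow> 'g) \<Rightarrow> 'b) set" where
  "upper_star_rel T U fo fa F C = colimit_rel (slice_obj T F) (slice_arr T F) fst (snd \<circ> snd)
     (\<lambda>(X, \<tau>). FObj (representable U (fo X)) C) (\<lambda>(_, \<alpha>, _) \<beta>. fa \<alpha> \<bullet>\<^bsub>U\<^esub> \<beta>)"

definition upper_star ::
  "('o, 'a) tricat \<Rightarrow> ('p, 'b) tricat \<Rightarrow> ('o \<Rightarrow> 'p) \<Rightarrow> ('a \<Rightarrow> 'b) \<Rightarrow> ('o, 'a, 'g) ab_functor \<Rightarrow>
    ('p, 'b, ('o \<times> ('o \<Rightarrow> 'a \<Rightarrow> 'g) \<Rightarrow> 'b) set) ab_functor" where
  "upper_star T U fo fa F =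
     \<lparr>FObj = (\<lambda>C. ab_colimit (slice_obj T F) (slice_arr T F) fst (snd \<circ> snd)
        (\<lambda>(X, \<tau>). FObj (representable U (fo X)) C) (\<lambda>(_, \<alpha>, _) \<beta>. fa \<alpha> \<bullet>\<^bsub>U\<^esub> \<beta>)),
      FArr = (\<lambda>c K. \<Union>z\<in>K. upper_star_rel T U fo fa F (Dom U c)
        #>\<^bsub>sum_group (slice_obj T F) (\<lambda>(X, \<tau>). FObj (representable U (fo X)) (Dom U c))\<^esub>
          (\<lambda>(X, \<tau>)\<in>slice_obj T F. FArr (representable U (fo X)) c (z (X, \<tau>))))\<rparr>"

definition lower_star ::
  "('o \<Rightarrow> 'p) \<Rightarrow> ('a \<Rightarrow> 'b) \<Rightarrow> ('p, 'b, 'g) ab_functor \<Rightarrow> ('o, 'a, 'g) ab_functor" where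
  "lower_star fo fa G = \<lparr>FObj = FObj G \<circ> fo, FArr = FArr G \<circ> fa\<rparr>"


section \<open>Local cohomology and support\<close>

definition torsion_subcategory ::
  "'r graded_ring \<Rightarrow> ('o, 'a) tricat \<Rightarrow> (int \<Rightarrow> 'r \<Rightarrow> 'o \<Rightarrow> 'a) \<Rightarrow> 'r set set \<Rightarrow> ('o, 'a) tricat" where
  "torsion_subcategory R T \<phi> V = full_subcategory T
     {X \<in> Obj T. \<forall>q\<in>Spec R - V. localization_zero R q (End_star T \<phi> X)}"

text \<open>\<open>i\<^sup>* \<circ> i\<^sub>*\<close>; the inclusion \<open>i\<close> is the identity on objects and on arrows.\<close>

definition Gamma_V ::
  "'r graded_ring \<Rightarrow> ('o, 'a) tricat \<Rightarrow> (int \<Rightarrow> 'r \<Rightarrow> 'o \<Rightarrow> 'a) \<Rightarrow> 'r set set \<Rightarrow> ('o, 'a, 'g) ab_functor \<Rightarrow>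
    ('o, 'a, ('o \<times> ('o \<Rightarrow> 'a \<Rightarrow> 'g) \<Rightarrow> 'a) set) ab_functor" where
  "Gamma_V R T \<phi> V F = upper_star (torsion_subcategory R T \<phi> V) T id id (lower_star id id F)"

definition Gamma_p ::
  "'r graded_ring \<Rightarrow> ('o, 'a) tricat \<Rightarrow> (int \<Rightarrow> 'r \<Rightarrow> 'o \<Rightarrow> 'a) \<Rightarrow> 'r set \<Rightarrow> ('o, 'a, 'g) ab_functor \<Rightarrow>
    ('o, 'a, ('o \<times> ('o \<Rightarrow> 'a \<Rightarrow> (int \<times> 'r \<times> 'g) set) \<Rightarrow> 'a) set) ab_functor" where
  "Gamma_p R T \<phi> p F = Gamma_V R T \<phi> (Vset R p) (functor_loc R T \<phi> p F)"

definition Supp ::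
  "'r graded_ring \<Rightarrow> ('o, 'a) tricat \<Rightarrow> (int \<Rightarrow> 'r \<Rightarrow> 'o \<Rightarrow> 'a) \<Rightarrow> ('o, 'a, 'g) ab_functor \<Rightarrow> 'r set set" where
  "Supp R T \<phi> F = {p \<in> Spec R. \<not> is_zero_functor T (Gamma_p R T \<phi> p F)}"


section \<open>Representable functors are objects of \<open>Coh T\<close>\<close>

context additive_category
begin

lemma Hom_carrier: "f \<in> hom_set T X Y \<longleftrightarrow> f \<in> Arr T \<and> Dom T f = X \<and> Cod T f = Y"
  by (auto simp: Hom_def)

lemma one_Hom: "\<one>\<^bsub>Hom T X Y\<^esub> = Zer T X Y"
  by (simp add: Hom_def)

lemma hom_obj: "f \<in> hom_set T X Y \<Longrightarrow> X \<in> Obj T \<and> Y \<in> Obj T"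
  using dom_obj cod_obj by (auto simp: Hom_carrier)

lemma zero_hom: "X \<in> Obj T \<Longrightarrow> Y \<in> Obj T \<Longrightarrow> Zer T X Y \<in> hom_set T X Y"
  using hom_group[of X Y] monoid.one_closed[of "Hom T X Y"]
  by (simp add: Hom_def comm_group_def comm_monoid_def)

lemma zero_if_idem:
  assumes "z \<in> hom_set T X Y" "Add T z z = z"
  shows "z = Zer T X Y"
proof -
  interpret G: comm_group "Hom T X Y" using hom_group hom_obj[OF assms(1)] by blast
  have "z \<otimes>\<^bsub>Hom T X Y\<^esub> z = z" using assms(2) by (simp add: Hom_def)
  then have "z = \<one>\<^bsub>Hom T X Y\<^esub>" using assms(1) G.l_cancel_one by blast
  then show ?thesis by (simp add: Hom_def)
qed

lemma add_zero: "X \<in> Obj T \<Longrightarrow> Y \<in> Obj T \<Longrightarrow> Add T (Zer T X Y) (Zer T X Y) = Zer T X Y"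
  using hom_group[of X Y] zero_hom[of X Y] monoid.l_one[of "Hom T X Y"]
  by (simp add: Hom_def comm_group_def comm_monoid_def)

lemma comp_zero_right:
  assumes X: "X \<in> Obj T" and g: "g \<in> hom_set T Y Z"
  shows "g \<bullet> Zer T X Y = Zer T X Z"
proof -
  have z: "Zer T X Y \<in> hom_set T X Y" using zero_hom X hom_obj[OF g] by blast
  show ?thesis
    using zero_if_idem[OF comp_hom[OF z g]] comp_add_right[OF z z g] add_zero[of X Y] X hom_obj[OF g]
    by simp
qed

lemma comp_zero_left:
  assumes Z: "Z \<in> Obj T" and f: "f \<in> hom_set T X Y"
  shows "Zer T Y Z \<bullet> f = Zer T X Z"
proof -
  have z: "Zer T Y Z \<in> hom_set T Y Z" using zero_hom Z hom_obj[OF f] by blast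
  show ?thesis
    using zero_if_idem[OF comp_hom[OF f z]] comp_add_left[OF f z z] add_zero[of Y Z] Z hom_obj[OF f]
    by simp
qed

end

lemma (in triangulated_category) cohomological_representable:
  assumes A: "A \<in> Obj T"
  shows "cohomological_functor T (representable T A)"
proof (intro cohomological_functor.intro additive_functor.intro additive_functor_axioms.intro
    cohomological_functor_axioms.intro, goal_cases)
  case 1 show ?case by (rule triangulated_category_axioms)
next
  case 2 show ?case by (rule additive_category_axioms)
next
  case (3 X) then show ?case using hom_group A by (simp only: representable_def ab_functor.simps)
next
  case (4 f X Y)
  have "(\<lambda>\<alpha>. \<alpha> \<bullet> f) \<in> hom (Hom T Y A) (Hom T X A)"
  proof (rule homI)
    fix x y assume "x \<in> hom_set T Y A" "y \<in> hom_set T Y A"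
    then show "(x \<otimes>\<^bsub>Hom T Y A\<^esub> y) \<bullet> f = (x \<bullet> f) \<otimes>\<^bsub>Hom T X A\<^esub> (y \<bullet> f)"
      using comp_add_left[OF 4(1)] by (simp add: Hom_def)
  qed (use comp_hom[OF 4(1)] in blast)
  then show ?case by (simp add: representable_def)
next
  case (5 X x) then show ?case using comp_id by (simp add: representable_def)
next
  case (6 f X Y g Z x) then show ?case using comp_assoc by (simp add: representable_def)
next
  case (7 f X Y g x) then show ?case using comp_add_right by (simp add: representable_def Hom_def)
next
  case (8 f g h)
  obtain X Y Z where o: "X \<in> Obj T" "Y \<in> Obj T" "Z \<in> Obj T" and
    fgh: "f \<in> hom_set T X Y" "g \<in> hom_set T Y Z" "h \<in> hom_set T Z (SigO T X)"
    using tri_arr[OF 8] by blast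
  have dc: "Dom T f = X" "Cod T f = Y" "Dom T g = Y" "Cod T g = Z" "Dom T h = Z"
    using fgh by (auto simp: Hom_carrier)
  obtain N where N: "is_zero_object T N" using zero_object by blast
  then have No: "N \<in> Obj T" by (simp add: is_zero_object_def)
  have dz: "Dom T (Idt T Y) = Y" "Dom T (Zer T Y Z) = Y" "Cod T (Zer T Y Z) = Z"
    if "Y \<in> Obj T" "Z \<in> Obj T" for Y Z
    using id_hom[OF that(1)] zero_hom[OF that] unfolding Hom_carrier by blast+
  have sx: "SigO T X' \<in> Obj T" if "X' \<in> Obj T" for X'
    using that susp_obj_bij bij_betwE by blast
  have gf: "g \<bullet> f = Zer T X Z"
  proof -
    have d: "Dom T (Idt T X) = X" "Dom T (Zer T X N) = X" "Dom T (Zer T N (SigO T X)) = N"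
      using dz o No sx by blast+
    have "\<exists>w\<in>hom_set T N Z. w \<bullet> Zer T X N = g \<bullet> f"
      using TR3[OF TR1_id[OF o(1) N] 8, of "Idt T X" f] id_hom[OF o(1)] fgh(1) unfolding d dc by blast
    then obtain w where w: "w \<in> hom_set T N Z" "w \<bullet> Zer T X N = g \<bullet> f" by blast
    then show ?thesis using comp_zero_right[OF o(1) w(1)] by simp
  qed
  obtain W where W: "W \<in> Obj T" "SigO T W = N"
    using susp_obj_bij No by (metis bij_betw_imp_surj_on imageE)
  have z: "Zer T W A \<in> hom_set T W A" by (rule zero_hom[OF W(1) A])
  have sz: "SigA T (Zer T W A) = Zer T N (SigO T A)"
    using zero_if_idem[OF susp_hom[OF z]] susp_add[OF z z] add_zero[OF W(1) A] W(2) by simp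
  have "Neg T (SigA T (Zer T W A)) = Zer T N (SigO T A)"
  proof -
    interpret G: comm_group "Hom T N (SigO T A)" using hom_group No sx A by blast
    have "Dom T (Zer T N (SigO T A)) = N" "Cod T (Zer T N (SigO T A)) = SigO T A"
      using dz(2,3) No sx[OF A] by blast+
    then show ?thesis using G.inv_one unfolding sz Neg_def one_Hom by simp
  qed
  then have tri: "(Zer T W A, Idt T A, Zer T A N) \<in> Tri T"
    using TR2[of "Zer T W A" W A "Idt T A" A "Zer T A N"] TR1_id[OF A N] W A No zero_hom id_hom by simp
  have lift: "\<exists>\<gamma>\<in>hom_set T Z A. \<beta> = \<gamma> \<bullet> g"
    if b: "\<beta> \<in> hom_set T Y A" "\<beta> \<bullet> f = Zer T X A" for \<beta>
  proof -
    have u: "Zer T X W \<in> hom_set T X W" by (rule zero_hom[OF o(1) W(1)])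
    have d: "Dom T (Zer T W A) = W" "Dom T (Idt T A) = A" "Dom T (Zer T A N) = A"
      using z id_hom[OF A] zero_hom[OF A No] unfolding Hom_carrier by blast+
    have "\<beta> \<bullet> f = Zer T W A \<bullet> Zer T X W" using b(2) comp_zero_left[OF A u] by simp
    then obtain w where "w \<in> hom_set T Z A" "w \<bullet> g = Idt T A \<bullet> \<beta>"
      using TR3[OF 8 tri, of "Zer T X W" \<beta>] u b(1) unfolding d dc by blast
    then show ?thesis using id_comp[OF b(1)] by force
  qed
  have zero: "(\<gamma> \<bullet> g) \<bullet> f = Zer T X A" if "\<gamma> \<in> hom_set T Z A" for \<gamma>
    using comp_assoc[OF fgh(1,2) that] gf comp_zero_right[OF o(1) that] by simp
  have "kernel (Hom T Y A) (Hom T X A) (\<lambda>\<beta>. \<beta> \<bullet> f) = (\<lambda>\<gamma>. \<gamma> \<bullet> g) ` hom_set T Z A"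
  proof (intro subset_antisym subsetI)
    fix \<beta> assume "\<beta> \<in> kernel (Hom T Y A) (Hom T X A) (\<lambda>\<beta>. \<beta> \<bullet> f)"
    then show "\<beta> \<in> (\<lambda>\<gamma>. \<gamma> \<bullet> g) ` hom_set T Z A"
      using lift[of \<beta>] unfolding kernel_def one_Hom by blast
  next
    fix \<beta> assume "\<beta> \<in> (\<lambda>\<gamma>. \<gamma> \<bullet> g) ` hom_set T Z A"
    then show "\<beta> \<in> kernel (Hom T Y A) (Hom T X A) (\<lambda>\<beta>. \<beta> \<bullet> f)"
      using zero comp_hom[OF fgh(2)] unfolding kernel_def one_Hom by blast
  qed
  then show ?case by (simp add: representable_def dc)
qed

end

theory Submission
  imports Defs
begin

text \<open>If \<open>End\<^sup>*(A)\<^sub>p = 0\<close>, some homogeneous \<open>s \<notin> p\<close> annihilates \<open>A\<close> and hence \<open>H\<^sub>A\<close>; then \<open>(H\<^sub>A)\<^sub>p = 0\<close>,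
  the zero object is terminal among the morphisms \<open>H\<^sub>X \<rightarrow> (H\<^sub>A)\<^sub>p\<close>, and the colimit vanishes.

  Conversely let \<open>End\<^sup>*(A)\<close> be finitely generated with \<open>End\<^sup>*(A)\<^sub>p \<noteq> 0\<close>. Starting from \<open>A\<close>, take
  successively the cones of homogeneous generators \<open>r\<close> of \<open>p\<close>. A cone of \<open>r : X \<rightarrow> \<Sigma>\<^sup>dX\<close> is
  annihilated by \<open>r\<^sup>2\<close>, so that the final object lies in \<open>T\<^bsub>V(p)\<^esub>\<close>. The long exact sequence shows that
  \<open>Hom\<^sup>*(X, A)\<close> stays noetherian and, by Nakayama's lemma, nonzero at \<open>p\<close>. Thus
  \<open>(H\<^sub>A)\<^sub>p(X) \<noteq> 0\<close> for some \<open>X\<close> in \<open>T\<^bsub>V(p)\<^esub>\<close>. A nonzero element of it is detected in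
  the colimit: evaluating the morphisms \<open>H\<^sub>Y \<rightarrow> (H\<^sub>A)\<^sub>p\<close> at \<open>X\<close> yields a map from the colimit at \<open>X\<close>
  to \<open>(H\<^sub>A)\<^sub>p(X)\<close>.\<close>

section \<open>Homogeneous components and homogeneous ideals\<close>

text \<open>Vanishing of a localized endomorphism ring is tested on one element:
  \<open>End*(X)\<close> dies at \<open>q\<close> exactly when some homogeneous \<open>s\<close>
  outside \<open>q\<close> acts as zero on \<open>X\<close>, because the identity of
  \<open>X\<close> has to become torsion. This condition, called \<open>killed\<close>, passes to
  cones and shifts, so the iterated cone is placed in the torsion subcategory without computing its
  endomorphisms. Along the cones \<open>A\<close> stays fixed and only \<open>X\<close> changes in
  \<open>Hom*(X, A)\<close>. What is carried along is that all graded submodules are finitely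
  generated: a long exact sequence produces kernels and images, and Nakayama's lemma needs a chain
  condition. The obstacle is that elements of \<open>R\<close> commute only up to sign. Hence
  fractions are left Ore fractions, and the module \<open>F*(X)\<close> agrees with
  \<open>Hom*(X, A)\<close> only after a twist by signs. Whether an element vanishes does not depend
  on its sign, so the central notion is torsion of elements, and the two modules are compared only
  through it. The colimit is used through its presentation as a quotient of a direct sum: it
  vanishes if the relations exhaust the sum, and it is nonzero if some cocone is nonzero on an
  element.\<close>

context graded_commutative_ring
begin

lemma grade_closed: "r \<in> grade R n \<Longrightarrow> r \<in> carrier R"
  using subgroup.mem_carrier[OF grade_subgroup] by simp

lemma grade_zero: "\<zero> \<in> grade R n"
  using subgroup.one_closed[OF grade_subgroup] by simp

lemma grade_add: "r \<in> grade R n \<Longrightarrow> s \<in> grade R n \<Longrightarrow> r \<oplus> s \<in> grade R n"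
  using subgroup.m_closed[OF grade_subgroup] by simp

lemma grade_neg: "r \<in> grade R n \<Longrightarrow> \<ominus> r \<in> grade R n"
  using subgroup.m_inv_closed[OF grade_subgroup] by (simp add: a_inv_def)

lemma grade_mult': "r \<in> grade R m \<Longrightarrow> s \<in> grade R n \<Longrightarrow> m + n = k \<Longrightarrow> r \<otimes> s \<in> grade R k"
  using grade_mult by blast

text \<open>The sign is absorbed into the factor that moves. Since \<open>s'\<close> is
  \<open>s\<close> or its negative, it has the same degree and lies in the same ideals, so later
  arguments need not distinguish parities.\<close>

lemma grade_swap:
  assumes r: "r \<in> grade R m" and s: "s \<in> grade R n"
  obtains s' where "s' \<in> {s, \<ominus> s}" "s' \<in> grade R n" "r \<otimes> s = s' \<otimes> r"
proof (cases "even (m * n)")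
  case True
  then show ?thesis using grade_comm[OF r s] that[of s] s by simp
next
  case False
  then have "r \<otimes> s = \<ominus> s \<otimes> r"
    using grade_comm[OF r s] grade_closed[OF r] grade_closed[OF s] by (simp add: l_minus)
  then show ?thesis using that[of "\<ominus> s"] grade_neg[OF s] by blast
qed

lemma hcomp_decomp: "x \<in> carrier R \<Longrightarrow> is_decomp R x (hcomp R x)"
  unfolding hcomp_def by (rule theI'[OF grade_decomp])

lemma hcomp_unique: "x \<in> carrier R \<Longrightarrow> is_decomp R x c \<Longrightarrow> hcomp R x = c"
  using grade_decomp hcomp_decomp by blast

lemma hcomp_grade: "x \<in> carrier R \<Longrightarrow> hcomp R x n \<in> grade R n"
  using hcomp_decomp unfolding is_decomp_def by blast

lemma hcomp_finite: "x \<in> carrier R \<Longrightarrow> finite {n. hcomp R x n \<noteq> \<zero>}"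
  using hcomp_decomp unfolding is_decomp_def by blast

lemma hcomp_sum:
  assumes "x \<in> carrier R" "finite B" "{n. hcomp R x n \<noteq> \<zero>} \<subseteq> B"
  shows "x = (\<Oplus>n\<in>B. hcomp R x n)"
proof -
  have "x = (\<Oplus>n\<in>{n. hcomp R x n \<noteq> \<zero>}. hcomp R x n)"
    using hcomp_decomp[OF assms(1)] unfolding is_decomp_def by blast
  also have "\<dots> = (\<Oplus>n\<in>B. hcomp R x n)"
    by (rule add.finprod_mono_neutral_cong_left)
      (use assms hcomp_grade[OF assms(1)] grade_closed in auto)
  finally show ?thesis .
qed

lemma hcomp_eqI:
  assumes c: "\<And>n. c n \<in> grade R n" and B: "finite B" "{n. c n \<noteq> \<zero>} \<subseteq> B" and x: "x = (\<Oplus>n\<in>B. c n)"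
  shows "hcomp R x = c"
proof (rule hcomp_unique)
  show "x \<in> carrier R" unfolding x using c grade_closed by (intro finsum_closed) auto
  have "(\<Oplus>n\<in>{n. c n \<noteq> \<zero>}. c n) = (\<Oplus>n\<in>B. c n)"
    by (rule add.finprod_mono_neutral_cong_left) (use B c grade_closed in auto)
  then show "is_decomp R x c"
    unfolding is_decomp_def using c x finite_subset[OF B(2,1)] by simp
qed

lemma hcomp_add:
  assumes "x \<in> carrier R" "y \<in> carrier R"
  shows "hcomp R (x \<oplus> y) n = hcomp R x n \<oplus> hcomp R y n"
proof -
  let ?B = "{n. hcomp R x n \<noteq> \<zero>} \<union> {n. hcomp R y n \<noteq> \<zero>}"
  have f: "finite ?B" using hcomp_finite assms by blast
  have "x \<oplus> y = (\<Oplus>n\<in>?B. hcomp R x n) \<oplus> (\<Oplus>n\<in>?B. hcomp R y n)"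
    using hcomp_sum[OF assms(1) f] hcomp_sum[OF assms(2) f] by auto
  also have "\<dots> = (\<Oplus>n\<in>?B. hcomp R x n \<oplus> hcomp R y n)"
    by (rule add.finprod_multf[symmetric]) (use assms hcomp_grade grade_closed in blast)+
  finally have "hcomp R (x \<oplus> y) = (\<lambda>n. hcomp R x n \<oplus> hcomp R y n)"
    by (intro hcomp_eqI[OF _ f]) (use assms hcomp_grade grade_add in auto)
  then show ?thesis by simp
qed

lemma hcomp_homogeneous:
  assumes "r \<in> grade R n"
  shows "hcomp R r m = (if m = n then r else \<zero>)"
proof -
  have "hcomp R r = (\<lambda>m. if m = n then r else \<zero>)"
    by (rule hcomp_eqI[of _ "{n}"]) (use assms grade_zero grade_closed in auto)
  then show ?thesis by simp
qed

lemma ideal_finsum_closed: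
  assumes "ideal I R" "finite A" "\<And>i. i \<in> A \<Longrightarrow> f i \<in> I"
  shows "finsum R f A \<in> I"
proof -
  interpret I: ideal I R by fact
  show ?thesis using assms(2,3)
  proof (induction A rule: finite_induct)
    case (insert a A)
    then have "finsum R f (insert a A) = f a \<oplus> finsum R f A"
      using I.a_subset by (intro finsum_insert) auto
    then show ?case using insert by simp
  qed simp
qed

lemma homogeneous_ideal_iff:
  assumes "homogeneous_ideal R I" "x \<in> carrier R"
  shows "x \<in> I \<longleftrightarrow> (\<forall>n. hcomp R x n \<in> I)"
  using assms hcomp_sum[OF assms(2) hcomp_finite[OF assms(2)] subset_refl]
    ideal_finsum_closed[OF _ hcomp_finite[OF assms(2)]]
  unfolding homogeneous_ideal_def by metis

end

section \<open>Graded modules\<close>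

locale graded_left_module = graded_commutative_ring R
  for R :: "'r graded_ring" (structure) and M :: "('r, 'm) graded_module" +
  assumes part_group: "comm_group (part M n)"
    and act_hom: "r \<in> grade R d \<Longrightarrow> act M d n r \<in> hom (part M n) (part M (d + n))"
    and act_add: "r \<in> grade R d \<Longrightarrow> s \<in> grade R d \<Longrightarrow> x \<in> carrier (part M n) \<Longrightarrow>
      act M d n (r \<oplus> s) x = act M d n r x \<otimes>\<^bsub>part M (d + n)\<^esub> act M d n s x"
    and act_mult: "r \<in> grade R d \<Longrightarrow> s \<in> grade R e \<Longrightarrow> x \<in> carrier (part M n) \<Longrightarrow>
      act M (d + e) n (r \<otimes> s) x = act M d (e + n) r (act M e n s x)"
    and act_one: "x \<in> carrier (part M n) \<Longrightarrow> act M 0 n \<one> x = x"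

text \<open>Graded submodules are sets of pairs of a degree and an element, because all parts share
  the type \<open>'m\<close> and an element alone does not determine its degree.\<close>

inductive_set gspan :: "'r graded_ring \<Rightarrow> ('r, 'm) graded_module \<Rightarrow> (int \<times> 'm) set \<Rightarrow> (int \<times> 'm) set"
  for R M G where
    gspan_base: "(k, x) \<in> G \<Longrightarrow> (k, x) \<in> gspan R M G"
  | gspan_one: "(k, \<one>\<^bsub>part M k\<^esub>) \<in> gspan R M G"
  | gspan_mult: "(k, x) \<in> gspan R M G \<Longrightarrow> (k, y) \<in> gspan R M G \<Longrightarrow> (k, x \<otimes>\<^bsub>part M k\<^esub> y) \<in> gspan R M G"
  | gspan_act: "(k, x) \<in> gspan R M G \<Longrightarrow> r \<in> grade R d \<Longrightarrow> (d + k, act M d k r x) \<in> gspan R M G"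

text \<open>Closure under inverses is implied, since \<open>-1\<close> acts.\<close>

definition gsub :: "'r graded_ring \<Rightarrow> ('r, 'm) graded_module \<Rightarrow> (int \<times> 'm) set \<Rightarrow> bool" where
  "gsub R M N \<longleftrightarrow> (\<forall>k x. (k, x) \<in> N \<longrightarrow> x \<in> carrier (part M k)) \<and> (\<forall>k. (k, \<one>\<^bsub>part M k\<^esub>) \<in> N) \<and>
     (\<forall>k x y. (k, x) \<in> N \<longrightarrow> (k, y) \<in> N \<longrightarrow> (k, x \<otimes>\<^bsub>part M k\<^esub> y) \<in> N) \<and>
     (\<forall>k x d r. (k, x) \<in> N \<longrightarrow> r \<in> grade R d \<longrightarrow> (d + k, act M d k r x) \<in> N)"

text \<open>Finite generation of all graded submodules is the form that passes through exact
  sequences. The chain condition is extracted from it only where Nakayama's lemma needs it.\<close>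

definition gnoetherian :: "'r graded_ring \<Rightarrow> ('r, 'm) graded_module \<Rightarrow> bool" where
  "gnoetherian R M \<longleftrightarrow> (\<forall>N. gsub R M N \<longrightarrow> (\<exists>G. finite G \<and> N = gspan R M G))"

lemma gsubI:
  assumes "\<And>k x. (k, x) \<in> N \<Longrightarrow> x \<in> carrier (part M k)" "\<And>k. (k, \<one>\<^bsub>part M k\<^esub>) \<in> N"
    "\<And>k x y. (k, x) \<in> N \<Longrightarrow> (k, y) \<in> N \<Longrightarrow> (k, x \<otimes>\<^bsub>part M k\<^esub> y) \<in> N"
    "\<And>k x d r. (k, x) \<in> N \<Longrightarrow> r \<in> grade R d \<Longrightarrow> (d + k, act M d k r x) \<in> N"
  shows "gsub R M N"
  using assms unfolding gsub_def by blast

lemma gsubD: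
  assumes "gsub R M N"
  shows "(k, x) \<in> N \<Longrightarrow> x \<in> carrier (part M k)" "(k, \<one>\<^bsub>part M k\<^esub>) \<in> N"
    "(k, x) \<in> N \<Longrightarrow> (k, y) \<in> N \<Longrightarrow> (k, x \<otimes>\<^bsub>part M k\<^esub> y) \<in> N"
    "(k, x) \<in> N \<Longrightarrow> r \<in> grade R d \<Longrightarrow> (d + k, act M d k r x) \<in> N"
  using assms unfolding gsub_def by blast+

lemma gsub_Int: "gsub R M N \<Longrightarrow> gsub R M N' \<Longrightarrow> gsub R M (N \<inter> N')"
  unfolding gsub_def by simp

lemma gspan_minimal:
  assumes "gsub R M N" "G \<subseteq> N"
  shows "gspan R M G \<subseteq> N"
proof clarify
  fix k x assume "(k, x) \<in> gspan R M G"
  then show "(k, x) \<in> N"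
    by induction (use assms gsubD[OF assms(1)] in auto)
qed

lemma gspan_superset: "G \<subseteq> gspan R M G"
  using gspan_base by fast

lemma gspan_mono: "G \<subseteq> H \<Longrightarrow> gspan R M G \<subseteq> gspan R M H"
proof clarify
  fix k x assume "G \<subseteq> H" "(k, x) \<in> gspan R M G"
  from this(2,1) show "(k, x) \<in> gspan R M H"
    by induction (auto intro: gspan.intros)
qed

text \<open>Makes homogeneous ideals into graded submodules, so that the noetherian hypothesis on
  \<open>R\<close> becomes the starting point for the modules over it.\<close>

definition regular_module :: "'r graded_ring \<Rightarrow> ('r, 'r) graded_module" where
  "regular_module R = \<lparr>part = (\<lambda>n. \<lparr>carrier = grade R n, monoid.mult = add R, one = \<zero>\<^bsub>R\<^esub>\<rparr>),
     act = (\<lambda>d n r x. r \<otimes>\<^bsub>R\<^esub> x)\<rparr>"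

context graded_left_module
begin

lemma part_comm_group [simp]: "comm_group (part M n)"
  and part_is_group [simp]: "group (part M n)"
  and part_is_monoid [simp]: "monoid (part M n)"
  using part_group comm_group.axioms(2) group.is_monoid by blast+

lemma act_closed [simp]:
  "r \<in> grade R d \<Longrightarrow> x \<in> carrier (part M n) \<Longrightarrow> act M d n r x \<in> carrier (part M (d + n))"
  by (rule hom_in_carrier[OF act_hom])

lemma act_closed':
  "r \<in> grade R d \<Longrightarrow> x \<in> carrier (part M n) \<Longrightarrow> d + n = k \<Longrightarrow> act M d n r x \<in> carrier (part M k)"
  using act_closed by blast

lemma act_distrib:
  "r \<in> grade R d \<Longrightarrow> x \<in> carrier (part M n) \<Longrightarrow> y \<in> carrier (part M n) \<Longrightarrow>
    act M d n r (x \<otimes>\<^bsub>part M n\<^esub> y) = act M d n r x \<otimes>\<^bsub>part M (d + n)\<^esub> act M d n r y"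
  by (rule hom_mult[OF act_hom])

lemma act_unit [simp]: "r \<in> grade R d \<Longrightarrow> act M d n r \<one>\<^bsub>part M n\<^esub> = \<one>\<^bsub>part M (d + n)\<^esub>"
  using hom_one[OF act_hom] by simp

lemma act_zero [simp]:
  assumes "x \<in> carrier (part M n)"
  shows "act M d n \<zero> x = \<one>\<^bsub>part M (d + n)\<^esub>"
proof -
  interpret G: group "part M (d + n)" by simp
  have "act M d n \<zero> x \<otimes>\<^bsub>part M (d + n)\<^esub> act M d n \<zero> x = act M d n \<zero> x"
    using act_add[OF grade_zero grade_zero assms, of d] by simp
  then show ?thesis using act_closed[OF grade_zero assms, of d] G.l_cancel_one by blast
qed

lemma act_neg:
  assumes "r \<in> grade R d" "x \<in> carrier (part M n)"
  shows "act M d n (\<ominus> r) x = inv\<^bsub>part M (d + n)\<^esub> act M d n r x"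
proof -
  interpret G: group "part M (d + n)" by simp
  have "act M d n (\<ominus> r) x \<otimes>\<^bsub>part M (d + n)\<^esub> act M d n r x = \<one>\<^bsub>part M (d + n)\<^esub>"
    using act_add[OF grade_neg assms(1,2), of r] assms grade_closed by (simp add: l_neg)
  then show ?thesis using G.inv_equality assms grade_neg by simp
qed

lemma act_mult':
  "r \<in> grade R d \<Longrightarrow> s \<in> grade R e \<Longrightarrow> x \<in> carrier (part M n) \<Longrightarrow> k = d + e \<Longrightarrow> j = e + n \<Longrightarrow>
      act M k n (r \<otimes> s) x = act M d j r (act M e n s x)"
  using act_mult by blast

lemma gsub_inv:
  assumes "gsub R M N" "(k, x) \<in> N"
  shows "(k, inv\<^bsub>part M k\<^esub> x) \<in> N"
proof -
  have x: "x \<in> carrier (part M k)" by (rule gsubD(1)[OF assms])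
  have "(0 + k, act M 0 k (\<ominus> \<one>) x) \<in> N"
    by (rule gsubD(4)[OF assms grade_neg[OF grade_one]])
  then show ?thesis using act_neg[OF grade_one x] act_one[OF x] by simp
qed

lemma gsub_gspan:
  assumes "\<And>k x. (k, x) \<in> G \<Longrightarrow> x \<in> carrier (part M k)"
  shows "gsub R M (gspan R M G)"
proof (rule gsubI)
  fix k x assume "(k, x) \<in> gspan R M G"
  then show "x \<in> carrier (part M k)"
  proof induction
    case (gspan_mult k x y)
    then show ?case using monoid.m_closed[of "part M k"] by simp
  qed (use assms in \<open>auto intro: monoid.one_closed\<close>)
qed (auto intro: gspan.intros)

end

lemma (in graded_commutative_ring) regular_module: "graded_left_module R (regular_module R)"
proof -
  have g: "comm_group \<lparr>carrier = grade R n, monoid.mult = add R, one = \<zero>\<rparr>" (is "comm_group ?G") for n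
  proof (rule comm_groupI)
    fix x assume "x \<in> carrier ?G"
    then show "\<exists>y\<in>carrier ?G. y \<otimes>\<^bsub>?G\<^esub> x = \<one>\<^bsub>?G\<^esub>"
      using grade_neg[of x n] l_neg[of x] grade_closed[of x n] by auto
  next
    fix x y assume "x \<in> carrier ?G" "y \<in> carrier ?G"
    then show "x \<otimes>\<^bsub>?G\<^esub> y \<in> carrier ?G" "x \<otimes>\<^bsub>?G\<^esub> y = y \<otimes>\<^bsub>?G\<^esub> x"
      using grade_add[of x n y] a_comm[of x y] grade_closed[of _ n] by auto
  next
    fix x y z assume "x \<in> carrier ?G" "y \<in> carrier ?G" "z \<in> carrier ?G"
    then show "x \<otimes>\<^bsub>?G\<^esub> y \<otimes>\<^bsub>?G\<^esub> z = x \<otimes>\<^bsub>?G\<^esub> (y \<otimes>\<^bsub>?G\<^esub> z)"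
      using a_assoc[of x y z] grade_closed[of _ n] by auto
  qed (use grade_zero grade_closed[of _ n] in auto)
  show ?thesis
  proof (intro graded_left_module.intro graded_left_module_axioms.intro graded_commutative_ring_axioms, goal_cases)
    case (1 n) then show ?case using g by (simp add: regular_module_def)
  next
    case (2 r d n)
    then show ?case
      using grade_mult[of r d _ n] r_distr[of _ _ r] grade_closed by (simp add: regular_module_def hom_def)
  next
    case (3 r d s x n)
    then show ?case using l_distr[of r s x] grade_closed by (simp add: regular_module_def)
  next
    case (4 r d s e x n)
    then show ?case using m_assoc[of r s x] grade_closed by (simp add: regular_module_def)
  next
    case (5 x n)
    then show ?case using grade_closed by (simp add: regular_module_def)
  qed
qed

section \<open>Noetherian graded modules\<close>

lemma (in graded_commutative_ring) hcomp_neg: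
  assumes "x \<in> carrier R"
  shows "hcomp R (\<ominus> x) n = \<ominus> hcomp R x n"
proof -
  have "hcomp R x n \<oplus> hcomp R (\<ominus> x) n = \<zero>"
    using hcomp_add[of x "\<ominus> x" n] assms hcomp_homogeneous[OF grade_zero, of n n] by (simp add: r_neg)
  then show ?thesis
    using assms hcomp_grade[of x n] hcomp_grade[of "\<ominus> x" n] grade_closed add.inv_equality
    by (metis a_comm a_inv_closed a_inv_def)
qed

text \<open>The elements all of whose components lie in \<open>J\<close> are the inhomogeneous
  closure of \<open>J\<close>. A graded submodule is closed under multiplication from the left only;
  \<open>x r\<close> is \<open>r x\<close> up to sign, which gives the other side of the ideal
  (\<open>Jact'\<close>).\<close>

lemma (in graded_commutative_ring) ideal_of_graded_submodule:
  assumes J: "gsub R (regular_module R) J"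
  shows "ideal {x \<in> carrier R. \<forall>n. (n, hcomp R x n) \<in> J} R" (is "ideal ?I R")
proof -
  have J0: "(n, \<zero>) \<in> J" for n using gsubD(2)[OF J, of n] by (simp add: regular_module_def)
  have Jadd: "(n, x \<oplus> y) \<in> J" if "(n, x) \<in> J" "(n, y) \<in> J" for n x y
    using gsubD(3)[OF J that] by (simp add: regular_module_def)
  have Jg: "x \<in> grade R n" if "(n, x) \<in> J" for n x
    using gsubD(1)[OF J that] by (simp add: regular_module_def)
  have Jact: "(d + n, r \<otimes> x) \<in> J" if "(n, x) \<in> J" "r \<in> grade R d" for n d r x
    using gsubD(4)[OF J that] by (simp add: regular_module_def)
  have Jneg: "(n, \<ominus> x) \<in> J" if "(n, x) \<in> J" for n x
    using graded_left_module.gsub_inv[OF regular_module J that] Jact[OF that grade_neg[OF grade_one]]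
      grade_closed[OF Jg[OF that]] by (simp add: l_minus)
  have Jact': "(d + n, x \<otimes> r) \<in> J" if x: "(n, x) \<in> J" and r: "r \<in> grade R d" for n d r x
  proof -
    obtain x' where "x' \<in> {x, \<ominus> x}" "r \<otimes> x = x' \<otimes> r" by (rule grade_swap[OF r Jg[OF x]])
    moreover have "x \<otimes> r \<in> {r \<otimes> x, \<ominus> (r \<otimes> x)}"
      using calculation grade_closed[OF Jg[OF x]] grade_closed[OF r] by (auto simp: l_minus)
    ultimately show ?thesis using Jact[OF x r] Jneg[OF Jact[OF x r]] by auto
  qed
  have homI: "x \<in> ?I" if "(n, x) \<in> J" for n x
    using hcomp_homogeneous[OF Jg[OF that]] J0 that grade_closed[OF Jg[OF that]] by simp
  have addI: "x \<oplus> y \<in> ?I" if "x \<in> ?I" "y \<in> ?I" for x y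
    using that Jadd by (simp add: hcomp_add)
  have z: "\<zero> \<in> ?I" using homI[OF J0] .
  have sumI: "finsum R f A \<in> ?I" if "finite A" "\<And>i. i \<in> A \<Longrightarrow> f i \<in> ?I" for f :: "int \<Rightarrow> _" and A
    using that
  proof (induction A rule: finite_induct)
    case empty show ?case using z by (simp only: add.finprod_empty)
  next
    case (insert a A)
    then have "finsum R f (insert a A) = f a \<oplus> finsum R f A" by (intro finsum_insert) auto
    then show ?case using insert addI by simp
  qed
  \<comment> \<open>Neither factor is homogeneous. Products of components are handled first
    (\<open>1\<close>), then \<open>a\<close> is reassembled from its components (\<open>2\<close>),
    and finally \<open>x\<close>.\<close>
  have mult: "a \<otimes> x \<in> ?I \<and> x \<otimes> a \<in> ?I" if a: "a \<in> carrier R" and x: "x \<in> ?I" for a x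
  proof -
    let ?A = "{n. hcomp R a n \<noteq> \<zero>}" and ?B = "{n. hcomp R x n \<noteq> \<zero>}"
    have xc: "x \<in> carrier R" using x by simp
    have fA: "finite ?A" and fB: "finite ?B" using hcomp_finite a xc by blast+
    have cA: "hcomp R a i \<in> carrier R" and cB: "hcomp R x i \<in> carrier R" for i
      using hcomp_grade a xc grade_closed by blast+
    have ea: "a = (\<Oplus>n\<in>?A. hcomp R a n)" and ex: "x = (\<Oplus>n\<in>?B. hcomp R x n)"
      using hcomp_sum a xc fA fB by blast+
    have 1: "hcomp R a i \<otimes> hcomp R x j \<in> ?I \<and> hcomp R x j \<otimes> hcomp R a i \<in> ?I" for i j
      using homI[OF Jact] homI[OF Jact'] x hcomp_grade[OF a] by blast
    have 2: "a \<otimes> hcomp R x j \<in> ?I \<and> hcomp R x j \<otimes> a \<in> ?I" for j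
    proof -
      have "a \<otimes> hcomp R x j = (\<Oplus>i\<in>?A. hcomp R a i \<otimes> hcomp R x j)"
        by (subst ea, rule finsum_ldistr) (use fA cA cB in auto)
      moreover have "hcomp R x j \<otimes> a = (\<Oplus>i\<in>?A. hcomp R x j \<otimes> hcomp R a i)"
        by (subst ea, rule finsum_rdistr) (use fA cA cB in auto)
      ultimately show ?thesis using 1 sumI[OF fA] by simp
    qed
    have "x \<otimes> a = (\<Oplus>i\<in>?B. hcomp R x i \<otimes> a)"
      by (subst ex, rule finsum_ldistr) (use fB cB a in auto)
    moreover have "a \<otimes> x = (\<Oplus>i\<in>?B. a \<otimes> hcomp R x i)"
      by (subst ex, rule finsum_rdistr) (use fB cB a in auto)
    ultimately show ?thesis using 2 sumI[OF fB] by simp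
  qed
  show ?thesis
  proof (rule idealI)
    show "ring R" by (rule ring_axioms)
    show "subgroup ?I (add_monoid R)"
    proof (rule add.subgroupI)
      show "?I \<noteq> {}" using z by blast
      show "\<ominus> a \<in> ?I" if "a \<in> ?I" for a
        using that Jneg hcomp_neg by simp
    qed (use addI in auto)
  qed (use mult in auto)
qed

text \<open>The generators \<open>A\<close> of the ideal attached to \<open>J\<close> may be
  inhomogeneous. Their finitely many nonzero components, collected in \<open>B\<close>, lie in
  \<open>J\<close> and span it.\<close>

lemma (in noetherian_graded_commutative_ring) regular_module_noetherian:
  "gnoetherian R (regular_module R)"
  unfolding gnoetherian_def
proof (intro allI impI)
  fix J assume J: "gsub R (regular_module R) J"
  have Jg: "x \<in> grade R n" if "(n, x) \<in> J" for n x
    using gsubD(1)[OF J that] by (simp add: regular_module_def)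
  have J0: "(n, \<zero>) \<in> J" for n using gsubD(2)[OF J, of n] by (simp add: regular_module_def)
  define I where "I = {x \<in> carrier R. \<forall>n. (n, hcomp R x n) \<in> J}"
  have "homogeneous_ideal R I" unfolding homogeneous_ideal_def
  proof (intro conjI ballI allI)
    show "ideal I R" unfolding I_def by (rule ideal_of_graded_submodule[OF J])
    fix x n assume x: "x \<in> I"
    then have "(n, hcomp R x n) \<in> J" by (simp add: I_def)
    then show "hcomp R x n \<in> I"
      using hcomp_homogeneous[OF Jg] J0 grade_closed[OF Jg] unfolding I_def by simp
  qed
  then obtain A where A: "finite A" "A \<subseteq> carrier R" "I = Idl A"
    using homogeneous_finitely_generated by blast
  define B where "B = (\<Union>a\<in>A. (\<lambda>n. (n, hcomp R a n)) ` {n. hcomp R a n \<noteq> \<zero>})"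
  have fB: "finite B" unfolding B_def using A(1,2) hcomp_finite by blast
  have AI: "A \<subseteq> I" using A genideal_self by blast
  then have BJ: "B \<subseteq> J" unfolding B_def I_def by blast
  have BJ': "gspan R (regular_module R) B \<subseteq> J" by (rule gspan_minimal[OF J BJ])
  have "gsub R (regular_module R) (gspan R (regular_module R) B)"
    using BJ gsubD(1)[OF J] by (intro graded_left_module.gsub_gspan[OF regular_module]) blast
  \<comment> \<open>The span of \<open>B\<close> is itself attached to an ideal. That ideal contains
    \<open>A\<close>, hence all of \<open>I\<close>; comparing homogeneous elements gives the
    inclusion of \<open>J\<close> in the span.\<close>
  note K = ideal_of_graded_submodule[OF this]
  have "(n, hcomp R a n) \<in> gspan R (regular_module R) B" if "a \<in> A" for a n
  proof (cases "hcomp R a n = \<zero>")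
    case True then show ?thesis using gspan_one[of n "regular_module R" R B] by (simp add: regular_module_def)
  next
    case False then show ?thesis using that unfolding B_def by (intro gspan_base) blast
  qed
  then have IK: "I \<subseteq> {x \<in> carrier R. \<forall>n. (n, hcomp R x n) \<in> gspan R (regular_module R) B}"
    unfolding A(3) using A(2) by (intro genideal_minimal K) blast
  have "J \<subseteq> gspan R (regular_module R) B"
  proof clarify
    fix n x assume x: "(n, x) \<in> J"
    then have "x \<in> I" using hcomp_homogeneous[OF Jg[OF x]] J0 grade_closed[OF Jg[OF x]] unfolding I_def by simp
    then have "(n, hcomp R x n) \<in> gspan R (regular_module R) B" using IK by blast
    then show "(n, x) \<in> gspan R (regular_module R) B" using hcomp_homogeneous[OF Jg[OF x], of n] by simp
  qed
  then show "\<exists>G. finite G \<and> J = gspan R (regular_module R) G" using fB BJ' by blast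
qed

text \<open>\<open>Z\<close> is a linear correspondence rather than a map: for a module generated by \<open>x\<^sub>0\<close> and others, \<open>Z\<close>
  relates an element to its possible, not unique, coefficients at \<open>x\<^sub>0\<close>. For extensions, \<open>Z\<close> is the
  graph of the quotient map.\<close>

lemma finitely_generated_by_correspondence:
  assumes M: "graded_left_module R M" and L: "graded_left_module R L"
    and N: "gsub R M N" and noeth: "gnoetherian R L"
    and Zc: "\<And>k x c. Z k x c \<Longrightarrow> (k, x) \<in> N \<and> c \<in> carrier (part L (k + b))"
    and Ztot: "\<And>k x. (k, x) \<in> N \<Longrightarrow> \<exists>c. Z k x c"
    and Zone: "\<And>k. Z k \<one>\<^bsub>part M k\<^esub> \<one>\<^bsub>part L (k + b)\<^esub>"
    and Zmult: "\<And>k x y c d. Z k x c \<Longrightarrow> Z k y d \<Longrightarrow> Z k (x \<otimes>\<^bsub>part M k\<^esub> y) (c \<otimes>\<^bsub>part L (k + b)\<^esub> d)"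
    and Zact: "\<And>k x c e r. Z k x c \<Longrightarrow> r \<in> grade R e \<Longrightarrow> Z (e + k) (act M e k r x) (act L e (k + b) r c)"
    and ker: "\<exists>G. finite G \<and> {(k, x). Z k x \<one>\<^bsub>part L (k + b)\<^esub>} = gspan R M G"
  shows "\<exists>G. finite G \<and> N = gspan R M G"
proof -
  interpret M: graded_left_module R M by fact
  interpret L: graded_left_module R L by fact
  \<comment> \<open>The coefficients that occur form a graded submodule of \<open>L\<close>, with
    degrees moved by \<open>b\<close>. Lifts of its generators together with generators of the
    kernel will span \<open>N\<close>.\<close>
  define J where "J = {(j, c). \<exists>x. Z (j - b) x c}"
  have "gsub R L J"
  proof (rule gsubI)
    fix k x assume "(k, x) \<in> J" then show "x \<in> carrier (part L k)"
      using Zc[of "k - b"] by (auto simp: J_def)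
  next
    fix k show "(k, \<one>\<^bsub>part L k\<^esub>) \<in> J" using Zone[of "k - b"] by (auto simp: J_def)
  next
    fix k x y assume "(k, x) \<in> J" "(k, y) \<in> J" then show "(k, x \<otimes>\<^bsub>part L k\<^esub> y) \<in> J"
      using Zmult[of "k - b"] by (fastforce simp: J_def)
  next
    fix k x d r assume x: "(k, x) \<in> J" and r: "r \<in> grade R d"
    then obtain y where "Z (k - b) y x" by (auto simp: J_def)
    from Zact[OF this r] show "(d + k, act L d k r x) \<in> J" by (auto simp: J_def algebra_simps)
  qed
  then obtain B where B: "finite B" "J = gspan R L B" using noeth unfolding gnoetherian_def by blast
  have "\<forall>z\<in>B. \<exists>x. Z (fst z - b) x (snd z)"
    using gspan_superset[of B R L] B(2) unfolding J_def by fastforce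
  then obtain n where n: "\<And>z. z \<in> B \<Longrightarrow> Z (fst z - b) (n z) (snd z)" by metis
  obtain G0 where G0: "finite G0" "{(k, x). Z k x \<one>\<^bsub>part L (k + b)\<^esub>} = gspan R M G0"
    using ker by blast
  define G where "G = (\<lambda>z. (fst z - b, n z)) ` B \<union> G0"
  have "gspan R M G \<subseteq> N"
  proof (rule gspan_minimal[OF N])
    show "G \<subseteq> N" using gspan_superset[of G0 R M] G0(2) Zc n unfolding G_def by fast
  qed
  moreover have "N \<subseteq> gspan R M G"
  proof clarify
    have Gc: "x \<in> carrier (part M k)" if "(k, x) \<in> G" for k x
      using that \<open>gspan R M G \<subseteq> N\<close> gspan_superset[of G R M] gsubD(1)[OF N] by blast
    note sG = M.gsub_gspan[OF Gc]
    \<comment> \<open>Lifting respects all rules that build the span, so every coefficient in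
      \<open>J\<close> has a lift inside the span of \<open>G\<close>.\<close>
    have lift: "\<exists>x. (j - b, x) \<in> gspan R M G \<and> Z (j - b) x c" if "(j, c) \<in> gspan R L B" for j c
      using that
    proof induction
      case (gspan_base k x)
      have "(k - b, n (k, x)) \<in> G" using gspan_base unfolding G_def by force
      then show ?case using n[OF gspan_base] gspan.gspan_base by fastforce
    next
      case (gspan_one k)
      show ?case using Zone[of "k - b"] gspan.gspan_one by fastforce
    next
      case (gspan_mult k x y)
      then obtain x' y' where "(k - b, x') \<in> gspan R M G" "Z (k - b) x' x"
        "(k - b, y') \<in> gspan R M G" "Z (k - b) y' y" by blast
      then show ?case using Zmult[of "k - b" x' x y' y] gspan.gspan_mult[of "k - b" x' R M G y'] by fastforce
    next
      case (gspan_act k x r d)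
      then obtain x' where x': "(k - b, x') \<in> gspan R M G" "Z (k - b) x' x" by blast
      have "d + (k - b) = d + k - b" "k - b + b = k" by auto
      then show ?case using Zact[OF x'(2) gspan_act(2)] gspan.gspan_act[OF x'(1) gspan_act(2)] by metis
    qed
    fix k x assume x: "(k, x) \<in> N"
    then obtain c where c: "Z k x c" using Ztot by blast
    then have "(k + b, c) \<in> J" unfolding J_def by auto
    then obtain y where y: "(k, y) \<in> gspan R M G" "Z k y c" using lift[of "k + b" c] B(2) by auto
    interpret Mk: comm_group "part M k" by simp
    interpret Lk: comm_group "part L (k + b)" by simp
    have cc: "x \<in> carrier (part M k)" "y \<in> carrier (part M k)" "c \<in> carrier (part L (k + b))"
      using gsubD(1)[OF N] x Zc y c by blast+
    have "Z (0 + k) (act M 0 k (\<ominus>\<^bsub>R\<^esub> \<one>\<^bsub>R\<^esub>) y) (act L 0 (k + b) (\<ominus>\<^bsub>R\<^esub> \<one>\<^bsub>R\<^esub>) c)"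
      by (rule Zact[OF y(2) M.grade_neg[OF M.grade_one]])
    then have "Z k (inv\<^bsub>part M k\<^esub> y) (inv\<^bsub>part L (k + b)\<^esub> c)"
      using M.act_neg[OF M.grade_one cc(2)] L.act_neg[OF M.grade_one cc(3)] M.act_one[OF cc(2)] L.act_one[OF cc(3)]
      by simp
    \<comment> \<open>\<open>x\<close> and its approximation \<open>y\<close> share the coefficient
      \<open>c\<close>, so their difference has coefficient zero and belongs to the span of
      \<open>G0\<close>.\<close>
    from Zmult[OF c this] have "Z k (x \<otimes>\<^bsub>part M k\<^esub> inv\<^bsub>part M k\<^esub> y) \<one>\<^bsub>part L (k + b)\<^esub>"
      using cc(3) by simp
    then have "(k, x \<otimes>\<^bsub>part M k\<^esub> inv\<^bsub>part M k\<^esub> y) \<in> gspan R M G"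
      using G0(2) gspan_mono[of G0 G R M] unfolding G_def by blast
    from gsubD(3)[OF sG this y(1)] show "(k, x) \<in> gspan R M G"
      using cc by (simp add: Mk.m_assoc)
  qed
  ultimately have "N = gspan R M G" by (rule subset_antisym[rotated])
  moreover have "finite G" using B(1) G0(1) unfolding G_def by simp
  ultimately show ?thesis by (intro exI[of _ G] conjI)
qed

text \<open>Induction on the number of generators. The coefficients of elements of \<open>N\<close>
  at the new generator \<open>x0\<close> form, up to a shift, a graded ideal of \<open>R\<close>,
  which is finitely generated; the elements with coefficient zero are those of \<open>N\<close> in
  the span of the remaining generators, where the induction hypothesis applies.\<close>

lemma submodule_of_gspan_finitely_generated:
  assumes R: "noetherian_graded_commutative_ring R" and M: "graded_left_module R M" and "finite G"
    and "\<And>k x. (k, x) \<in> G \<Longrightarrow> x \<in> carrier (part M k)" "gsub R M N" "N \<subseteq> gspan R M G"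
  shows "\<exists>H. finite H \<and> N = gspan R M H"
  using assms(3-)
proof (induction G arbitrary: N rule: finite_induct)
  case empty
  then show ?case using gspan_minimal[of R M N "{}"] by (intro exI[of _ "{}"]) auto
next
  case (insert z G)
  interpret noetherian_graded_commutative_ring R by fact
  interpret M: graded_left_module R M by fact
  obtain k0 x0 where z: "z = (k0, x0)" by fastforce
  have x0: "x0 \<in> carrier (part M k0)" using insert.prems(1)[of k0 x0] z by blast
  have Gc: "x \<in> carrier (part M k)" if "(k, x) \<in> G" for k x using insert.prems(1) that by blast
  note sG = M.gsub_gspan[OF Gc]
  define W where "W k x c \<longleftrightarrow> c \<in> grade R (k - k0) \<and>
     (\<exists>g. (k, g) \<in> gspan R M G \<and> x = g \<otimes>\<^bsub>part M k\<^esub> act M (k - k0) k0 c x0)" for k x c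
  have a: "act M (k - k0) k0 c x0 \<in> carrier (part M k)" if "c \<in> grade R (k - k0)" for k c
    using M.act_closed'[OF that x0] by simp
  have W0: "W k x \<zero>\<^bsub>R\<^esub>" if "(k, x) \<in> gspan R M G" for k x
  proof -
    have "act M (k - k0) k0 \<zero>\<^bsub>R\<^esub> x0 = \<one>\<^bsub>part M k\<^esub>" using M.act_zero[OF x0, of "k - k0"] by simp
    then show ?thesis using that gsubD(1)[OF sG that] grade_zero unfolding W_def
      by (intro conjI exI[of _ x]) (auto simp: monoid.r_one)
  qed
  have W0': "(k, x) \<in> gspan R M G" if "W k x \<zero>\<^bsub>R\<^esub>" for k x
  proof -
    obtain g where g: "(k, g) \<in> gspan R M G" "x = g \<otimes>\<^bsub>part M k\<^esub> act M (k - k0) k0 \<zero>\<^bsub>R\<^esub> x0"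
      using \<open>W k x \<zero>\<^bsub>R\<^esub>\<close> unfolding W_def by blast
    have "act M (k - k0) k0 \<zero>\<^bsub>R\<^esub> x0 = \<one>\<^bsub>part M k\<^esub>" using M.act_zero[OF x0, of "k - k0"] by simp
    then show ?thesis using g gsubD(1)[OF sG g(1)] by (simp add: monoid.r_one)
  qed
  have Wc: "x \<in> carrier (part M k)" if "W k x c" for k x c
    using that gsubD(1)[OF sG] a unfolding W_def by (auto intro!: monoid.m_closed)
  have Wm: "W k (x \<otimes>\<^bsub>part M k\<^esub> y) (c \<oplus>\<^bsub>R\<^esub> d)" if x: "W k x c" and y: "W k y d" for k x y c d
  proof -
    obtain g h where gh: "(k, g) \<in> gspan R M G" "x = g \<otimes>\<^bsub>part M k\<^esub> act M (k - k0) k0 c x0"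
      "(k, h) \<in> gspan R M G" "y = h \<otimes>\<^bsub>part M k\<^esub> act M (k - k0) k0 d x0"
      and cd: "c \<in> grade R (k - k0)" "d \<in> grade R (k - k0)"
      using x y unfolding W_def by blast
    interpret Mk: comm_group "part M k" by simp
    have e: "act M (k - k0) k0 (c \<oplus>\<^bsub>R\<^esub> d) x0
        = act M (k - k0) k0 c x0 \<otimes>\<^bsub>part M k\<^esub> act M (k - k0) k0 d x0"
      using M.act_add[OF cd x0] by simp
    have "x \<otimes>\<^bsub>part M k\<^esub> y = (g \<otimes>\<^bsub>part M k\<^esub> h) \<otimes>\<^bsub>part M k\<^esub> act M (k - k0) k0 (c \<oplus>\<^bsub>R\<^esub> d) x0"
      unfolding e gh(2,4) using gsubD(1)[OF sG gh(1)] gsubD(1)[OF sG gh(3)] a[OF cd(1)] a[OF cd(2)]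
      by (simp add: Mk.m_ac)
    then show ?thesis
      unfolding W_def using grade_add[OF cd] gspan_mult[OF gh(1,3)] by blast
  qed
  have Wa: "W (e + k) (act M e k r x) (r \<otimes>\<^bsub>R\<^esub> c)" if x: "W k x c" and r: "r \<in> grade R e" for k x c e r
  proof -
    obtain g where g: "(k, g) \<in> gspan R M G" "x = g \<otimes>\<^bsub>part M k\<^esub> act M (k - k0) k0 c x0"
      and c: "c \<in> grade R (k - k0)" using x unfolding W_def by blast
    have "act M e k r x = act M e k r g \<otimes>\<^bsub>part M (e + k)\<^esub> act M e k r (act M (k - k0) k0 c x0)"
      unfolding g(2) by (rule M.act_distrib[OF r gsubD(1)[OF sG g(1)] a[OF c]])
    moreover have "act M e k r (act M (k - k0) k0 c x0) = act M (e + k - k0) k0 (r \<otimes>\<^bsub>R\<^esub> c) x0"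
      by (rule M.act_mult'[OF r c x0, symmetric]) auto
    moreover have "r \<otimes>\<^bsub>R\<^esub> c \<in> grade R (e + k - k0)" by (rule grade_mult'[OF r c]) simp
    ultimately show ?thesis unfolding W_def using gspan_act[OF g(1) r] by auto
  qed
  have Wone: "W k \<one>\<^bsub>part M k\<^esub> \<zero>\<^bsub>R\<^esub>" for k by (rule W0[OF gspan_one])
  have "gsub R M {(k, x). \<exists>c. W k x c}"
    by (rule gsubI) (use Wc Wone Wm Wa in blast)+
  moreover have "insert z G \<subseteq> {(k, x). \<exists>c. W k x c}"
  proof -
    have "W k0 x0 \<one>\<^bsub>R\<^esub>" unfolding W_def
      using grade_one M.act_one[OF x0] gspan_one[of k0 M R G] x0
      by (intro conjI exI[of _ "\<one>\<^bsub>part M k0\<^esub>"]) (auto simp: monoid.l_one)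
    then show ?thesis using W0[OF gspan_base] z by blast
  qed
  ultimately have "gspan R M (insert z G) \<subseteq> {(k, x). \<exists>c. W k x c}" by (rule gspan_minimal)
  then have tot: "\<exists>c. W k x c" if "(k, x) \<in> N" for k x
    using insert.prems(3) that by blast
  have N': "gsub R M (N \<inter> gspan R M G)"
    by (rule gsub_Int[OF insert.prems(2) sG])
  have ker: "{(k, x). (k, x) \<in> N \<and> W k x \<zero>\<^bsub>R\<^esub>} = N \<inter> gspan R M G"
    using W0 W0' by blast
  have ex: "\<exists>H. finite H \<and> N \<inter> gspan R M G = gspan R M H"
    by (rule insert.IH[OF Gc N' Int_lower2])
  let ?L = "regular_module R"
  have L: "part ?L k = \<lparr>carrier = grade R k, monoid.mult = add R, one = \<zero>\<^bsub>R\<^esub>\<rparr>" "act ?L e k r x = r \<otimes>\<^bsub>R\<^esub> x" for k e r x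
    by (simp_all add: regular_module_def)
  \<comment> \<open>The shift is \<open>- k0\<close> because an element of degree \<open>k\<close>
    has at \<open>x0\<close> a coefficient of degree \<open>k - k0\<close>.\<close>
  show ?case
  proof (rule finitely_generated_by_correspondence[OF M regular_module insert.prems(2) regular_module_noetherian,
        where b = "- k0" and Z = "\<lambda>k x c. (k, x) \<in> N \<and> W k x c"], unfold L monoid.simps partial_object.simps, goal_cases)
    case 1 then show ?case by (simp add: W_def)
  next
    case 2 then show ?case using tot by blast
  next
    case 3 show ?case using Wone gsubD(2)[OF insert.prems(2)] by blast
  next
    case 4 then show ?case using Wm gsubD(3)[OF insert.prems(2)] by blast
  next
    case 5 then show ?case using Wa gsubD(4)[OF insert.prems(2)] by blast
  next
    case 6 show ?case using ker ex by simp
  qed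
qed

text \<open>Finite generation describes each part as an additive group. The negatives allowed there,
  for which \<open>gspan\<close> has no rule, come from the action of \<open>-1\<close>, so a finite
  span is all of \<open>M\<close>.\<close>

lemma finitely_generated_imp_gnoetherian:
  assumes R: "noetherian_graded_commutative_ring R" and M: "graded_left_module R M"
    and fg: "finitely_generated R M"
  shows "gnoetherian R M"
proof -
  interpret M: graded_left_module R M by fact
  obtain G where G: "finite G" "\<And>k x. (k, x) \<in> G \<Longrightarrow> x \<in> carrier (part M k)"
    "\<And>n. carrier (part M n) =
        generate (part M n) {act M d k r x | d k r x. (k, x) \<in> G \<and> d + k = n \<and> r \<in> grade R d}"
    using fg unfolding finitely_generated_def by blast
  note sG = M.gsub_gspan[OF G(2)]
  have base: "(n, y) \<in> gspan R M G" if y: "y \<in> {act M d k r x | d k r x. (k, x) \<in> G \<and> d + k = n \<and> r \<in> grade R d}" for n y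
  proof -
    obtain d k r x where *: "y = act M d k r x" "(k, x) \<in> G" "d + k = n" "r \<in> grade R d" using y by blast
    then show ?thesis using gspan_act[OF gspan_base[OF *(2)] *(4)] by simp
  qed
  have "(n, x) \<in> gspan R M G" if "x \<in> carrier (part M n)" for n x
    using that unfolding G(3)
  proof induction
    case one show ?case by (rule gspan_one)
  next
    case (incl h) then show ?case by (rule base)
  next
    case (inv h) then show ?case by (intro M.gsub_inv[OF sG] base)
  next
    case (eng h1 h2) then show ?case by (intro gspan_mult)
  qed
  then have "N \<subseteq> gspan R M G" if "gsub R M N" for N using gsubD(1)[OF that] by fast
  then show ?thesis unfolding gnoetherian_def
    by (intro allI impI submodule_of_gspan_finitely_generated[OF R M G(1,2)])
qed

text \<open>Exactness at \<open>M\<close> is what a long exact sequence supplies, and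
  \<open>a\<close> and \<open>b\<close> are the degrees by which its maps shift. The part of
  \<open>N\<close> killed by \<open>v\<close> is the image of the preimage \<open>P\<close> of
  \<open>N\<close> in \<open>K\<close>, and the rest of \<open>N\<close> is governed by its image in
  \<open>L\<close>.\<close>

lemma gnoetherian_extension:
  assumes M: "graded_left_module R M" and K: "graded_left_module R K" and L: "graded_left_module R L"
    and nK: "gnoetherian R K" and nL: "gnoetherian R L"
    and u: "\<And>n. u n \<in> hom (part K (n + a)) (part M n)"
    and uact: "\<And>d n r x. r \<in> grade R d \<Longrightarrow> x \<in> carrier (part K (n + a)) \<Longrightarrow>
      u (d + n) (act K d (n + a) r x) = act M d n r (u n x)"
    and v: "\<And>n. v n \<in> hom (part M n) (part L (n + b))"
    and vact: "\<And>d n r x. r \<in> grade R d \<Longrightarrow> x \<in> carrier (part M n) \<Longrightarrow>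
      v (d + n) (act M d n r x) = act L d (n + b) r (v n x)"
    and exact: "\<And>n. kernel (part M n) (part L (n + b)) (v n) = u n ` carrier (part K (n + a))"
  shows "gnoetherian R M"
  unfolding gnoetherian_def
proof (intro allI impI)
  interpret M: graded_left_module R M by fact
  interpret K: graded_left_module R K by fact
  interpret L: graded_left_module R L by fact
  fix N assume N: "gsub R M N"
  have v1: "v n \<one>\<^bsub>part M n\<^esub> = \<one>\<^bsub>part L (n + b)\<^esub>" and u1: "u n \<one>\<^bsub>part K (n + a)\<^esub> = \<one>\<^bsub>part M n\<^esub>" for n
    using hom_one[OF v] hom_one[OF u] by simp_all
  have vu: "v n (u n x) = \<one>\<^bsub>part L (n + b)\<^esub>" if "x \<in> carrier (part K (n + a))" for n x
    using exact[of n] that unfolding kernel_def by blast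
  \<comment> \<open>The preimage of \<open>N\<close> under \<open>u\<close>; finitely many
    generators of it are pushed forward to generators \<open>H'\<close> of the kernel of
    \<open>v\<close> on \<open>N\<close>.\<close>
  define P where "P = {(j, x). x \<in> carrier (part K j) \<and> (j - a, u (j - a) x) \<in> N}"
  have PD: "x \<in> carrier (part K j)" "(j - a, u (j - a) x) \<in> N" if "(j, x) \<in> P" for j x
    using that by (auto simp: P_def)
  have "gsub R K P"
  proof (rule gsubI)
    fix k x assume "(k, x) \<in> P" then show "x \<in> carrier (part K k)" by (rule PD)
  next
    fix k show "(k, \<one>\<^bsub>part K k\<^esub>) \<in> P"
      using gsubD(2)[OF N, of "k - a"] u1[of "k - a"] by (simp add: P_def monoid.one_closed)
  next
    fix k x y assume "(k, x) \<in> P" "(k, y) \<in> P"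
    then show "(k, x \<otimes>\<^bsub>part K k\<^esub> y) \<in> P"
      using gsubD(3)[OF N, of "k - a" "u (k - a) x" "u (k - a) y"] hom_mult[OF u[of "k - a"], of x y]
      by (simp add: P_def monoid.m_closed)
  next
    fix k x d r assume x: "(k, x) \<in> P" and r: "r \<in> grade R d"
    have "(d + (k - a), u (d + (k - a)) (act K d k r x)) \<in> N"
      using gsubD(4)[OF N PD(2)[OF x] r] uact[OF r, of x "k - a"] PD(1)[OF x] by simp
    moreover have "d + (k - a) = d + k - a" by simp
    ultimately show "(d + k, act K d k r x) \<in> P"
      using PD(1)[OF x] K.act_closed[OF r, of x k] by (simp add: P_def)
  qed
  then obtain H where H: "finite H" "P = gspan R K H" using nK unfolding gnoetherian_def by blast
  define H' where "H' = (\<lambda>(j, x). (j - a, u (j - a) x)) ` H"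
  have up: "(j - a, u (j - a) x) \<in> gspan R M H'" if "(j, x) \<in> gspan R K H" for j x
    using that
  proof induction
    case (gspan_base k x)
    then show ?case unfolding H'_def by (intro gspan.gspan_base) force
  next
    case (gspan_one k)
    show ?case using gspan.gspan_one[of "k - a"] u1[of "k - a"] by simp
  next
    case (gspan_mult k x y)
    then have "x \<in> carrier (part K k)" "y \<in> carrier (part K k)" using PD H(2) by blast+
    then show ?case
      using gspan.gspan_mult[OF gspan_mult.IH] hom_mult[OF u[of "k - a"], of x y] by simp
  next
    case (gspan_act k x r d)
    then have "x \<in> carrier (part K k)" using PD H(2) by blast
    then have "(d + (k - a), u (d + (k - a)) (act K d k r x)) \<in> gspan R M H'"
      using gspan.gspan_act[OF gspan_act.IH gspan_act(2)] uact[OF gspan_act(2), of x "k - a"] by simp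
    then show ?case unfolding add_diff_eq .
  qed
  let ?Z = "\<lambda>k x c. (k, x) \<in> N \<and> c = v k x"
  have Zs: "gsub R M {(k, x). ?Z k x \<one>\<^bsub>part L (k + b)\<^esub>}"
  proof (rule gsubI)
    fix k x y assume "(k, x) \<in> {(k, x). ?Z k x \<one>\<^bsub>part L (k + b)\<^esub>}" "(k, y) \<in> {(k, x). ?Z k x \<one>\<^bsub>part L (k + b)\<^esub>}"
    then have xy: "(k, x) \<in> N" "(k, y) \<in> N" "v k x = \<one>\<^bsub>part L (k + b)\<^esub>" "v k y = \<one>\<^bsub>part L (k + b)\<^esub>"
      by auto
    show "(k, x \<otimes>\<^bsub>part M k\<^esub> y) \<in> {(k, x). ?Z k x \<one>\<^bsub>part L (k + b)\<^esub>}"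
      using gsubD(3)[OF N xy(1,2)] hom_mult[OF v gsubD(1)[OF N xy(1)] gsubD(1)[OF N xy(2)]] xy(3,4)
      by (simp add: monoid.l_one monoid.one_closed)
  next
    fix k x d r assume "(k, x) \<in> {(k, x). ?Z k x \<one>\<^bsub>part L (k + b)\<^esub>}" and r: "r \<in> grade R d"
    then have x: "(k, x) \<in> N" "v k x = \<one>\<^bsub>part L (k + b)\<^esub>" by auto
    show "(d + k, act M d k r x) \<in> {(k, x). ?Z k x \<one>\<^bsub>part L (k + b)\<^esub>}"
      using gsubD(4)[OF N x(1) r] vact[OF r gsubD(1)[OF N x(1)]] x(2) L.act_unit[OF r, of "k + b"]
      by (simp add: add.assoc)
  qed (use gsubD(1,2)[OF N] v1 in auto)
  have "{(k, x). ?Z k x \<one>\<^bsub>part L (k + b)\<^esub>} = gspan R M H'"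
  proof (rule subset_antisym)
    show "gspan R M H' \<subseteq> {(k, x). ?Z k x \<one>\<^bsub>part L (k + b)\<^esub>}"
    proof (rule gspan_minimal[OF Zs], clarify)
      fix k y assume "(k, y) \<in> H'"
      then obtain j x where jx: "(j, x) \<in> H" "k = j - a" "y = u k x" by (auto simp: H'_def)
      then have "(j, x) \<in> P" using gspan_base H(2) by fast
      then show "(k, y) \<in> N \<and> \<one>\<^bsub>part L (k + b)\<^esub> = v k y"
        using PD[of j x] vu[of x k] jx(2,3) by auto
    qed
    show "{(k, x). ?Z k x \<one>\<^bsub>part L (k + b)\<^esub>} \<subseteq> gspan R M H'"
    proof clarify
      fix k x assume x: "(k, x) \<in> N" "\<one>\<^bsub>part L (k + b)\<^esub> = v k x"
      then have "x \<in> kernel (part M k) (part L (k + b)) (v k)"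
        using gsubD(1)[OF N x(1)] unfolding kernel_def by simp
      then obtain y where y: "y \<in> carrier (part K (k + a))" "x = u k y" unfolding exact by blast
      then have "(k + a, y) \<in> P" using x(1) by (simp add: P_def)
      then show "(k, x) \<in> gspan R M H'" using up[of "k + a" y] H(2) y(2) by simp
    qed
  qed
  moreover have "finite H'" unfolding H'_def using H(1) by simp
  ultimately have ker: "\<exists>G. finite G \<and> {(k, x). ?Z k x \<one>\<^bsub>part L (k + b)\<^esub>} = gspan R M G"
    by (intro exI[of _ H'] conjI)
  show "\<exists>G. finite G \<and> N = gspan R M G"
  proof (rule finitely_generated_by_correspondence[OF M L N nL, where b = b and Z = ?Z])
    show "\<exists>G. finite G \<and> {(k, x). ?Z k x \<one>\<^bsub>part L (k + b)\<^esub>} = gspan R M G" by (rule ker)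
  next
    fix k x y c d assume xy: "(k, x) \<in> N \<and> c = v k x" "(k, y) \<in> N \<and> d = v k y"
    then have c: "x \<in> carrier (part M k)" "y \<in> carrier (part M k)" using gsubD(1)[OF N] by blast+
    show "(k, x \<otimes>\<^bsub>part M k\<^esub> y) \<in> N \<and> c \<otimes>\<^bsub>part L (k + b)\<^esub> d = v k (x \<otimes>\<^bsub>part M k\<^esub> y)"
      using xy gsubD(3)[OF N, of k x y] hom_mult[OF v c] by simp
  next
    fix k x c e r assume x: "(k, x) \<in> N \<and> c = v k x" and r: "r \<in> grade R e"
    then have c: "x \<in> carrier (part M k)" using gsubD(1)[OF N] by blast
    show "(e + k, act M e k r x) \<in> N \<and> act L e (k + b) r c = v (e + k) (act M e k r x)"
      using x gsubD(4)[OF N _ r, of k x] vact[OF r c] by simp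
  next
    fix k x c assume x: "(k, x) \<in> N \<and> c = v k x"
    then show "(k, x) \<in> N \<and> c \<in> carrier (part L (k + b))"
      using hom_in_carrier[OF v] gsubD(1)[OF N] by blast
  qed (use gsubD(2)[OF N] v1 in auto)
qed

section \<open>Homogeneous primes, torsion and localization\<close>

text \<open>The kernel of the map from \<open>M\<close> to its localization at \<open>p\<close>.
  Nakayama's lemma and the cone arguments are carried out with this notion, so that no fractions
  occur in them.\<close>

definition torsion :: "'r graded_ring \<Rightarrow> 'r set \<Rightarrow> ('r, 'm) graded_module \<Rightarrow> int \<Rightarrow> 'm \<Rightarrow> bool" where
  "torsion R p M k x \<longleftrightarrow>
     (\<exists>e s. s \<in> grade R e \<and> s \<notin> p \<and> act M e k s x = \<one>\<^bsub>part M (e + k)\<^esub>)"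

locale graded_prime = graded_commutative_ring +
  fixes p
  assumes in_Spec: "p \<in> Spec R"
begin

lemma p_ideal: "ideal p R"
  using in_Spec unfolding Spec_def homogeneous_ideal_def by blast

sublocale p: ideal p R by (rule p_ideal)

lemma one_notin: "\<one> \<notin> p"
  using in_Spec p.one_imp_carrier unfolding Spec_def by blast

lemma mult_notin: "a \<in> grade R m \<Longrightarrow> b \<in> grade R n \<Longrightarrow> a \<notin> p \<Longrightarrow> b \<notin> p \<Longrightarrow> a \<otimes> b \<notin> p"
  using in_Spec unfolding Spec_def by blast

lemma neg_notin: "a \<in> grade R m \<Longrightarrow> a \<notin> p \<Longrightarrow> \<ominus> a \<notin> p"
  using p.a_inv_closed[of "\<ominus> a"] grade_closed[of a m] by auto

text \<open>The multipliers are \<open>a = s'\<close> and \<open>a' = s\<close> up to sign, which is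
  why the degrees appear exchanged.\<close>

lemma ore:
  assumes s: "s \<in> grade R d" "s \<notin> p" and s': "s' \<in> grade R d'" "s' \<notin> p"
  obtains a a' where "a \<in> grade R d'" "a' \<in> grade R d" "a \<notin> p" "a' \<notin> p" "a \<otimes> s = a' \<otimes> s'"
  using grade_swap[OF s'(1) s(1)] neg_notin[OF s] s s' by (metis insertE singletonD)

end

section \<open>Nakayama's lemma at a homogeneous prime\<close>

locale module_at_prime = graded_left_module R M + graded_prime R p
  for R :: "'r graded_ring" (structure) and M :: "('r, 'm) graded_module" and p
begin

text \<open>Nakayama's lemma without determinants: if \<open>r M\<^sub>p = M\<^sub>p\<close>, divide repeatedly by \<open>r\<close>, so that
  \<open>s\<^sub>i y\<^sub>i = r y\<^sub>i\<^sub>+\<^sub>1\<close>. By the chain condition some \<open>y\<^sub>n\<^sub>+\<^sub>1\<close> is a combination of the preceding ones, all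
  of which lie in \<open>p y\<^sub>n\<^sub>+\<^sub>1\<close> up to a denominator; hence \<open>(s - t) y\<^sub>n\<^sub>+\<^sub>1 = 0\<close> with \<open>t \<in> p\<close>, \<open>s \<notin> p\<close>.\<close>

definition below :: "int \<Rightarrow> 'm \<Rightarrow> int \<Rightarrow> 'm \<Rightarrow> bool" where
  "below j y k z \<longleftrightarrow> (\<exists>e s c. s \<in> grade R e \<and> s \<notin> p \<and> c \<in> grade R (e + k - j) \<and> c \<in> p \<and>
     act M e k s z = act M (e + k - j) j c y)"

text \<open>For sums the two denominators are made equal by the Ore condition, and the numerators
  stay in \<open>p\<close>. For the action of \<open>r\<close> the denominator \<open>s\<close> is
  moved past \<open>r\<close> at the price of a sign.\<close>

lemma gsub_below:
  assumes y: "y \<in> carrier (part M j)"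
  shows "gsub R M {(k, z). z \<in> carrier (part M k) \<and> below j y k z}"
proof (rule gsubI)
  fix k
  have "below j y k \<one>\<^bsub>part M k\<^esub>"
    unfolding below_def using grade_one one_notin grade_zero p.zero_closed act_unit[OF grade_one, of k]
      act_zero[OF y, of "k - j"] by (intro exI[of _ 0] exI[of _ "\<one>"] exI[of _ "\<zero>"]) simp
  then show "(k, \<one>\<^bsub>part M k\<^esub>) \<in> {(k, z). z \<in> carrier (part M k) \<and> below j y k z}"
    by (simp add: monoid.one_closed)
next
  fix k z z'
  assume "(k, z) \<in> {(k, z). z \<in> carrier (part M k) \<and> below j y k z}"
    "(k, z') \<in> {(k, z). z \<in> carrier (part M k) \<and> below j y k z}"
  then have z: "z \<in> carrier (part M k)" "z' \<in> carrier (part M k)" "below j y k z" "below j y k z'"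
    by auto
  obtain e s c where s: "s \<in> grade R e" "s \<notin> p" "c \<in> grade R (e + k - j)" "c \<in> p"
    "act M e k s z = act M (e + k - j) j c y" using z(3) unfolding below_def by blast
  obtain e' s' c' where s': "s' \<in> grade R e'" "s' \<notin> p" "c' \<in> grade R (e' + k - j)" "c' \<in> p"
    "act M e' k s' z' = act M (e' + k - j) j c' y" using z(4) unfolding below_def by blast
  obtain a a' where a: "a \<in> grade R e'" "a' \<in> grade R e" "a \<notin> p" "a' \<notin> p" "a \<otimes> s = a' \<otimes> s'"
    by (rule ore[OF s(1,2) s'(1,2)])
  let ?m = "e' + e + k - j"
  have ac: "a \<otimes> c \<in> grade R ?m" "a' \<otimes> c' \<in> grade R ?m"
    by (rule grade_mult'[OF a(1) s(3)], simp, rule grade_mult'[OF a(2) s'(3)], simp)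
  have "act M (e' + e) k (a \<otimes> s) z = act M ?m j (a \<otimes> c) y"
    using act_mult'[OF a(1) s(1) z(1) refl refl] act_mult'[OF a(1) s(3) y, of ?m "e + k"] s(5) by simp
  moreover have "act M (e' + e) k (a \<otimes> s) z' = act M ?m j (a' \<otimes> c') y"
    using act_mult'[OF a(2) s'(1) z(2), of "e' + e" "e' + k"] act_mult'[OF a(2) s'(3) y, of ?m "e' + k"] s'(5) a(5)
    by simp
  moreover have as: "a \<otimes> s \<in> grade R (e' + e)" by (rule grade_mult[OF a(1) s(1)])
  ultimately have "act M (e' + e) k (a \<otimes> s) (z \<otimes>\<^bsub>part M k\<^esub> z') = act M ?m j (a \<otimes> c \<oplus> a' \<otimes> c') y"
    using act_distrib[OF as z(1,2)] act_add[OF ac y] by simp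
  moreover have "a \<otimes> c \<oplus> a' \<otimes> c' \<in> p"
    using p.I_l_closed[OF s(4) grade_closed[OF a(1)]] p.I_l_closed[OF s'(4) grade_closed[OF a(2)]] by simp
  moreover have "a \<otimes> s \<notin> p" by (rule mult_notin[OF a(1) s(1) a(3) s(2)])
  ultimately have "below j y k (z \<otimes>\<^bsub>part M k\<^esub> z')"
    unfolding below_def using as grade_add[OF ac] by blast
  then show "(k, z \<otimes>\<^bsub>part M k\<^esub> z') \<in> {(k, z). z \<in> carrier (part M k) \<and> below j y k z}"
    using z by (simp add: monoid.m_closed)
next
  fix k z d r
  assume "(k, z) \<in> {(k, z). z \<in> carrier (part M k) \<and> below j y k z}" and r: "r \<in> grade R d"
  then have z: "z \<in> carrier (part M k)" "below j y k z" by auto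
  obtain e s c where s: "s \<in> grade R e" "s \<notin> p" "c \<in> grade R (e + k - j)" "c \<in> p"
    "act M e k s z = act M (e + k - j) j c y" using z(2) unfolding below_def by blast
  obtain r' where r': "r' \<in> grade R d" "s \<otimes> r = r' \<otimes> s" using grade_swap[OF s(1) r] by metis
  have rc: "r' \<otimes> c \<in> grade R (e + (d + k) - j)" by (rule grade_mult'[OF r'(1) s(3)]) simp
  have "act M e (d + k) s (act M d k r z) = act M (d + e) k (r' \<otimes> s) z"
    using act_mult'[OF s(1) r z(1), of "d + e" "d + k"] r'(2) by simp
  also have "\<dots> = act M d (e + k) r' (act M (e + k - j) j c y)"
    using act_mult'[OF r'(1) s(1) z(1) refl refl] s(5) by simp
  also have "\<dots> = act M (e + (d + k) - j) j (r' \<otimes> c) y"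
    by (rule act_mult'[OF r'(1) s(3) y, symmetric]) auto
  finally have "below j y (d + k) (act M d k r z)"
    unfolding below_def using s(1,2) rc p.I_l_closed[OF s(4) grade_closed[OF r'(1)]] by blast
  then show "(d + k, act M d k r z) \<in> {(k, z). z \<in> carrier (part M k) \<and> below j y k z}"
    using z r by simp
qed auto

text \<open>Multiplying \<open>s z = r w\<close> by a denominator \<open>t\<close> with
  \<open>t w = c y\<close> and moving \<open>t\<close> past \<open>r\<close> gives
  \<open>t s z = r' c y\<close>, where \<open>r'\<close> is \<open>r\<close> up to sign and
  \<open>r' c\<close> lies in \<open>p\<close>.\<close>

lemma below_step:
  assumes r: "r \<in> grade R d" "r \<in> p" and s: "s \<in> grade R e" "s \<notin> p"
    and z: "z \<in> carrier (part M k)" and w: "w \<in> carrier (part M (e + k - d))"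
    and eq: "act M e k s z = act M d (e + k - d) r w"
    and y: "y \<in> carrier (part M j)" and bel: "below j y (e + k - d) w"
  shows "below j y k z"
proof -
  obtain f t c where t: "t \<in> grade R f" "t \<notin> p" "c \<in> grade R (f + (e + k - d) - j)" "c \<in> p"
    "act M f (e + k - d) t w = act M (f + (e + k - d) - j) j c y" using bel unfolding below_def by blast
  obtain r' where r': "r' \<in> {r, \<ominus> r}" "r' \<in> grade R d" "t \<otimes> r = r' \<otimes> t" using grade_swap[OF t(1) r(1)] by metis
  have "act M (f + e) k (t \<otimes> s) z = act M f (e + k) t (act M d (e + k - d) r w)"
    using act_mult'[OF t(1) s(1) z refl refl] eq by simp
  also have "\<dots> = act M (d + f) (e + k - d) (r' \<otimes> t) w"
    using act_mult'[OF t(1) r(1) w, of "d + f" "e + k"] r'(3) by simp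
  also have "\<dots> = act M d (f + (e + k - d)) r' (act M (f + (e + k - d) - j) j c y)"
    using act_mult'[OF r'(2) t(1) w refl refl] t(5) by simp
  also have "\<dots> = act M (f + e + k - j) j (r' \<otimes> c) y"
    by (rule act_mult'[OF r'(2) t(3) y, symmetric]) auto
  finally show ?thesis
    unfolding below_def using grade_mult[OF t(1) s(1)] mult_notin[OF t(1) s(1) t(2) s(2)]
      grade_mult'[OF r'(2) t(3), of "f + e + k - j"] p.I_l_closed[OF t(4) grade_closed[OF r'(2)]]
    by (intro exI[of _ "f + e"] exI[of _ "t \<otimes> s"] exI[of _ "r' \<otimes> c"]) simp
qed

text \<open>Since the same \<open>y\<close> stands on both sides of \<open>s y = c y\<close>, the
  scalars \<open>s\<close> and \<open>c\<close> have equal degree. Thus \<open>s - c\<close> is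
  homogeneous, and it lies outside \<open>p\<close> because \<open>c\<close> lies in
  \<open>p\<close> and \<open>s\<close> does not.\<close>

lemma below_self_torsion:
  assumes y: "y \<in> carrier (part M j)" and "below j y j y"
  shows "torsion R p M j y"
proof -
  obtain e s c where s: "s \<in> grade R e" "s \<notin> p" "c \<in> grade R e" "c \<in> p" "act M e j s y = act M e j c y"
    using assms(2) unfolding below_def by auto
  interpret G: group "part M (e + j)" by simp
  have "act M e j (s \<oplus> \<ominus> c) y = \<one>\<^bsub>part M (e + j)\<^esub>"
    using act_add[OF s(1) grade_neg[OF s(3)] y] act_neg[OF s(3) y] s(5) act_closed[OF s(3) y] by simp
  moreover have "s \<oplus> \<ominus> c \<notin> p"
  proof
    assume "s \<oplus> \<ominus> c \<in> p"
    then have "s \<oplus> \<ominus> c \<oplus> c \<in> p" using s(4) by simp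
    moreover have "s \<oplus> \<ominus> c \<oplus> c = s" using grade_closed[OF s(1)] grade_closed[OF s(3)] by (simp add: a_assoc l_neg)
    ultimately show False using s(2) by simp
  qed
  ultimately show ?thesis
    unfolding torsion_def using grade_add[OF s(1) grade_neg[OF s(3)]] by blast
qed

text \<open>Transports torsion backwards along the chain of divisions: a denominator killing
  \<open>w\<close>, multiplied by \<open>s\<close>, kills \<open>z\<close>.\<close>

lemma torsion_step:
  assumes r: "r \<in> grade R d" and s: "s \<in> grade R e" "s \<notin> p"
    and z: "z \<in> carrier (part M k)" and w: "w \<in> carrier (part M (e + k - d))"
    and eq: "act M e k s z = act M d (e + k - d) r w"
    and tor: "torsion R p M (e + k - d) w"
  shows "torsion R p M k z"
proof -
  obtain f t where t: "t \<in> grade R f" "t \<notin> p" "act M f (e + k - d) t w = \<one>\<^bsub>part M (f + (e + k - d))\<^esub>"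
    using tor unfolding torsion_def by blast
  obtain r' where r': "r' \<in> grade R d" "t \<otimes> r = r' \<otimes> t" using grade_swap[OF t(1) r] by metis
  have "act M (f + e) k (t \<otimes> s) z = act M f (e + k) t (act M d (e + k - d) r w)"
    using act_mult'[OF t(1) s(1) z refl refl] eq by simp
  also have "\<dots> = act M (d + f) (e + k - d) (r' \<otimes> t) w"
    using act_mult'[OF t(1) r w, of "d + f" "e + k"] r'(2) by simp
  also have "\<dots> = \<one>\<^bsub>part M (f + e + k)\<^esub>"
    using act_mult'[OF r'(1) t(1) w refl refl] t(3) act_unit[OF r'(1), of "f + (e + k - d)"] by (simp add: add.assoc)
  finally show ?thesis
    unfolding torsion_def using grade_mult[OF t(1) s(1)] mult_notin[OF t(1) s(1) t(2) s(2)] by auto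
qed

lemma nakayama:
  assumes noeth: "gnoetherian R M" and r: "r \<in> grade R d" "r \<in> p"
    and sur: "\<And>k x. x \<in> carrier (part M k) \<Longrightarrow>
      \<exists>e s w. s \<in> grade R e \<and> s \<notin> p \<and> w \<in> carrier (part M (e + k - d)) \<and>
        act M e k s x = act M d (e + k - d) r w"
    and x: "x \<in> carrier (part M k)"
  shows "torsion R p M k x"
proof -
  \<comment> \<open>The chain consists of pairs of a degree and an element. \<open>V\<close> says
    that the element has this degree, \<open>Q\<close> that the second pair arises from the first by
    dividing by \<open>r\<close>, up to a denominator.\<close>
  define V where "V z \<longleftrightarrow> snd z \<in> carrier (part M (fst z))" for z
  define Q where "Q z w \<longleftrightarrow> (\<exists>e s. s \<in> grade R e \<and> s \<notin> p \<and> fst w = e + fst z - d \<and>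
     act M e (fst z) s (snd z) = act M d (fst w) r (snd w))" for z w
  have "\<exists>f. \<forall>n. (V (f n) \<and> (n = 0 \<longrightarrow> f n = (k, x))) \<and> Q (f n) (f (Suc n))"
  proof (rule dependent_nat_choice[where P = "\<lambda>n z. V z \<and> (n = 0 \<longrightarrow> z = (k, x))" and Q = "\<lambda>_. Q"])
    show "\<exists>z. V z \<and> (0 = (0::nat) \<longrightarrow> z = (k, x))" using x by (auto simp: V_def)
  next
    fix z :: "int \<times> 'm" and n :: nat assume "V z \<and> (n = 0 \<longrightarrow> z = (k, x))"
    then obtain e s w where "s \<in> grade R e" "s \<notin> p" "w \<in> carrier (part M (e + fst z - d))"
      "act M e (fst z) s (snd z) = act M d (e + fst z - d) r w"
      using sur[of "snd z" "fst z"] unfolding V_def by blast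
    then show "\<exists>w. (V w \<and> (Suc n = 0 \<longrightarrow> w = (k, x))) \<and> Q z w"
      by (intro exI[of _ "(e + fst z - d, w)"]) (auto simp: V_def Q_def)
  qed
  then obtain f where f: "\<And>n. V (f n)" "f 0 = (k, x)" "\<And>n. Q (f n) (f (Suc n))" by blast
  have Vc: "x \<in> carrier (part M k)" if "(k, x) \<in> range f" for k x
    using that f(1) unfolding V_def by (metis fst_conv imageE snd_conv)
  obtain G where G: "finite G" "gspan R M (range f) = gspan R M G"
    using noeth gsub_gspan[OF Vc] unfolding gnoetherian_def by blast
  have mono: "gspan R M (f ` {..m}) \<subseteq> gspan R M (f ` {..n})" if "m \<le> n" for m n
    by (rule gspan_mono) (use that in auto)
  \<comment> \<open>The span of the whole chain is the union of the spans of its initial segments. A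
    finite generating set therefore lies in one of them.\<close>
  have "(k, x) \<in> gspan R M (range f) \<Longrightarrow> \<exists>n. (k, x) \<in> gspan R M (f ` {..n})" for k x
  proof (induction rule: gspan.induct)
    case (gspan_base k x)
    then obtain n where "(k, x) = f n" by blast
    then show ?case by (intro exI[of _ n] gspan.gspan_base) auto
  next
    case (gspan_one k) show ?case using gspan.gspan_one by blast
  next
    case (gspan_mult k x y)
    then obtain m n where "(k, x) \<in> gspan R M (f ` {..m})" "(k, y) \<in> gspan R M (f ` {..n})" by blast
    then have "(k, x) \<in> gspan R M (f ` {..max m n})" "(k, y) \<in> gspan R M (f ` {..max m n})"
      using mono[of m "max m n"] mono[of n "max m n"] by auto
    from gspan.gspan_mult[OF this] show ?case by blast
  next
    case (gspan_act k x r d)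
    then obtain n where "(k, x) \<in> gspan R M (f ` {..n})" by blast
    from gspan.gspan_act[OF this gspan_act(2)] show ?case by blast
  qed
  then have "\<forall>z\<in>G. \<exists>n. z \<in> gspan R M (f ` {..n})"
    using gspan_superset[of G R M] G(2) by (metis prod.collapse subsetD)
  then obtain h where h: "\<And>z. z \<in> G \<Longrightarrow> z \<in> gspan R M (f ` {..h z})" by metis
  \<comment> \<open>Inserting \<open>0\<close> keeps \<open>Max\<close> meaningful when
    \<open>G\<close> is empty.\<close>
  define n where "n = Max (insert 0 (h ` G))"
  have "h z \<le> n" if "z \<in> G" for z unfolding n_def using G(1) that by simp
  then have "G \<subseteq> gspan R M (f ` {..n})" using h mono by blast
  moreover have "gsub R M (gspan R M (f ` {..n}))" by (rule gsub_gspan) (use Vc in blast)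
  ultimately have *: "gspan R M (range f) \<subseteq> gspan R M (f ` {..n})"
    unfolding G(2) by (intro gspan_minimal)
  obtain j y where jy: "f (Suc n) = (j, y)" by fastforce
  have y: "y \<in> carrier (part M j)" using f(1)[of "Suc n"] jy by (simp add: V_def)
  have divide: "\<exists>e s. s \<in> grade R e \<and> s \<notin> p \<and> fst (f (Suc i)) = e + fst (f i) - d \<and>
     act M e (fst (f i)) s (snd (f i)) = act M d (e + fst (f i) - d) r (snd (f (Suc i)))" for i
    using f(3)[of i] unfolding Q_def by force
  \<comment> \<open>Descending induction from \<open>n\<close>: at the top
    \<open>s f(n) = r y\<close> with \<open>r\<close> itself as the scalar in \<open>p\<close>, and
    each step down multiplies by \<open>r\<close> once more.\<close>
  have bel: "below j y (fst (f i)) (snd (f i))" if "i \<le> n" for i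
    using that
  proof (induction rule: inc_induct)
    case base
    obtain e s where s: "s \<in> grade R e" "s \<notin> p" "fst (f (Suc n)) = e + fst (f n) - d"
     "act M e (fst (f n)) s (snd (f n)) = act M d (e + fst (f n) - d) r (snd (f (Suc n)))" using divide by blast
    then have "fst (f n) = j + d - e" using jy by simp
    then show ?case unfolding below_def using s jy r by (intro exI[of _ e] exI[of _ s] exI[of _ r]) simp
  next
    case (step i)
    obtain e s where s: "s \<in> grade R e" "s \<notin> p" "fst (f (Suc i)) = e + fst (f i) - d"
     "act M e (fst (f i)) s (snd (f i)) = act M d (e + fst (f i) - d) r (snd (f (Suc i)))"
      using divide by blast
    show ?case
      by (rule below_step[OF r s(1,2) _ _ s(4) y]) (use f(1)[of i] f(1)[of "Suc i"] s(3) step.IH in \<open>simp_all add: V_def\<close>)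
  qed
  have "gspan R M (f ` {..n}) \<subseteq> {(k, z). z \<in> carrier (part M k) \<and> below j y k z}"
  proof (rule gspan_minimal[OF gsub_below[OF y]])
    show "f ` {..n} \<subseteq> {(k, z). z \<in> carrier (part M k) \<and> below j y k z}"
    proof (rule image_subsetI)
      fix i assume "i \<in> {..n}"
      then show "f i \<in> {(k, z). z \<in> carrier (part M k) \<and> below j y k z}"
        using bel[of i] f(1)[of i] by (cases "f i") (simp add: V_def)
    qed
  qed
  \<comment> \<open>The element \<open>y\<close> belongs to the span of its predecessors, each of
    which is below \<open>y\<close>; so \<open>y\<close> is below itself.\<close>
  moreover have "f (Suc n) \<in> gspan R M (range f)" using gspan_superset[of "range f" R M] by blast
  ultimately have "below j y j y" using * jy by auto
  then have "torsion R p M j y" by (rule below_self_torsion[OF y])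
  then have last: "torsion R p M (fst (f (Suc n))) (snd (f (Suc n)))" using jy by simp
  \<comment> \<open>From the last element torsion is carried back to \<open>f 0\<close>, which is
    the given \<open>x\<close>.\<close>
  have "torsion R p M (fst (f i)) (snd (f i))" if "i \<le> Suc n" for i
    using that
  proof (induction rule: inc_induct)
    case base show ?case by (rule last)
  next
    case (step i)
    obtain e s where s: "s \<in> grade R e" "s \<notin> p" "fst (f (Suc i)) = e + fst (f i) - d"
     "act M e (fst (f i)) s (snd (f i)) = act M d (e + fst (f i) - d) r (snd (f (Suc i)))" using divide by blast
    show ?case
      by (rule torsion_step[OF r(1) s(1,2) _ _ s(4)]) (use f(1)[of i] f(1)[of "Suc i"] s(3) step.IH in \<open>simp_all add: V_def\<close>)
  qed
  from this[of 0] show ?thesis using f(2) by simp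
qed

end

section \<open>The Ore localization as a family of abelian groups\<close>

context module_at_prime
begin

lemma fractions_iff:
  "(d, s, x) \<in> fractions R p M n \<longleftrightarrow> s \<in> grade R d \<and> s \<notin> p \<and> x \<in> carrier (part M (d + n))"
  by (simp add: fractions_def)

lemma fraction_eqI:
  assumes "(d, s, x) \<in> fractions R p M n" "(d', s', x') \<in> fractions R p M n"
    "a \<in> grade R k" "a' \<in> grade R k'" "k + d = k' + d'" "a \<otimes> s = a' \<otimes> s'" "a \<otimes> s \<notin> p"
    "act M k (d + n) a x = act M k' (d' + n) a' x'"
  shows "((d, s, x), (d', s', x')) \<in> fraction_eq R p M n"
  using assms unfolding fraction_eq_def by blast

text \<open>The two multipliers lie outside \<open>p\<close> themselves, since \<open>p\<close> is
  an ideal that misses the common product \<open>a s = a' s'\<close>.\<close>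

lemma fraction_eqE:
  assumes "((d, s, x), (d', s', x')) \<in> fraction_eq R p M n"
  obtains k k' a a' where "(d, s, x) \<in> fractions R p M n" "(d', s', x') \<in> fractions R p M n"
    "a \<in> grade R k" "a' \<in> grade R k'" "k + d = k' + d'" "a \<otimes> s = a' \<otimes> s'" "a \<otimes> s \<notin> p"
    "a \<notin> p" "a' \<notin> p" "act M k (d + n) a x = act M k' (d' + n) a' x'"
proof -
  obtain k k' a a' where *: "(d, s, x) \<in> fractions R p M n" "(d', s', x') \<in> fractions R p M n"
    "a \<in> grade R k" "a' \<in> grade R k'" "k + d = k' + d'" "a \<otimes> s = a' \<otimes> s'" "a \<otimes> s \<notin> p"
    "act M k (d + n) a x = act M k' (d' + n) a' x'"
    using assms unfolding fraction_eq_def by blast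
  moreover have "a \<notin> p" "a' \<notin> p"
    using * p.I_r_closed grade_closed unfolding fractions_iff by metis+
  ultimately show ?thesis using that by blast
qed

lemma fraction_expand:
  assumes f: "(d, s, x) \<in> fractions R p M n" and a: "a \<in> grade R k" "a \<notin> p" and k: "k' = k + d"
  shows "((d, s, x), (k', a \<otimes> s, act M k (d + n) a x)) \<in> fraction_eq R p M n"
proof -
  have s: "s \<in> grade R d" "s \<notin> p" "x \<in> carrier (part M (d + n))" using f by (auto simp: fractions_iff)
  have as: "a \<otimes> s \<in> grade R k'" "a \<otimes> s \<notin> p" using grade_mult[OF a(1) s(1)] mult_notin[OF a(1) s(1) a(2) s(2)] k by auto
  have ax: "act M k (d + n) a x \<in> carrier (part M (k' + n))" using act_closed'[OF a(1) s(3)] k by (simp add: add.assoc)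
  have e: "\<one> \<otimes> (a \<otimes> s) = a \<otimes> s" using as grade_closed by simp
  show ?thesis
    by (rule fraction_eqI[OF f _ a(1) grade_one, of k'])
      (use as ax e act_one[OF ax] k in \<open>simp_all add: fractions_iff\<close>)
qed

lemma fraction_eq_refl: "(d, s, x) \<in> fractions R p M n \<Longrightarrow> ((d, s, x), (d, s, x)) \<in> fraction_eq R p M n"
  using grade_closed
  by (intro fraction_eqI[of _ _ _ _ _ _ _ \<one> 0 \<one> 0]) (auto simp: grade_one fractions_iff)

lemma fraction_eq_sym:
  "((d, s, x), (d', s', x')) \<in> fraction_eq R p M n \<Longrightarrow> ((d', s', x'), (d, s, x)) \<in> fraction_eq R p M n"
  by (erule fraction_eqE) (metis fraction_eqI)

text \<open>The middle fraction is expanded once by \<open>a'\<close> and once by \<open>b\<close>.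
  The Ore condition supplies \<open>c a' = c' b\<close>, and both equalities are multiplied
  accordingly.\<close>

lemma fraction_eq_trans:
  assumes "((d, s, x), (d', s', x')) \<in> fraction_eq R p M n" "((d', s', x'), (d'', s'', x'')) \<in> fraction_eq R p M n"
  shows "((d, s, x), (d'', s'', x'')) \<in> fraction_eq R p M n"
proof -
  obtain k k' a a' where a: "(d, s, x) \<in> fractions R p M n" "(d', s', x') \<in> fractions R p M n"
    "a \<in> grade R k" "a' \<in> grade R k'" "k + d = k' + d'" "a \<otimes> s = a' \<otimes> s'" "a \<otimes> s \<notin> p"
    "a \<notin> p" "a' \<notin> p" "act M k (d + n) a x = act M k' (d' + n) a' x'" using assms(1) by (rule fraction_eqE)
  obtain l l' b b' where b: "(d'', s'', x'') \<in> fractions R p M n"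
    "b \<in> grade R l" "b' \<in> grade R l'" "l + d' = l' + d''" "b \<otimes> s' = b' \<otimes> s''" "b \<otimes> s' \<notin> p"
    "b \<notin> p" "b' \<notin> p" "act M l (d' + n) b x' = act M l' (d'' + n) b' x''" using assms(2) by (rule fraction_eqE)
  obtain c c' where c: "c \<in> grade R l" "c' \<in> grade R k'" "c \<notin> p" "c' \<notin> p" "c \<otimes> a' = c' \<otimes> b"
    by (rule ore[OF a(4,9) b(2,7)])
  have s: "s \<in> grade R d" "s' \<in> grade R d'" "s'' \<in> grade R d''" "s \<notin> p"
    and x: "x \<in> carrier (part M (d + n))" "x' \<in> carrier (part M (d' + n))" "x'' \<in> carrier (part M (d'' + n))"
    using a(1,2) b(1) by (auto simp: fractions_iff)
  note cl = grade_closed[OF a(3)] grade_closed[OF a(4)] grade_closed[OF b(2)] grade_closed[OF b(3)]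
    grade_closed[OF c(1)] grade_closed[OF c(2)] grade_closed[OF s(1)] grade_closed[OF s(2)] grade_closed[OF s(3)]
  show ?thesis
  proof (rule fraction_eqI[OF a(1) b(1) grade_mult[OF c(1) a(3)] grade_mult[OF c(2) b(3)]])
    show "l + k + d = k' + l' + d''" using a(5) b(4) by simp
    have "c \<otimes> a \<otimes> s = c \<otimes> (a' \<otimes> s')" using a(6) cl by (simp add: m_assoc)
    also have "\<dots> = c' \<otimes> (b \<otimes> s')" using c(5) cl by (simp flip: m_assoc)
    also have "\<dots> = c' \<otimes> b' \<otimes> s''" using b(5) cl by (simp add: m_assoc)
    finally show "c \<otimes> a \<otimes> s = c' \<otimes> b' \<otimes> s''" .
    show "c \<otimes> a \<otimes> s \<notin> p"
      using mult_notin[OF grade_mult[OF c(1) a(3)] s(1) mult_notin[OF c(1) a(3) c(3) a(8)] s(4)] .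
    have "act M (l + k) (d + n) (c \<otimes> a) x = act M l (k + (d + n)) c (act M k' (d' + n) a' x')"
      using act_mult[OF c(1) a(3) x(1)] a(10) by simp
    also have "\<dots> = act M (l + k') (d' + n) (c' \<otimes> b) x'"
      using act_mult'[OF c(1) a(4) x(2) refl, of "k + (d + n)"] a(5) c(5) by simp
    also have "\<dots> = act M k' (l + (d' + n)) c' (act M l' (d'' + n) b' x'')"
      using act_mult'[OF c(2) b(2) x(2) _ refl, of "l + k'"] b(9) by simp
    also have "\<dots> = act M (k' + l') (d'' + n) (c' \<otimes> b') x''"
      by (rule act_mult'[OF c(2) b(3) x(3), symmetric]) (use b(4) in auto)
    finally show "act M (l + k) (d + n) (c \<otimes> a) x = act M (k' + l') (d'' + n) (c' \<otimes> b') x''" .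
  qed
qed

lemma equiv_fraction_eq: "equiv (fractions R p M n) (fraction_eq R p M n)"
proof (rule equivI)
  show "fraction_eq R p M n \<subseteq> fractions R p M n \<times> fractions R p M n"
    unfolding fraction_eq_def by blast
  show "refl_on (fractions R p M n) (fraction_eq R p M n)"
    using fraction_eq_refl unfolding refl_on_def by (metis prod_cases3)
  show "sym (fraction_eq R p M n)"
    using fraction_eq_sym unfolding sym_def by (metis prod_cases3)
  show "trans (fraction_eq R p M n)"
    using fraction_eq_trans unfolding trans_def by (metis prod_cases3)
qed

text \<open>The equalities for \<open>x\<close> and for \<open>y\<close> come with different
  multipliers. Choosing \<open>c a = c' b\<close> makes the left ones agree, but for the right ones
  it yields only \<open>(c a' - c' b') s' = 0\<close>, as \<open>s'\<close> may be a zero divisor.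
  Moving \<open>s'\<close> to the front gives \<open>t (c a' - c' b') = 0\<close> with
  \<open>t\<close> equal to \<open>s'\<close> up to sign, so after a further multiplication by
  \<open>t\<close> one pair of multipliers serves both equalities.\<close>

lemma fraction_eq_add:
  assumes "((d, s, x), (d', s', x')) \<in> fraction_eq R p M n" "((d, s, y), (d', s', y')) \<in> fraction_eq R p M n"
  shows "((d, s, x \<otimes>\<^bsub>part M (d + n)\<^esub> y), (d', s', x' \<otimes>\<^bsub>part M (d' + n)\<^esub> y')) \<in> fraction_eq R p M n"
proof -
  obtain k k' a a' where a: "(d, s, x) \<in> fractions R p M n" "(d', s', x') \<in> fractions R p M n"
    "a \<in> grade R k" "a' \<in> grade R k'" "k + d = k' + d'" "a \<otimes> s = a' \<otimes> s'" "a \<otimes> s \<notin> p"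
    "a \<notin> p" "a' \<notin> p" "act M k (d + n) a x = act M k' (d' + n) a' x'" using assms(1) by (rule fraction_eqE)
  obtain l l' b b' where b: "(d, s, y) \<in> fractions R p M n" "(d', s', y') \<in> fractions R p M n"
    "b \<in> grade R l" "b' \<in> grade R l'" "l + d = l' + d'" "b \<otimes> s = b' \<otimes> s'" "b \<otimes> s \<notin> p"
    "b \<notin> p" "b' \<notin> p" "act M l (d + n) b y = act M l' (d' + n) b' y'" using assms(2) by (rule fraction_eqE)
  obtain c c' where c: "c \<in> grade R l" "c' \<in> grade R k" "c \<notin> p" "c' \<notin> p" "c \<otimes> a = c' \<otimes> b"
    by (rule ore[OF a(3,8) b(3,8)])
  have s: "s \<in> grade R d" "s' \<in> grade R d'" "s \<notin> p" "s' \<notin> p"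
    and x: "x \<in> carrier (part M (d + n))" "x' \<in> carrier (part M (d' + n))"
      "y \<in> carrier (part M (d + n))" "y' \<in> carrier (part M (d' + n))"
    using a(1,2) b(1,2) by (auto simp: fractions_iff)
  note cl = grade_closed[OF a(3)] grade_closed[OF a(4)] grade_closed[OF b(3)] grade_closed[OF b(4)]
    grade_closed[OF c(1)] grade_closed[OF c(2)] grade_closed[OF s(1)] grade_closed[OF s(2)]
  define m m' where "m = l + k" and "m' = l + k'"
  have m'2: "k + l' = m'" and mm': "m + d = m' + d'" unfolding m_def m'_def using a(5) b(5) by simp_all
  have gr: "c \<otimes> a \<in> grade R m" "c \<otimes> a' \<in> grade R m'" "c' \<otimes> b' \<in> grade R m'"
    using grade_mult'[OF c(1) a(3)] grade_mult'[OF c(1) a(4)] grade_mult'[OF c(2) b(4) m'2] by (auto simp: m_def m'_def)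
  note grc = gr[THEN grade_closed]
  have e1: "c \<otimes> a \<otimes> s = c \<otimes> a' \<otimes> s'" using a(6) cl by (simp add: m_assoc)
  have e2: "c \<otimes> a \<otimes> s = c' \<otimes> b' \<otimes> s'" unfolding c(5) using b(6) cl by (simp add: m_assoc)
  have D: "c \<otimes> a' \<oplus> \<ominus> (c' \<otimes> b') \<in> grade R m'" by (rule grade_add[OF gr(2) grade_neg[OF gr(3)]])
  have D0: "(c \<otimes> a' \<oplus> \<ominus> (c' \<otimes> b')) \<otimes> s' = \<zero>"
    using e1 e2 cl grc by (simp add: l_distr l_minus r_neg)
  obtain t where t: "t \<in> {s', \<ominus> s'}" "t \<in> grade R d'"
    "(c \<otimes> a' \<oplus> \<ominus> (c' \<otimes> b')) \<otimes> s' = t \<otimes> (c \<otimes> a' \<oplus> \<ominus> (c' \<otimes> b'))" by (rule grade_swap[OF D s(2)])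
  have tp: "t \<notin> p" using t(1) s(4) neg_notin[OF s(2,4)] by auto
  note tc = grade_closed[OF t(2)]
  have "t \<otimes> (c \<otimes> a') = t \<otimes> (c' \<otimes> b')"
  proof -
    have "t \<otimes> (c \<otimes> a') \<oplus> \<ominus> (t \<otimes> (c' \<otimes> b')) = \<zero>" using D0 t(3) tc grc by (simp add: r_distr r_minus)
    then show ?thesis using tc grc by (metis m_closed minus_equality minus_minus a_inv_closed a_comm)
  qed
  note te = this
  let ?X = "x \<otimes>\<^bsub>part M (d + n)\<^esub> y" and ?X' = "x' \<otimes>\<^bsub>part M (d' + n)\<^esub> y'"
  have X: "?X \<in> carrier (part M (d + n))" "?X' \<in> carrier (part M (d' + n))"
    using x by (auto simp: monoid.m_closed)
  have g: "t \<otimes> (c \<otimes> a) \<in> grade R (d' + m)" "t \<otimes> (c \<otimes> a') \<in> grade R (d' + m')"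
    by (rule grade_mult[OF t(2) gr(1)], rule grade_mult[OF t(2) gr(2)])
  have mn: "m + (d + n) = m' + (d' + n)" using mm' by simp
  show ?thesis
  proof (rule fraction_eqI[OF _ _ g])
    show "(d, s, ?X) \<in> fractions R p M n" "(d', s', ?X') \<in> fractions R p M n"
      using s X by (auto simp: fractions_iff)
    show "d' + m + d = d' + m' + d'" using mm' by simp
    show "t \<otimes> (c \<otimes> a) \<otimes> s = t \<otimes> (c \<otimes> a') \<otimes> s'" using e1 tc grc cl by (simp add: m_assoc)
    show "t \<otimes> (c \<otimes> a) \<otimes> s \<notin> p"
      using mult_notin[OF g(1) s(1) mult_notin[OF t(2) gr(1) tp mult_notin[OF c(1) a(3) c(3) a(8)]] s(3)] .
    have "act M m (d + n) (c \<otimes> a) x = act M l (k + (d + n)) c (act M k' (d' + n) a' x')"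
      unfolding m_def using act_mult[OF c(1) a(3) x(1)] a(10) by simp
    also have "\<dots> = act M m' (d' + n) (c \<otimes> a') x'"
      by (rule act_mult'[OF c(1) a(4) x(2), symmetric]) (use a(5) in \<open>auto simp: m'_def\<close>)
    finally have 1: "act M (d' + m) (d + n) (t \<otimes> (c \<otimes> a)) x = act M (d' + m') (d' + n) (t \<otimes> (c \<otimes> a')) x'"
      using act_mult[OF t(2) gr(1) x(1)] act_mult[OF t(2) gr(2) x(2)] mn by simp
    have "act M m (d + n) (c \<otimes> a) y = act M k (l + (d + n)) c' (act M l' (d' + n) b' y')"
      unfolding m_def c(5) using act_mult'[OF c(2) b(3) x(3), of "l + k"] b(10) by simp
    also have "\<dots> = act M m' (d' + n) (c' \<otimes> b') y'"
      by (rule act_mult'[OF c(2) b(4) x(4), symmetric]) (use b(5) m'2 in auto)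
    finally have 2: "act M (d' + m) (d + n) (t \<otimes> (c \<otimes> a)) y = act M (d' + m') (d' + n) (t \<otimes> (c \<otimes> a')) y'"
      unfolding te using act_mult[OF t(2) gr(1) x(3)] act_mult[OF t(2) gr(3) x(4)] mn by simp
    have mn': "d' + m + (d + n) = d' + m' + (d' + n)" using mm' by simp
    show "act M (d' + m) (d + n) (t \<otimes> (c \<otimes> a)) ?X = act M (d' + m') (d' + n) (t \<otimes> (c \<otimes> a')) ?X'"
      unfolding act_distrib[OF g(1) x(1,3)] act_distrib[OF g(2) x(2,4)] 1 2 mn' by (rule refl)
  qed
qed

definition frac :: "int \<Rightarrow> int \<Rightarrow> 'r \<Rightarrow> 'm \<Rightarrow> (int \<times> 'r \<times> 'm) set" where
  "frac n d s x = fraction_eq R p M n `` {(d, s, x)}"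

lemma frac_eq_iff:
  assumes "(d, s, x) \<in> fractions R p M n" "(d', s', x') \<in> fractions R p M n"
  shows "frac n d s x = frac n d' s' x' \<longleftrightarrow> ((d, s, x), (d', s', x')) \<in> fraction_eq R p M n"
  unfolding frac_def by (rule eq_equiv_class_iff[OF equiv_fraction_eq assms])

lemma frac_closed:
  "(d, s, x) \<in> fractions R p M n \<Longrightarrow> frac n d s x \<in> carrier (localization R p M n)"
  unfolding frac_def localization_def by (simp add: quotientI)

lemma localizationE:
  assumes "K \<in> carrier (localization R p M n)"
  obtains d s x where "(d, s, x) \<in> fractions R p M n" "K = frac n d s x"
  using assms unfolding localization_def frac_def by (auto elim!: quotientE)

lemma frac_mem: "(d', s', x') \<in> frac n d s x \<longleftrightarrow> ((d, s, x), (d', s', x')) \<in> fraction_eq R p M n"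
  by (simp add: frac_def)

text \<open>The definition takes a union over all representatives with a common denominator. By
  \<open>fraction_eq_add\<close> they all give the same class, so the union is that class.\<close>

lemma frac_mult:
  assumes x: "(d, s, x) \<in> fractions R p M n" and y: "(d, s, y) \<in> fractions R p M n"
  shows "frac n d s x \<otimes>\<^bsub>localization R p M n\<^esub> frac n d s y = frac n d s (x \<otimes>\<^bsub>part M (d + n)\<^esub> y)"
proof -
  have xy: "(d, s, x \<otimes>\<^bsub>part M (d + n)\<^esub> y) \<in> fractions R p M n"
    using x y by (auto simp: fractions_iff monoid.m_closed)
  let ?S = "{frac n d' s' (x' \<otimes>\<^bsub>part M (d' + n)\<^esub> y') | d' s' x' y'.
              (d', s', x') \<in> frac n d s x \<and> (d', s', y') \<in> frac n d s y}"
  have "?S = {frac n d s (x \<otimes>\<^bsub>part M (d + n)\<^esub> y)}"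
  proof (intro subset_antisym subsetI)
    fix K assume "K \<in> ?S"
    then obtain d' s' x' y' where *: "K = frac n d' s' (x' \<otimes>\<^bsub>part M (d' + n)\<^esub> y')"
      "((d, s, x), (d', s', x')) \<in> fraction_eq R p M n" "((d, s, y), (d', s', y')) \<in> fraction_eq R p M n"
      unfolding frac_mem by blast
    have "((d, s, x \<otimes>\<^bsub>part M (d + n)\<^esub> y), (d', s', x' \<otimes>\<^bsub>part M (d' + n)\<^esub> y')) \<in> fraction_eq R p M n"
      by (rule fraction_eq_add[OF *(2,3)])
    then show "K \<in> {frac n d s (x \<otimes>\<^bsub>part M (d + n)\<^esub> y)}"
      unfolding *(1) using equiv_class_eq[OF equiv_fraction_eq] by (simp add: frac_def)
  next
    fix K assume "K \<in> {frac n d s (x \<otimes>\<^bsub>part M (d + n)\<^esub> y)}"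
    then show "K \<in> ?S" using fraction_eq_refl[OF x] fraction_eq_refl[OF y] frac_mem by blast
  qed
  then show ?thesis by (simp add: localization_def frac_def)
qed

lemma frac_expand:
  assumes "(d, s, x) \<in> fractions R p M n" "a \<in> grade R k" "a \<notin> p" "k' = k + d"
  shows "frac n d s x = frac n k' (a \<otimes> s) (act M k (d + n) a x)"
    and "(k', a \<otimes> s, act M k (d + n) a x) \<in> fractions R p M n"
proof -
  have "((d, s, x), (k', a \<otimes> s, act M k (d + n) a x)) \<in> fraction_eq R p M n"
    by (rule fraction_expand[OF assms])
  then show "frac n d s x = frac n k' (a \<otimes> s) (act M k (d + n) a x)"
    unfolding frac_def by (rule equiv_class_eq[OF equiv_fraction_eq])
  show "(k', a \<otimes> s, act M k (d + n) a x) \<in> fractions R p M n"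
    using \<open>((d, s, x), (k', a \<otimes> s, act M k (d + n) a x)) \<in> fraction_eq R p M n\<close> unfolding fraction_eq_def by blast
qed

text \<open>Three classes are treated at once so that associativity is read off inside a single part
  of \<open>M\<close>.\<close>

lemma common_denominator3:
  assumes "K \<in> carrier (localization R p M n)" "L \<in> carrier (localization R p M n)" "N \<in> carrier (localization R p M n)"
  obtains d s x y z where "(d, s, x) \<in> fractions R p M n" "(d, s, y) \<in> fractions R p M n"
    "(d, s, z) \<in> fractions R p M n" "K = frac n d s x" "L = frac n d s y" "N = frac n d s z"
proof -
  have common: "\<exists>k k' a b. a \<in> grade R k \<and> a \<notin> p \<and> b \<in> grade R k' \<and> b \<notin> p \<and> k + d = k' + d' \<and> a \<otimes> s = b \<otimes> s'"
    if f: "(d, s, x) \<in> fractions R p M n" "(d', s', x') \<in> fractions R p M n" for d s x d' s' x'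
  proof -
    obtain a b where "a \<in> grade R d'" "b \<in> grade R d" "a \<notin> p" "b \<notin> p" "a \<otimes> s = b \<otimes> s'"
      by (rule ore[of s d s' d']) (use f in \<open>auto simp: fractions_iff\<close>)
    then show ?thesis using add.commute by blast
  qed
  obtain d s x where x: "(d, s, x) \<in> fractions R p M n" "K = frac n d s x" by (rule localizationE[OF assms(1)])
  obtain d' s' y where y: "(d', s', y) \<in> fractions R p M n" "L = frac n d' s' y" by (rule localizationE[OF assms(2)])
  obtain d'' s'' z where z: "(d'', s'', z) \<in> fractions R p M n" "N = frac n d'' s'' z" by (rule localizationE[OF assms(3)])
  obtain k k' a b where a: "a \<in> grade R k" "a \<notin> p" "b \<in> grade R k'" "b \<notin> p" "k + d = k' + d'" "a \<otimes> s = b \<otimes> s'"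
    using common[OF x(1) y(1)] by blast
  note x' = frac_expand[OF x(1) a(1,2) refl] and y' = frac_expand[OF y(1) a(3,4) a(5), folded a(6)]
  obtain l l' e f where e: "e \<in> grade R l" "e \<notin> p" "f \<in> grade R l'" "f \<notin> p" "l + (k + d) = l' + d''"
    "e \<otimes> (a \<otimes> s) = f \<otimes> s''"
    using common[OF x'(2) z(1)] by blast
  note x'' = frac_expand[OF x'(2) e(1,2) refl] and y'' = frac_expand[OF y'(2) e(1,2) refl]
    and z'' = frac_expand[OF z(1) e(3,4) e(5), folded e(6)]
  show ?thesis
    using that[OF x''(2) y''(2) z''(2)] x(2) y(2) z(2) x'(1) y'(1) x''(1) y''(1) z''(1) by simp
qed

lemma localization_one:
  "\<one>\<^bsub>localization R p M n\<^esub> = frac n 0 \<one> \<one>\<^bsub>part M n\<^esub>"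
  by (simp add: localization_def frac_def)

lemma one_fraction: "x \<in> carrier (part M n) \<Longrightarrow> (0, \<one>, x) \<in> fractions R p M n"
  using grade_one one_notin by (simp add: fractions_iff)

lemma frac_one:
  assumes "s \<in> grade R d" "s \<notin> p"
  shows "frac n d s \<one>\<^bsub>part M (d + n)\<^esub> = \<one>\<^bsub>localization R p M n\<^esub>"
proof -
  have "(0, \<one>, \<one>\<^bsub>part M n\<^esub>) \<in> fractions R p M n" by (simp add: one_fraction monoid.one_closed)
  from frac_expand(1)[OF this assms, of d] show ?thesis
    unfolding localization_one using grade_closed[OF assms(1)] act_unit[OF assms(1), of n] by simp
qed

lemma localization_comm_group: "comm_group (localization R p M n)" (is "comm_group ?L")
proof (rule comm_groupI)
  show "\<one>\<^bsub>?L\<^esub> \<in> carrier ?L"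
    unfolding localization_one by (intro frac_closed one_fraction monoid.one_closed) simp
next
  fix x y assume xy: "x \<in> carrier ?L" "y \<in> carrier ?L"
  obtain d s a b where *: "(d, s, a) \<in> fractions R p M n" "(d, s, b) \<in> fractions R p M n"
    "x = frac n d s a" "y = frac n d s b"
    by (rule common_denominator3[OF xy(1,2,1)])
  interpret G: comm_group "part M (d + n)" by simp
  have ab: "(d, s, a \<otimes>\<^bsub>part M (d + n)\<^esub> b) \<in> fractions R p M n" using * by (simp add: fractions_iff)
  show "x \<otimes>\<^bsub>?L\<^esub> y \<in> carrier ?L" using * frac_closed[OF ab] by (simp add: frac_mult)
  show "x \<otimes>\<^bsub>?L\<^esub> y = y \<otimes>\<^bsub>?L\<^esub> x" using * by (simp add: frac_mult G.m_comm fractions_iff)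
next
  fix x y z assume "x \<in> carrier ?L" "y \<in> carrier ?L" "z \<in> carrier ?L"
  then obtain d s a b c where *: "(d, s, a) \<in> fractions R p M n" "(d, s, b) \<in> fractions R p M n"
    "(d, s, c) \<in> fractions R p M n" "x = frac n d s a" "y = frac n d s b" "z = frac n d s c"
    by (rule common_denominator3)
  interpret G: comm_group "part M (d + n)" by simp
  show "x \<otimes>\<^bsub>?L\<^esub> y \<otimes>\<^bsub>?L\<^esub> z = x \<otimes>\<^bsub>?L\<^esub> (y \<otimes>\<^bsub>?L\<^esub> z)"
    using * by (simp add: frac_mult G.m_assoc fractions_iff)
next
  fix x assume "x \<in> carrier ?L"
  then obtain d s a where *: "(d, s, a) \<in> fractions R p M n" "x = frac n d s a" by (rule localizationE)
  interpret G: comm_group "part M (d + n)" by simp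
  have s: "s \<in> grade R d" "s \<notin> p" and a: "a \<in> carrier (part M (d + n))" using * by (auto simp: fractions_iff)
  have 1: "(d, s, \<one>\<^bsub>part M (d + n)\<^esub>) \<in> fractions R p M n" and i: "(d, s, inv\<^bsub>part M (d + n)\<^esub> a) \<in> fractions R p M n"
    using s a by (auto simp: fractions_iff)
  show "\<one>\<^bsub>?L\<^esub> \<otimes>\<^bsub>?L\<^esub> x = x" unfolding *(2) frac_one[OF s, symmetric] frac_mult[OF 1 *(1)] using a by simp
  show "\<exists>y\<in>carrier ?L. y \<otimes>\<^bsub>?L\<^esub> x = \<one>\<^bsub>?L\<^esub>"
    using frac_closed[OF i] frac_mult[OF i *(1)] a *(2) frac_one[OF s] by auto
qed

lemma frac_one_eq_one_iff:
  assumes x: "x \<in> carrier (part M n)"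
  shows "frac n 0 \<one> x = \<one>\<^bsub>localization R p M n\<^esub> \<longleftrightarrow> torsion R p M n x"
proof -
  have 1: "(0, \<one>, x) \<in> fractions R p M n" "(0, \<one>, \<one>\<^bsub>part M n\<^esub>) \<in> fractions R p M n"
    using x by (auto simp: one_fraction monoid.one_closed)
  show ?thesis
  proof
    assume "frac n 0 \<one> x = \<one>\<^bsub>localization R p M n\<^esub>"
    then have "((0, \<one>, x), (0, \<one>, \<one>\<^bsub>part M n\<^esub>)) \<in> fraction_eq R p M n"
      unfolding localization_one frac_eq_iff[OF 1] .
    then obtain k k' a a' where a: "a \<in> grade R k" "a' \<in> grade R k'" "k + 0 = k' + 0" "a \<otimes> \<one> = a' \<otimes> \<one>" "a \<notin> p"
      "act M k (0 + n) a x = act M k' (0 + n) a' \<one>\<^bsub>part M n\<^esub>" by (rule fraction_eqE)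
    have "act M k n a x = \<one>\<^bsub>part M (k + n)\<^esub>" using a(3,6) act_unit[OF a(2), of n] by simp
    then show "torsion R p M n x" unfolding torsion_def using a(1,5) by blast
  next
    assume "torsion R p M n x"
    then obtain e s where s: "s \<in> grade R e" "s \<notin> p" "act M e n s x = \<one>\<^bsub>part M (e + n)\<^esub>"
      unfolding torsion_def by blast
    have "((0, \<one>, x), (0, \<one>, \<one>\<^bsub>part M n\<^esub>)) \<in> fraction_eq R p M n"
      by (rule fraction_eqI[OF 1 s(1) s(1)]) (use s grade_closed[OF s(1)] act_unit[OF s(1), of n] in simp_all)
    then show "frac n 0 \<one> x = \<one>\<^bsub>localization R p M n\<^esub>" unfolding localization_one frac_eq_iff[OF 1] .
  qed
qed

lemma localization_trivial:
  assumes "\<And>k x. x \<in> carrier (part M k) \<Longrightarrow> torsion R p M k x"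
  shows "carrier (localization R p M n) = {\<one>\<^bsub>localization R p M n\<^esub>}"
proof -
  have "K = \<one>\<^bsub>localization R p M n\<^esub>" if K: "K \<in> carrier (localization R p M n)" for K
  proof -
    obtain d s x where x: "(d, s, x) \<in> fractions R p M n" "K = frac n d s x" using K by (rule localizationE)
    then have s: "s \<in> grade R d" "s \<notin> p" "x \<in> carrier (part M (d + n))" by (auto simp: fractions_iff)
    obtain e t where t: "t \<in> grade R e" "t \<notin> p" "act M e (d + n) t x = \<one>\<^bsub>part M (e + (d + n))\<^esub>"
      using assms[OF s(3)] unfolding torsion_def by blast
    have "K = frac n (e + d) (t \<otimes> s) \<one>\<^bsub>part M (e + (d + n))\<^esub>"
      using frac_expand(1)[OF x(1) t(1,2) refl] t(3) x(2) by simp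
    then show ?thesis using frac_one[OF grade_mult[OF t(1) s(1)] mult_notin[OF t(1) s(1) t(2) s(2)], of n]
      by (simp add: add.assoc)
  qed
  moreover have "\<one>\<^bsub>localization R p M n\<^esub> \<in> carrier (localization R p M n)"
    using localization_comm_group[of n] by (simp add: comm_group_def group.is_monoid monoid.one_closed)
  ultimately show ?thesis by blast
qed

text \<open>Reduces both sides of the theorem's support condition to annihilation of single
  elements.\<close>

lemma localization_zero_iff:
  "localization_zero R p M \<longleftrightarrow> (\<forall>k. \<forall>x\<in>carrier (part M k). torsion R p M k x)"
proof (intro iffI allI ballI)
  fix k x assume z: "localization_zero R p M" and x: "x \<in> carrier (part M k)"
  have "frac k 0 \<one> x \<in> carrier (localization R p M k)" by (rule frac_closed[OF one_fraction[OF x]])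
  then have "frac k 0 \<one> x = \<one>\<^bsub>localization R p M k\<^esub>" using z unfolding localization_zero_def by simp
  then show "torsion R p M k x" unfolding frac_one_eq_one_iff[OF x] .
next
  assume t: "\<forall>k. \<forall>x\<in>carrier (part M k). torsion R p M k x"
  show "localization_zero R p M"
    unfolding localization_zero_def by (intro allI localization_trivial) (use t in simp)
qed

end

section \<open>Powers of the suspension\<close>

text \<open>The common shape of \<open>SigO_pow\<close> and \<open>SigA_pow\<close>; the addition
  rule for integer exponents is proved once for both.\<close>

definition bij_pow :: "'b set \<Rightarrow> ('b \<Rightarrow> 'b) \<Rightarrow> int \<Rightarrow> 'b \<Rightarrow> 'b" where
  "bij_pow A f n = (if 0 \<le> n then f ^^ nat n else inv_into A f ^^ nat (- n))"

lemma bij_pow_closed: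
  assumes "bij_betw f A A" "x \<in> A"
  shows "bij_pow A f n x \<in> A"
proof -
  have c: "(g ^^ k) x \<in> A" if "bij_betw g A A" for g :: "'a \<Rightarrow> 'a" and k
    by (induction k) (use assms(2) bij_betwE[OF that] in auto)
  show ?thesis
    using c[OF assms(1)] c[OF bij_betw_inv_into[OF assms(1)]] by (simp add: bij_pow_def)
qed

lemma bij_pow_zero [simp]: "bij_pow A f 0 x = x"
  by (simp add: bij_pow_def)

lemma bij_pow_Suc:
  assumes "bij_betw f A A" "x \<in> A"
  shows "bij_pow A f (n + 1) x = f (bij_pow A f n x)"
proof (cases "0 \<le> n")
  case True
  then have "nat (n + 1) = Suc (nat n)" by simp
  then show ?thesis using True by (simp add: bij_pow_def)
next
  case False
  then obtain k where k: "nat (- n) = Suc k" by (cases "nat (- n)") auto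
  then have n: "n = - int k - 1" by simp
  have "bij_pow A f (- int k) x = (inv_into A f ^^ k) x"
    by (cases k) (simp_all add: bij_pow_def nat_add_distrib)
  moreover have "(inv_into A f ^^ k) x \<in> A"
    using calculation bij_pow_closed[OF assms, of "- int k"] by simp
  moreover have "bij_pow A f n x = inv_into A f ((inv_into A f ^^ k) x)"
    using False k by (simp add: bij_pow_def)
  ultimately show ?thesis
    unfolding n using bij_betw_inv_into_right[OF assms(1)] by simp
qed

lemma bij_pow_add:
  assumes "bij_betw f A A" "x \<in> A"
  shows "bij_pow A f (m + n) x = bij_pow A f m (bij_pow A f n x)"
proof (induction m rule: int_induct[of _ 0])
  case base show ?case by simp
next
  case (step1 i)
  have "bij_pow A f (i + n + 1) x = f (bij_pow A f (i + n) x)" by (rule bij_pow_Suc[OF assms])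
  then show ?case
    using step1 bij_pow_Suc[OF assms(1) bij_pow_closed[OF assms, of n], of i] by (simp add: ac_simps)
next
  case (step2 i)
  \<comment> \<open>Downwards the claim is checked after one more application of \<open>f\<close>,
    which is injective on \<open>A\<close>.\<close>
  have "f (bij_pow A f (i - 1 + n) x) = f (bij_pow A f (i - 1) (bij_pow A f n x))"
    using step2 bij_pow_Suc[OF assms(1) bij_pow_closed[OF assms, of n], of "i - 1"]
      bij_pow_Suc[OF assms, of "i - 1 + n"] by simp
  then show ?case
    using bij_betw_imp_inj_on[OF assms(1)] bij_pow_closed[OF assms] bij_pow_closed[OF assms(1) bij_pow_closed[OF assms]]
    by (meson inj_onD)
qed

section \<open>Signs on morphisms\<close>

context additive_category
begin

text \<open>This is \<open>(-1)^k f\<close>. The exponent is kept as an integer, so that signs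
  combine by adding exponents.\<close>

definition signed :: "int \<Rightarrow> 'b \<Rightarrow> 'b" where
  "signed k f = (if even k then f else Neg T f)"

lemma Neg_eq: "f \<in> hom_set T X Y \<Longrightarrow> Neg T f = inv\<^bsub>Hom T X Y\<^esub> f"
  by (auto simp: Neg_def Hom_carrier)

lemma Neg_hom: "f \<in> hom_set T X Y \<Longrightarrow> Neg T f \<in> hom_set T X Y"
  using Neg_eq[of f X Y] hom_group[of X Y] hom_obj[of f X Y] group.inv_closed comm_group.axioms(2) by metis

lemma Neg_Neg: "f \<in> hom_set T X Y \<Longrightarrow> Neg T (Neg T f) = f"
  using Neg_eq[of f X Y] Neg_eq[of "Neg T f" X Y] Neg_hom[of f X Y] hom_group[of X Y] hom_obj[of f X Y]
    group.inv_inv comm_group.axioms(2) by metis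

lemma Neg_Zer:
  assumes "X \<in> Obj T" "Y \<in> Obj T"
  shows "Neg T (Zer T X Y) = Zer T X Y"
proof -
  interpret G: comm_group "Hom T X Y" using hom_group assms by blast
  show ?thesis using Neg_eq[OF zero_hom[OF assms]] G.inv_one by (simp only: one_Hom)
qed

lemma Neg_unique:
  assumes "f \<in> hom_set T X Y" "g \<in> hom_set T X Y" "Add T g f = Zer T X Y"
  shows "g = Neg T f"
proof -
  interpret G: comm_group "Hom T X Y" using hom_group hom_obj[OF assms(1)] by blast
  have "g \<otimes>\<^bsub>Hom T X Y\<^esub> f = \<one>\<^bsub>Hom T X Y\<^esub>" using assms(3) by (simp add: Hom_def)
  then show ?thesis using Neg_eq[OF assms(1)] G.inv_equality[OF _ assms(1,2)] by simp
qed

lemma Add_Neg: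
  assumes "f \<in> hom_set T X Y"
  shows "Add T (Neg T f) f = Zer T X Y"
proof -
  interpret G: comm_group "Hom T X Y" using hom_group hom_obj[OF assms] by blast
  have "inv\<^bsub>Hom T X Y\<^esub> f \<otimes>\<^bsub>Hom T X Y\<^esub> f = \<one>\<^bsub>Hom T X Y\<^esub>" using assms by simp
  then show ?thesis using Neg_eq[OF assms] by (simp add: Hom_def)
qed

lemma Add_hom: "f \<in> hom_set T X Y \<Longrightarrow> g \<in> hom_set T X Y \<Longrightarrow> Add T f g \<in> hom_set T X Y"
proof -
  assume fg: "f \<in> hom_set T X Y" "g \<in> hom_set T X Y"
  interpret G: comm_group "Hom T X Y" using hom_group hom_obj[OF fg(1)] by blast
  show ?thesis using G.m_closed[OF fg] by (simp add: Hom_def)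
qed

lemma comp_Neg_left:
  assumes f: "f \<in> hom_set T X Y" and g: "g \<in> hom_set T Y Z"
  shows "Neg T g \<bullet> f = Neg T (g \<bullet> f)"
  by (rule Neg_unique[OF comp_hom[OF f g] comp_hom[OF f Neg_hom[OF g]]])
    (use comp_add_left[OF f Neg_hom[OF g] g] Add_Neg[OF g] comp_zero_left[OF _ f, of Z] hom_obj[OF g] in simp)

lemma comp_Neg_right:
  assumes f: "f \<in> hom_set T X Y" and g: "g \<in> hom_set T Y Z"
  shows "g \<bullet> Neg T f = Neg T (g \<bullet> f)"
  by (rule Neg_unique[OF comp_hom[OF f g] comp_hom[OF Neg_hom[OF f] g]])
    (use comp_add_right[OF Neg_hom[OF f] f g] Add_Neg[OF f] comp_zero_right[OF _ g, of X] hom_obj[OF f] in simp)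

lemma signed_hom: "f \<in> hom_set T X Y \<Longrightarrow> signed k f \<in> hom_set T X Y"
  by (simp add: signed_def Neg_hom)

lemma signed_signed: "f \<in> hom_set T X Y \<Longrightarrow> signed k (signed l f) = signed (k + l) f"
  by (auto simp: signed_def Neg_Neg)

lemma signed_even: "even k \<Longrightarrow> signed k f = f"
  by (simp add: signed_def)

lemma signed_cong: "even k = even l \<Longrightarrow> signed k f = signed l f"
  by (simp add: signed_def)

lemma signed_Zer: "X \<in> Obj T \<Longrightarrow> Y \<in> Obj T \<Longrightarrow> signed k (Zer T X Y) = Zer T X Y"
  by (simp add: signed_def Neg_Zer)

lemma signed_eq_Zer:
  assumes "f \<in> hom_set T X Y" "signed k f = Zer T X Y"
  shows "f = Zer T X Y"
proof -
  have "signed k (signed k f) = f" using signed_signed[OF assms(1), of k k] by (simp add: signed_even)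
  then show ?thesis using assms(2) signed_Zer hom_obj[OF assms(1)] by simp
qed

lemma signed_comp_left: "f \<in> hom_set T X Y \<Longrightarrow> g \<in> hom_set T Y Z \<Longrightarrow> signed k g \<bullet> f = signed k (g \<bullet> f)"
  by (simp add: signed_def comp_Neg_left)

lemma signed_comp_right: "f \<in> hom_set T X Y \<Longrightarrow> g \<in> hom_set T Y Z \<Longrightarrow> g \<bullet> signed k f = signed k (g \<bullet> f)"
  by (simp add: signed_def comp_Neg_right)

end

section \<open>Suspension powers of arrows and elements of the graded centre\<close>

context triangulated_category
begin

abbreviation so :: "int \<Rightarrow> 'a \<Rightarrow> 'a" where "so \<equiv> SigO_pow T"
abbreviation sa :: "int \<Rightarrow> 'b \<Rightarrow> 'b" where "sa \<equiv> SigA_pow T"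

lemma so_bij_pow: "so = bij_pow (Obj T) (SigO T)" and sa_bij_pow: "sa = bij_pow (Arr T) (SigA T)"
  by (simp_all add: SigO_pow_def SigA_pow_def bij_pow_def fun_eq_iff)

lemma so_zero [simp]: "so 0 X = X" and sa_zero [simp]: "sa 0 f = f"
  by (simp_all add: so_bij_pow sa_bij_pow)

lemma so_obj [simp]: "X \<in> Obj T \<Longrightarrow> so n X \<in> Obj T"
  unfolding so_bij_pow by (rule bij_pow_closed[OF susp_obj_bij])

lemma sa_arr: "f \<in> Arr T \<Longrightarrow> sa n f \<in> Arr T"
  unfolding sa_bij_pow by (rule bij_pow_closed[OF susp_arr_bij])

lemma so_add: "X \<in> Obj T \<Longrightarrow> so m (so n X) = so (m + n) X"
  unfolding so_bij_pow by (rule bij_pow_add[OF susp_obj_bij, symmetric])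

lemma sa_add: "f \<in> Arr T \<Longrightarrow> sa m (sa n f) = sa (m + n) f"
  unfolding sa_bij_pow by (rule bij_pow_add[OF susp_arr_bij, symmetric])

lemma so_Suc: "X \<in> Obj T \<Longrightarrow> so (n + 1) X = SigO T (so n X)"
  unfolding so_bij_pow by (rule bij_pow_Suc[OF susp_obj_bij])

lemma sa_Suc: "f \<in> Arr T \<Longrightarrow> sa (n + 1) f = SigA T (sa n f)"
  unfolding sa_bij_pow by (rule bij_pow_Suc[OF susp_arr_bij])

lemma hom_arr: "f \<in> hom_set T X Y \<Longrightarrow> f \<in> Arr T"
  by (simp add: Hom_carrier)

lemma SigO_obj: "X \<in> Obj T \<Longrightarrow> SigO T X \<in> Obj T"
  using bij_betwE[OF susp_obj_bij] by blast

lemma SigO_eq: "X \<in> Obj T \<Longrightarrow> SigO T X = so 1 X"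
  using so_Suc[of X 0] by simp

lemma SigA_eq: "f \<in> Arr T \<Longrightarrow> SigA T f = sa 1 f"
  using sa_Suc[of f 0] by simp

lemma SigA_inj: "f \<in> Arr T \<Longrightarrow> g \<in> Arr T \<Longrightarrow> SigA T f = SigA T g \<Longrightarrow> f = g"
  using susp_arr_bij by (meson bij_betw_imp_inj_on inj_onD)

lemma SigO_inj: "X \<in> Obj T \<Longrightarrow> Y \<in> Obj T \<Longrightarrow> SigO T X = SigO T Y \<Longrightarrow> X = Y"
  using susp_obj_bij by (meson bij_betw_imp_inj_on inj_onD)

lemma sa_hom:
  assumes f: "f \<in> hom_set T X Y"
  shows "sa n f \<in> hom_set T (so n X) (so n Y)"
proof (induction n rule: int_induct[of _ 0])
  case base show ?case using f by simp
next
  case (step1 i)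
  then show ?case using susp_hom sa_Suc[OF hom_arr[OF f]] so_Suc hom_obj[OF f] by simp
next
  case (step2 i)
  \<comment> \<open>\<open>susp_hom\<close> only goes upwards. The source and target of the
    desuspended arrow are recovered from those of its suspension, by injectivity of
    \<open>SigO\<close> on objects.\<close>
  let ?g = "sa (i - 1) f"
  have g: "?g \<in> Arr T" by (rule sa_arr[OF hom_arr[OF f]])
  then have "?g \<in> hom_set T (Dom T ?g) (Cod T ?g)" by (simp add: Hom_carrier)
  then have "SigA T ?g \<in> hom_set T (SigO T (Dom T ?g)) (SigO T (Cod T ?g))" by (rule susp_hom)
  moreover have "SigA T ?g = sa i f" using sa_Suc[OF hom_arr[OF f], of "i - 1"] by simp
  ultimately have "SigO T (Dom T ?g) = so i X" "SigO T (Cod T ?g) = so i Y"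
    using step2 by (auto simp: Hom_carrier)
  moreover have "SigO T (so (i - 1) X) = so i X" "SigO T (so (i - 1) Y) = so i Y"
    using so_Suc[of X "i - 1"] so_Suc[of Y "i - 1"] hom_obj[OF f] by auto
  ultimately have "Dom T ?g = so (i - 1) X" "Cod T ?g = so (i - 1) Y"
    using SigO_inj dom_obj[OF g] cod_obj[OF g] so_obj hom_obj[OF f] by metis+
  then show ?case using g by (simp add: Hom_carrier)
qed

lemma sa_inverse: "f \<in> hom_set T X Y \<Longrightarrow> sa (- n) (sa n f) = f" "f \<in> hom_set T X Y \<Longrightarrow> sa n (sa (- n) f) = f"
  using sa_add[OF hom_arr] by simp_all

lemma sa_inj: "f \<in> hom_set T X Y \<Longrightarrow> g \<in> hom_set T X' Y' \<Longrightarrow> sa n f = sa n g \<Longrightarrow> f = g"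
  using sa_inverse(1) by metis

lemma sa_comp:
  assumes f: "f \<in> hom_set T X Y" and g: "g \<in> hom_set T Y Z"
  shows "sa n (g \<bullet> f) = sa n g \<bullet> sa n f"
proof (induction n rule: int_induct[of _ 0])
  case base show ?case by simp
next
  case (step1 i)
  then show ?case using sa_Suc hom_arr[OF f] hom_arr[OF g] hom_arr[OF comp_hom[OF f g]]
      susp_comp[OF sa_hom[OF f, of i] sa_hom[OF g, of i]] by simp
next
  case (step2 i)
  have "SigA T (sa (i - 1) (g \<bullet> f)) = SigA T (sa (i - 1) g \<bullet> sa (i - 1) f)"
    using step2 sa_Suc[of _ "i - 1"] hom_arr[OF f] hom_arr[OF g] hom_arr[OF comp_hom[OF f g]]
      susp_comp[OF sa_hom[OF f, of "i - 1"] sa_hom[OF g, of "i - 1"]] by simp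
  then show ?case
    using SigA_inj sa_arr[OF hom_arr[OF comp_hom[OF f g]]] hom_arr[OF comp_hom[OF sa_hom[OF f] sa_hom[OF g]]] by blast
qed

lemma sa_Add:
  assumes f: "f \<in> hom_set T X Y" and g: "g \<in> hom_set T X Y"
  shows "sa n (Add T f g) = Add T (sa n f) (sa n g)"
proof (induction n rule: int_induct[of _ 0])
  case base show ?case by simp
next
  case (step1 i)
  then show ?case using sa_Suc hom_arr[OF f] hom_arr[OF g] hom_arr[OF Add_hom[OF f g]]
      susp_add[OF sa_hom[OF f, of i] sa_hom[OF g, of i]] by simp
next
  case (step2 i)
  have "SigA T (sa (i - 1) (Add T f g)) = SigA T (Add T (sa (i - 1) f) (sa (i - 1) g))"
    using step2 sa_Suc[of _ "i - 1"] hom_arr[OF f] hom_arr[OF g] hom_arr[OF Add_hom[OF f g]]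
      susp_add[OF sa_hom[OF f, of "i - 1"] sa_hom[OF g, of "i - 1"]] by simp
  then show ?case
    using SigA_inj sa_arr[OF hom_arr[OF Add_hom[OF f g]]] hom_arr[OF Add_hom[OF sa_hom[OF f] sa_hom[OF g]]] by blast
qed

lemma sa_Zer:
  assumes "X \<in> Obj T" "Y \<in> Obj T"
  shows "sa n (Zer T X Y) = Zer T (so n X) (so n Y)"
  using sa_Add[OF zero_hom zero_hom, of X Y n] zero_if_idem[OF sa_hom[OF zero_hom], of X Y n] add_zero assms
  by simp

lemma sa_Neg:
  assumes f: "f \<in> hom_set T X Y"
  shows "sa n (Neg T f) = Neg T (sa n f)"
  by (rule Neg_unique[OF sa_hom[OF f] sa_hom[OF Neg_hom[OF f]]])
    (use sa_Add[OF Neg_hom[OF f] f, of n] Add_Neg[OF f] sa_Zer hom_obj[OF f] in simp)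

lemma sa_Idt:
  assumes X: "X \<in> Obj T"
  shows "sa n (Idt T X) = Idt T (so n X)"
proof (induction n rule: int_induct[of _ 0])
  case base show ?case by simp
next
  case (step1 i)
  then show ?case using sa_Suc[OF hom_arr[OF id_hom[OF X]], of i] susp_id[of "so i X"] so_Suc[OF X] X by simp
next
  case (step2 i)
  have "SigA T (sa (i - 1) (Idt T X)) = SigA T (Idt T (so (i - 1) X))"
    using step2 sa_Suc[OF hom_arr[OF id_hom[OF X]], of "i - 1"] susp_id[of "so (i - 1) X"] so_Suc[OF X, of "i - 1"] X by simp
  then show ?case
    using SigA_inj sa_arr[OF hom_arr[OF id_hom[OF X]]] hom_arr[OF id_hom[OF so_obj[OF X]]] by blast
qed

lemma sa_signed: "f \<in> hom_set T X Y \<Longrightarrow> sa n (signed k f) = signed k (sa n f)"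
  by (simp add: signed_def sa_Neg)

lemma center_hom: "\<eta> \<in> center T n \<Longrightarrow> X \<in> Obj T \<Longrightarrow> \<eta> X \<in> hom_set T X (so n X)"
  unfolding center_def by blast

lemma center_natural:
  "\<eta> \<in> center T n \<Longrightarrow> f \<in> hom_set T X Y \<Longrightarrow> sa n f \<bullet> \<eta> X = \<eta> Y \<bullet> f"
  unfolding center_def Hom_carrier by blast

text \<open>Each suspension contributes one sign \<open>(-1)^n\<close>, and each desuspension too,
  since the sign is its own inverse. The signs that arise when ring elements act on shifted objects
  come from here.\<close>

lemma center_shift:
  assumes e: "\<eta> \<in> center T n" and X: "X \<in> Obj T"
  shows "\<eta> (so m X) = signed (m * n) (sa m (\<eta> X))"
proof -
  have s: "\<eta> (SigO T Y) = signed n (SigA T (\<eta> Y))" if "Y \<in> Obj T" for Y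
    using e that unfolding center_def signed_def by simp
  note h = center_hom[OF e X]
  have h1: "\<eta> (so i X) \<in> hom_set T (so i X) (so n (so i X))" for i using center_hom[OF e so_obj[OF X]] .
  show ?thesis
  proof (induction m rule: int_induct[of _ 0])
    case base show ?case by (simp add: signed_even)
  next
    case (step1 i)
    have "SigA T (signed (i * n) (sa i (\<eta> X))) = signed (i * n) (sa (i + 1) (\<eta> X))"
      using sa_signed[OF sa_hom[OF h, of i], of 1 "i * n"] SigA_eq[OF hom_arr[OF signed_hom[OF sa_hom[OF h, of i]]]]
        sa_add[OF hom_arr[OF h], of 1 i] by (simp add: add.commute)
    then have "\<eta> (so (i + 1) X) = signed n (signed (i * n) (sa (i + 1) (\<eta> X)))"
      using step1 s[of "so i X"] so_Suc[OF X, of i] X by simp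
    then show ?case using signed_signed[OF sa_hom[OF h, of "i + 1"], of n "i * n"] by (simp add: algebra_simps)
  next
    case (step2 i)
    have hi: "SigA T (\<eta> (so (i - 1) X)) \<in> hom_set T (SigO T (so (i - 1) X)) (SigO T (so n (so (i - 1) X)))"
      by (rule susp_hom[OF h1])
    have "\<eta> (so i X) = signed n (SigA T (\<eta> (so (i - 1) X)))"
      using s[of "so (i - 1) X"] so_Suc[OF X, of "i - 1"] X by simp
    then have "SigA T (\<eta> (so (i - 1) X)) = signed n (\<eta> (so i X))"
      using signed_signed[OF hi, of n n] by (simp add: signed_even)
    also have "\<dots> = signed (n + i * n) (sa i (\<eta> X))"
      using step2 signed_signed[OF sa_hom[OF h, of i], of n "i * n"] by simp
    also have "\<dots> = signed ((i - 1) * n) (sa i (\<eta> X))"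
      by (rule signed_cong) (simp add: algebra_simps)
    also have "\<dots> = SigA T (signed ((i - 1) * n) (sa (i - 1) (\<eta> X)))"
      using sa_signed[OF sa_hom[OF h, of "i - 1"], of 1 "(i - 1) * n"]
        SigA_eq[OF hom_arr[OF signed_hom[OF sa_hom[OF h, of "i - 1"]]]] sa_add[OF hom_arr[OF h], of 1 "i - 1"] by simp
    finally show ?case
      using SigA_inj[OF hom_arr[OF h1] hom_arr[OF signed_hom[OF sa_hom[OF h]]]] by blast
  qed
qed

end

section \<open>The graded modules attached to a linear triangulated category\<close>

context linear_triangulated_category
begin

lemma phi_hom: "r \<in> grade R n \<Longrightarrow> X \<in> Obj T \<Longrightarrow> \<phi> n r X \<in> hom_set T X (so n X)"
  by (rule center_hom[OF phi_center])

lemma phi_natural: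
  "r \<in> grade R n \<Longrightarrow> f \<in> hom_set T X Y \<Longrightarrow> sa n f \<bullet>\<^bsub>T\<^esub> \<phi> n r X = \<phi> n r Y \<bullet>\<^bsub>T\<^esub> f"
  by (rule center_natural[OF phi_center])

lemma phi_shift: "r \<in> grade R n \<Longrightarrow> X \<in> Obj T \<Longrightarrow> \<phi> n r (so m X) = signed (m * n) (sa m (\<phi> n r X))"
  by (rule center_shift[OF phi_center])

lemma phi_add_at:
  "r \<in> grade R n \<Longrightarrow> s \<in> grade R n \<Longrightarrow> X \<in> Obj T \<Longrightarrow>
    \<phi> n (r \<oplus>\<^bsub>R\<^esub> s) X = Add T (\<phi> n r X) (\<phi> n s X)"
  by (simp add: phi_add center_add_def)

lemma phi_mult_at:
  "r \<in> grade R m \<Longrightarrow> s \<in> grade R n \<Longrightarrow> X \<in> Obj T \<Longrightarrow> k = m + n \<Longrightarrow>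
    \<phi> k (r \<otimes>\<^bsub>R\<^esub> s) X = sa n (\<phi> m r X) \<bullet>\<^bsub>T\<^esub> \<phi> n s X"
  by (simp add: phi_mult center_mult_def)

lemma phi_one_at: "X \<in> Obj T \<Longrightarrow> \<phi> 0 \<one>\<^bsub>R\<^esub> X = Idt T X"
  by (simp add: phi_one)

lemma phi_zero_at: "X \<in> Obj T \<Longrightarrow> \<phi> n \<zero>\<^bsub>R\<^esub> X = Zer T X (so n X)"
  using phi_add_at[OF grade_zero grade_zero, of X n] zero_if_idem[OF phi_hom[OF grade_zero]] by simp

lemma phi_neg_at:
  assumes "r \<in> grade R n" "X \<in> Obj T"
  shows "\<phi> n (\<ominus>\<^bsub>R\<^esub> r) X = Neg T (\<phi> n r X)"
proof (rule Neg_unique[OF phi_hom[OF assms] phi_hom[OF grade_neg[OF assms(1)] assms(2)]])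
  show "Add T (\<phi> n (\<ominus>\<^bsub>R\<^esub> r) X) (\<phi> n r X) = Zer T X (so n X)"
    using phi_add_at[OF grade_neg[OF assms(1)] assms] phi_zero_at[OF assms(2)] grade_closed[OF assms(1)]
    by (simp add: l_neg)
qed

lemma phi_commute:
  assumes r: "r \<in> grade R m" and s: "s \<in> grade R n" and X: "X \<in> Obj T"
  shows "\<phi> (m + n) (r \<otimes>\<^bsub>R\<^esub> s) X = signed (m * n) (\<phi> (m + n) (s \<otimes>\<^bsub>R\<^esub> r) X)"
  using grade_comm[OF r s] phi_neg_at[OF grade_mult[OF s r] X] by (simp add: signed_def add.commute)

lemma Hom_star_simps:
  "part (Hom_star T \<phi> X A) n = Hom T X (so n A)"
  "act (Hom_star T \<phi> X A) d n r x = sa n (\<phi> d r A) \<bullet>\<^bsub>T\<^esub> x"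
  by (simp_all add: Hom_star_def)

lemma sa_phi_hom:
  assumes "r \<in> grade R d" "A \<in> Obj T"
  shows "sa n (\<phi> d r A) \<in> hom_set T (so n A) (so (d + n) A)"
  using sa_hom[OF phi_hom[OF assms], of n] so_add[OF assms(2)] by (simp add: add.commute)

lemma hom_addI:
  assumes "\<And>x. x \<in> hom_set T X Y \<Longrightarrow> h x \<in> hom_set T X' Y'"
    "\<And>x y. x \<in> hom_set T X Y \<Longrightarrow> y \<in> hom_set T X Y \<Longrightarrow> h (Add T x y) = Add T (h x) (h y)"
  shows "h \<in> hom (Hom T X Y) (Hom T X' Y')"
proof (rule homI)
  fix x y assume "x \<in> hom_set T X Y" "y \<in> hom_set T X Y"
  then show "h (x \<otimes>\<^bsub>Hom T X Y\<^esub> y) = h x \<otimes>\<^bsub>Hom T X' Y'\<^esub> h y"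
    using assms(2) by (simp add: Hom_def)
qed (use assms(1) in blast)

lemma Hom_star_module:
  assumes X: "X \<in> Obj T" and A: "A \<in> Obj T"
  shows "graded_left_module R (Hom_star T \<phi> X A)"
proof (intro graded_left_module.intro graded_left_module_axioms.intro graded_commutative_ring_axioms,
    unfold Hom_star_simps, goal_cases)
  case (1 n) show ?case by (rule hom_group[OF X so_obj[OF A]])
next
  case (2 r d n)
  show ?case by (rule hom_addI) (use comp_hom comp_add_right sa_phi_hom[OF 2 A] in blast)+
next
  case (3 r d s x n)
  have "sa n (\<phi> d (r \<oplus>\<^bsub>R\<^esub> s) A) = Add T (sa n (\<phi> d r A)) (sa n (\<phi> d s A))"
    using phi_add_at[OF 3(1,2) A] sa_Add[OF phi_hom[OF 3(1) A] phi_hom[OF 3(2) A]] by simp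
  then show ?case using comp_add_left[OF 3(3) sa_phi_hom[OF 3(1) A] sa_phi_hom[OF 3(2) A]] by (simp add: Hom_def)
next
  case (4 r d s e x n)
  have "sa n (\<phi> (d + e) (r \<otimes>\<^bsub>R\<^esub> s) A) = sa n (sa e (\<phi> d r A)) \<bullet>\<^bsub>T\<^esub> sa n (\<phi> e s A)"
    unfolding phi_mult_at[OF 4(1,2) A refl]
    by (rule sa_comp[OF phi_hom[OF 4(2) A] sa_hom[OF phi_hom[OF 4(1) A]]])
  then show ?case
    using sa_add[OF hom_arr[OF phi_hom[OF 4(1) A]], of n e]
      comp_assoc[OF 4(3) sa_phi_hom[OF 4(2) A] sa_phi_hom[OF 4(1) A]] by (simp add: add.commute)
next
  case (5 x n)
  then show ?case using id_comp sa_Idt[OF A] phi_one_at[OF A] by simp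
qed

lemma functor_star_simps:
  "part (functor_star T \<phi> (representable T A) X) n = Hom T (so (- n) X) A"
  "act (functor_star T \<phi> (representable T A) X) d n r x = x \<bullet>\<^bsub>T\<^esub> \<phi> d r (so (- (d + n)) X)"
  by (simp_all add: functor_star_def representable_def)

lemma phi_so_hom:
  assumes "r \<in> grade R d" "X \<in> Obj T"
  shows "\<phi> d r (so (- (d + n)) X) \<in> hom_set T (so (- (d + n)) X) (so (- n) X)"
  using phi_hom[OF assms(1) so_obj[OF assms(2)], of "- (d + n)"] so_add[OF assms(2)] by simp

text \<open>Precomposition reverses the order of factors. Evaluating \<open>s\<close> at the shifted
  object \<open>so d Y\<close> contributes \<open>(-1)^(d e)\<close>, and this is the sign by which
  \<open>s r\<close> differs from \<open>r s\<close>, so a left action results.\<close>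

lemma functor_star_module:
  assumes X: "X \<in> Obj T" and A: "A \<in> Obj T"
  shows "graded_left_module R (functor_star T \<phi> (representable T A) X)"
proof (intro graded_left_module.intro graded_left_module_axioms.intro graded_commutative_ring_axioms,
    unfold functor_star_simps, goal_cases)
  case (1 n) show ?case by (rule hom_group[OF so_obj[OF X] A])
next
  case (2 r d n)
  show ?case by (rule hom_addI) (use comp_hom comp_add_left phi_so_hom[OF 2 X] in blast)+
next
  case (3 r d s x n)
  show ?case
    using comp_add_right[OF phi_so_hom[OF 3(1) X] phi_so_hom[OF 3(2) X] 3(3)]
      phi_add_at[OF 3(1,2) so_obj[OF X]] by (simp add: Hom_def)
next
  case (4 r d s e x n)
  define Y where "Y = so (- (d + e + n)) X"
  have Y: "Y \<in> Obj T" and sY: "so (- (e + n)) X = so d Y" "so (- (d + (e + n))) X = Y"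
    unfolding Y_def using X so_add[OF X] by (auto simp: algebra_simps)
  have hs: "\<phi> e s (so d Y) \<in> hom_set T (so d Y) (so (- n) X)" using phi_so_hom[OF 4(2) X, of n] sY by simp
  have hr: "\<phi> d r Y \<in> hom_set T Y (so d Y)" by (rule phi_hom[OF 4(1) Y])
  have hs': "sa d (\<phi> e s Y) \<in> hom_set T (so d Y) (so (- n) X)"
    using sa_hom[OF phi_hom[OF 4(2) Y], of d] so_add[OF X] Y so_add[OF Y] unfolding Y_def by (simp add: algebra_simps)
  have "\<phi> e s (so d Y) \<bullet>\<^bsub>T\<^esub> \<phi> d r Y = signed (d * e) (sa d (\<phi> e s Y) \<bullet>\<^bsub>T\<^esub> \<phi> d r Y)"
    unfolding phi_shift[OF 4(2) Y] by (rule signed_comp_left[OF hr hs'])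
  also have "\<dots> = signed (d * e) (\<phi> (e + d) (s \<otimes>\<^bsub>R\<^esub> r) Y)"
    using phi_mult_at[OF 4(2,1) Y refl] by simp
  also have "\<dots> = \<phi> (d + e) (r \<otimes>\<^bsub>R\<^esub> s) Y"
    using phi_commute[OF 4(1,2) Y] by (simp add: add.commute)
  finally show ?case
    using comp_assoc[OF hr hs 4(3)] unfolding sY Y_def[symmetric] by simp
next
  case (5 x n)
  then show ?case using comp_id phi_one_at[OF so_obj[OF X]] by simp
qed

end

section \<open>Koszul objects\<close>

context triangulated_category
begin

lemma triE:
  assumes "(f, g, h) \<in> Tri T"
  obtains X Y Z where "f \<in> hom_set T X Y" "g \<in> hom_set T Y Z" "h \<in> hom_set T Z (SigO T X)"
  using tri_arr[OF assms] by blast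

lemma representable_exact:
  assumes t: "(f, g, h) \<in> Tri T" and f: "f \<in> hom_set T X Y" and g: "g \<in> hom_set T Y Z" and B: "B \<in> Obj T"
  shows "{b \<in> hom_set T Y B. b \<bullet> f = Zer T X B} = (\<lambda>c. c \<bullet> g) ` hom_set T Z B"
proof -
  interpret F: cohomological_functor T "representable T B" by (rule cohomological_representable[OF B])
  have "Dom T f = X" "Cod T f = Y" "Cod T g = Z" using f g by (auto simp: Hom_carrier)
  then show ?thesis using F.exact[OF t] by (simp add: representable_def kernel_def one_Hom)
qed

text \<open>In a triangle \<open>g\<close> is a weak cokernel of \<open>f\<close>.\<close>

lemma tri_factor:
  assumes "(f, g, h) \<in> Tri T" "f \<in> hom_set T X Y" "g \<in> hom_set T Y Z" "b \<in> hom_set T Y B" "b \<bullet> f = Zer T X B"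
  obtains c where "c \<in> hom_set T Z B" "b = c \<bullet> g"
proof -
  have "b \<in> {b \<in> hom_set T Y B. b \<bullet> f = Zer T X B}" using assms(4,5) by simp
  then show ?thesis using representable_exact[OF assms(1-3), of B] hom_obj[OF assms(4)] that by auto
qed

text \<open>Exactness for the functor represented by \<open>Z\<close>, applied to the identity of
  \<open>Z\<close>.\<close>

lemma tri_zero:
  assumes "(f, g, h) \<in> Tri T" "f \<in> hom_set T X Y" "g \<in> hom_set T Y Z"
  shows "g \<bullet> f = Zer T X Z"
proof -
  have Z: "Z \<in> Obj T" using hom_obj[OF assms(3)] by simp
  have "Idt T Z \<bullet> g \<in> (\<lambda>c. c \<bullet> g) ` hom_set T Z Z" using id_hom[OF Z] by blast
  then show ?thesis using representable_exact[OF assms Z] id_comp[OF assms(3)] by auto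
qed

lemma rotate:
  assumes "(f, g, h) \<in> Tri T" "f \<in> hom_set T X Y" "g \<in> hom_set T Y Z" "h \<in> hom_set T Z (SigO T X)"
  shows "(g, h, Neg T (SigA T f)) \<in> Tri T" "Neg T (SigA T f) \<in> hom_set T (SigO T X) (SigO T Y)"
    "\<exists>k. (h, Neg T (SigA T f), k) \<in> Tri T"
proof -
  show 1: "(g, h, Neg T (SigA T f)) \<in> Tri T" using TR2 assms by blast
  show 2: "Neg T (SigA T f) \<in> hom_set T (SigO T X) (SigO T Y)" by (rule Neg_hom[OF susp_hom[OF assms(2)]])
  show "\<exists>k. (h, Neg T (SigA T f), k) \<in> Tri T" using TR2[OF assms(3,4) 2] 1 by blast
qed

end

section \<open>Annihilated objects and cones of ring elements\<close>

context linear_triangulated_category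
begin

text \<open>For \<open>q\<close> in \<open>Spec R\<close> and an object \<open>X\<close> this is
  equivalent to the vanishing of \<open>End*(X)\<close> at \<open>q\<close>, but it speaks of a
  single natural map and so can be followed through triangles.\<close>

definition killed :: "'r set \<Rightarrow> 'o \<Rightarrow> bool" where
  "killed q X \<longleftrightarrow> (\<exists>e t. t \<in> grade R e \<and> t \<notin> q \<and> \<phi> e t X = Zer T X (so e X))"

lemma phi_vanish_shift:
  assumes s: "s \<in> grade R e" and X: "X \<in> Obj T" and z: "\<phi> e s X = Zer T X (so e X)"
  shows "\<phi> e s (so m X) = Zer T (so m X) (so e (so m X))"
  unfolding phi_shift[OF s X] z using sa_Zer[OF X so_obj[OF X]] signed_Zer so_add[OF X] X by (simp add: add.commute)

text \<open>Since \<open>s\<close> on \<open>Y\<close> vanishes on \<open>g\<close>, it factors as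
  \<open>w h\<close>. Naturality moves a second factor \<open>s\<close> past \<open>w\<close>, where
  it meets \<open>h\<close> and vanishes; this is the origin of the square.\<close>

lemma phi_square_vanishes_on_cone:
  assumes t: "(f, g, h) \<in> Tri T" and f: "f \<in> hom_set T X X'" and g: "g \<in> hom_set T X' Y"
    and h: "h \<in> hom_set T Y (SigO T X)" and s: "s \<in> grade R e"
    and zg: "\<phi> e s Y \<bullet>\<^bsub>T\<^esub> g = Zer T X' (so e Y)"
    and zh: "\<phi> e s (SigO T X) \<bullet>\<^bsub>T\<^esub> h = Zer T Y (so e (SigO T X))"
  shows "\<phi> (e + e) (s \<otimes>\<^bsub>R\<^esub> s) Y = Zer T Y (so (e + e) Y)"
proof -
  have Y: "Y \<in> Obj T" and X: "X \<in> Obj T" using hom_obj[OF g] hom_obj[OF f] by auto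
  obtain w where w: "w \<in> hom_set T (SigO T X) (so e Y)" "\<phi> e s Y = w \<bullet>\<^bsub>T\<^esub> h"
    by (rule tri_factor[OF rotate(1)[OF t f g h] g h phi_hom[OF s Y] zg])
  have p: "sa e (\<phi> e s Y) \<in> hom_set T (so e Y) (so (e + e) Y)" by (rule sa_phi_hom[OF s Y])
  have P: "\<phi> e s (so e Y) = signed (e * e) (sa e (\<phi> e s Y))" by (rule phi_shift[OF s Y])
  have Pp: "sa e (\<phi> e s Y) = signed (e * e) (\<phi> e s (so e Y))"
    unfolding P using signed_signed[OF p, of "e * e" "e * e"] by (simp add: signed_even)
  have Ph: "\<phi> e s (so e Y) \<in> hom_set T (so e Y) (so (e + e) Y)"
    using phi_hom[OF s so_obj[OF Y], of e] so_add[OF Y, of e e] by simp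
  have w': "sa e w \<in> hom_set T (so e (SigO T X)) (so (e + e) Y)"
    using sa_hom[OF w(1), of e] so_add[OF Y, of e e] by simp
  have "\<phi> e s (so e Y) \<bullet>\<^bsub>T\<^esub> (w \<bullet>\<^bsub>T\<^esub> h) = (sa e w \<bullet>\<^bsub>T\<^esub> \<phi> e s (SigO T X)) \<bullet>\<^bsub>T\<^esub> h"
    using comp_assoc[OF h w(1) Ph] phi_natural[OF s w(1)] by simp
  also have "\<dots> = sa e w \<bullet>\<^bsub>T\<^esub> Zer T Y (so e (SigO T X))"
    using comp_assoc[OF h phi_hom[OF s SigO_obj[OF X]] w'] zh by simp
  also have "\<dots> = Zer T Y (so (e + e) Y)" by (rule comp_zero_right[OF Y w'])
  finally have z: "\<phi> e s (so e Y) \<bullet>\<^bsub>T\<^esub> \<phi> e s Y = Zer T Y (so (e + e) Y)" using w(2) by simp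
  have "\<phi> (e + e) (s \<otimes>\<^bsub>R\<^esub> s) Y = signed (e * e) (\<phi> e s (so e Y)) \<bullet>\<^bsub>T\<^esub> \<phi> e s Y"
    unfolding phi_mult_at[OF s s Y refl] Pp[symmetric] ..
  also have "\<dots> = signed (e * e) (\<phi> e s (so e Y) \<bullet>\<^bsub>T\<^esub> \<phi> e s Y)"
    by (rule signed_comp_left[OF phi_hom[OF s Y] Ph])
  finally show ?thesis unfolding z using signed_Zer Y by simp
qed

text \<open>\<open>Y\<close> is the Koszul object \<open>X//r\<close>.\<close>

context
  fixes X Y :: 'o and d :: int and r :: 'r and g h :: 'a
  assumes r: "r \<in> grade R d" and X: "X \<in> Obj T" and tri: "(\<phi> d r X, g, h) \<in> Tri T"
    and g: "g \<in> hom_set T (so d X) Y" and h: "h \<in> hom_set T Y (SigO T X)"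
begin

lemma cone_obj: "Y \<in> Obj T"
  using hom_obj[OF g] by simp

lemma cone_fh: "SigA T (\<phi> d r X) \<bullet>\<^bsub>T\<^esub> h = Zer T Y (SigO T (so d X))"
proof -
  obtain k where "(h, Neg T (SigA T (\<phi> d r X)), k) \<in> Tri T"
    using rotate(3)[OF tri phi_hom[OF r X] g h] by blast
  then have "Neg T (SigA T (\<phi> d r X)) \<bullet>\<^bsub>T\<^esub> h = Zer T Y (SigO T (so d X))"
    by (rule tri_zero[OF _ h rotate(2)[OF tri phi_hom[OF r X] g h]])
  then have "Neg T (SigA T (\<phi> d r X) \<bullet>\<^bsub>T\<^esub> h) = Zer T Y (SigO T (so d X))"
    using comp_Neg_left[OF h susp_hom[OF phi_hom[OF r X]]] by simp
  then show ?thesis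
    using signed_eq_Zer[OF comp_hom[OF h susp_hom[OF phi_hom[OF r X]]], of 1] by (simp add: signed_def)
qed

text \<open>Both cases exhibit an element that vanishes against \<open>g\<close> and
  \<open>h\<close>. For \<open>r\<close> outside \<open>q\<close> it is \<open>r\<close> itself,
  because consecutive maps of the triangle compose to zero; otherwise it is an element killing
  \<open>X\<close>, which also kills the shifts of \<open>X\<close> at the two ends of
  \<open>Y\<close>.\<close>

lemma killed_cone:
  assumes q: "q \<in> Spec R" and k: "killed q X \<or> r \<notin> q"
  shows "killed q Y"
proof -
  interpret graded_prime R q by unfold_locales (rule q)
  have Y: "Y \<in> Obj T" by (rule cone_obj)
  note f = phi_hom[OF r X]
  have "\<exists>e s. s \<in> grade R e \<and> s \<notin> q \<and> \<phi> e s Y \<bullet>\<^bsub>T\<^esub> g = Zer T (so d X) (so e Y) \<and>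
      \<phi> e s (SigO T X) \<bullet>\<^bsub>T\<^esub> h = Zer T Y (so e (SigO T X))"
  proof (cases "r \<notin> q")
    case True
    have "\<phi> d r Y \<bullet>\<^bsub>T\<^esub> g = sa d g \<bullet>\<^bsub>T\<^esub> \<phi> d r (so d X)" by (rule phi_natural[OF r g, symmetric])
    also have "\<dots> = signed (d * d) (sa d g \<bullet>\<^bsub>T\<^esub> sa d (\<phi> d r X))"
      unfolding phi_shift[OF r X] by (rule signed_comp_right[OF sa_hom[OF f] sa_hom[OF g]])
    also have "\<dots> = signed (d * d) (sa d (g \<bullet>\<^bsub>T\<^esub> \<phi> d r X))" using sa_comp[OF f g] by simp
    also have "\<dots> = signed (d * d) (Zer T (so d X) (so d Y))"
      unfolding tri_zero[OF tri f g] using sa_Zer[OF X Y] by simp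
    finally have 1: "\<phi> d r Y \<bullet>\<^bsub>T\<^esub> g = Zer T (so d X) (so d Y)" using signed_Zer X Y by simp
    have sf: "SigA T (\<phi> d r X) \<in> hom_set T (SigO T X) (so d (SigO T X))"
      using susp_hom[OF f] SigO_eq X so_add[OF X] by (simp add: add.commute)
    have "\<phi> d r (SigO T X) = signed d (SigA T (\<phi> d r X))"
      using phi_shift[OF r X, of 1] SigO_eq[OF X] SigA_eq[OF hom_arr[OF f]] by simp
    then have "\<phi> d r (SigO T X) \<bullet>\<^bsub>T\<^esub> h = signed d (SigA T (\<phi> d r X) \<bullet>\<^bsub>T\<^esub> h)"
      using signed_comp_left[OF h sf] by simp
    also have "\<dots> = Zer T Y (SigO T (so d X))" unfolding cone_fh using signed_Zer Y SigO_obj X by simp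
    also have "SigO T (so d X) = so d (SigO T X)" using SigO_eq X so_add[OF X] by (simp add: add.commute)
    finally show ?thesis using 1 r True by blast
  next
    case False
    then obtain e s where s: "s \<in> grade R e" "s \<notin> q" "\<phi> e s X = Zer T X (so e X)"
      using k unfolding killed_def by blast
    have "\<phi> e s Y \<bullet>\<^bsub>T\<^esub> g = sa e g \<bullet>\<^bsub>T\<^esub> \<phi> e s (so d X)" by (rule phi_natural[OF s(1) g, symmetric])
    also have "\<dots> = Zer T (so d X) (so e Y)"
      unfolding phi_vanish_shift[OF s(1) X s(3)] by (rule comp_zero_right[OF so_obj[OF X] sa_hom[OF g]])
    finally have 1: "\<phi> e s Y \<bullet>\<^bsub>T\<^esub> g = Zer T (so d X) (so e Y)" .
    have "\<phi> e s (SigO T X) = Zer T (SigO T X) (so e (SigO T X))"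
      using phi_vanish_shift[OF s(1) X s(3), of 1] SigO_eq[OF X] by simp
    then have "\<phi> e s (SigO T X) \<bullet>\<^bsub>T\<^esub> h = Zer T Y (so e (SigO T X))"
      using comp_zero_left[OF _ h] SigO_obj X by simp
    then show ?thesis using 1 s(1,2) by blast
  qed
  then obtain e s where s: "s \<in> grade R e" "s \<notin> q" "\<phi> e s Y \<bullet>\<^bsub>T\<^esub> g = Zer T (so d X) (so e Y)"
      "\<phi> e s (SigO T X) \<bullet>\<^bsub>T\<^esub> h = Zer T Y (so e (SigO T X))" by blast
  have "\<phi> (e + e) (s \<otimes>\<^bsub>R\<^esub> s) Y = Zer T Y (so (e + e) Y)"
    by (rule phi_square_vanishes_on_cone[OF tri f g h s(1,3,4)])
  then show ?thesis
    unfolding killed_def using grade_mult[OF s(1,1)] mult_notin[OF s(1,1,2,2)] by blast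
qed

text \<open>\<open>Hom(-, A)\<close> is applied to the rotated triangle with terms
  \<open>so d X\<close>, \<open>Y\<close> and \<open>SigO T X\<close>. Its outer terms are
  \<open>Hom*(X, A)\<close> shifted by \<open>- d\<close> and by \<open>- 1\<close>. The
  identifications are plain suspensions: \<open>R\<close> acts by composing with maps of
  \<open>A\<close> on the left, so they commute with the action without signs.\<close>

lemma gnoetherian_cone:
  assumes A: "A \<in> Obj T" and noeth: "gnoetherian R (Hom_star T \<phi> X A)"
  shows "gnoetherian R (Hom_star T \<phi> Y A)"
proof -
  have Y: "Y \<in> Obj T" by (rule cone_obj)
  note f = phi_hom[OF r X]
  have up: "sa 1 x \<in> hom_set T (SigO T X) (so n A)" if "x \<in> hom_set T X (so (n + - 1) A)" for x n
    using sa_hom[OF that, of 1] SigO_eq[OF X] so_add[OF A] by simp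
  have down: "sa (- d) y \<in> hom_set T X (so (n + - d) A)" if "y \<in> hom_set T (so d X) (so n A)" for y n
    using sa_hom[OF that, of "- d"] so_add X A by (simp add: add.commute)
  show ?thesis
  proof (rule gnoetherian_extension[OF Hom_star_module[OF Y A] Hom_star_module[OF X A] Hom_star_module[OF X A]
        noeth noeth, where a = "- 1" and b = "- d" and u = "\<lambda>n x. sa 1 x \<bullet>\<^bsub>T\<^esub> h"
        and v = "\<lambda>n y. sa (- d) (y \<bullet>\<^bsub>T\<^esub> g)"], unfold Hom_star_simps, goal_cases)
    case (1 n)
    show ?case
    proof (rule hom_addI)
      fix x y assume xy: "x \<in> hom_set T X (so (n + - 1) A)" "y \<in> hom_set T X (so (n + - 1) A)"
      show "sa 1 x \<bullet>\<^bsub>T\<^esub> h \<in> hom_set T Y (so n A)" by (rule comp_hom[OF h up[OF xy(1)]])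
      show "sa 1 (Add T x y) \<bullet>\<^bsub>T\<^esub> h = Add T (sa 1 x \<bullet>\<^bsub>T\<^esub> h) (sa 1 y \<bullet>\<^bsub>T\<^esub> h)"
        unfolding sa_Add[OF xy] by (rule comp_add_left[OF h up[OF xy(1)] up[OF xy(2)]])
    qed
  next
    case (2 e n s x)
    have ph: "sa (n + - 1) (\<phi> e s A) \<in> hom_set T (so (n + - 1) A) (so (e + (n + - 1)) A)" by (rule sa_phi_hom[OF 2(1) A])
    have "sa 1 (sa (n + - 1) (\<phi> e s A) \<bullet>\<^bsub>T\<^esub> x) = sa n (\<phi> e s A) \<bullet>\<^bsub>T\<^esub> sa 1 x"
      using sa_comp[OF 2(2) ph, of 1] sa_add[OF hom_arr[OF phi_hom[OF 2(1) A]]] by simp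
    then show ?case using comp_assoc[OF h up[OF 2(2)] sa_phi_hom[OF 2(1) A]] by simp
  next
    case (3 n)
    show ?case
    proof (rule hom_addI)
      fix x y assume xy: "x \<in> hom_set T Y (so n A)" "y \<in> hom_set T Y (so n A)"
      show "sa (- d) (x \<bullet>\<^bsub>T\<^esub> g) \<in> hom_set T X (so (n + - d) A)" by (rule down[OF comp_hom[OF g xy(1)]])
      show "sa (- d) (Add T x y \<bullet>\<^bsub>T\<^esub> g) = Add T (sa (- d) (x \<bullet>\<^bsub>T\<^esub> g)) (sa (- d) (y \<bullet>\<^bsub>T\<^esub> g))"
        unfolding comp_add_left[OF g xy] by (rule sa_Add[OF comp_hom[OF g xy(1)] comp_hom[OF g xy(2)]])
    qed
  next
    case (4 e n s y)
    have "(sa n (\<phi> e s A) \<bullet>\<^bsub>T\<^esub> y) \<bullet>\<^bsub>T\<^esub> g = sa n (\<phi> e s A) \<bullet>\<^bsub>T\<^esub> (y \<bullet>\<^bsub>T\<^esub> g)"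
      by (rule comp_assoc[OF g 4(2) sa_phi_hom[OF 4(1) A], symmetric])
    then show ?case
      using sa_comp[OF comp_hom[OF g 4(2)] sa_phi_hom[OF 4(1) A], of "- d"]
        sa_add[OF hom_arr[OF phi_hom[OF 4(1) A]], of "- d" n] by (simp add: add.commute)
  next
    case (5 n)
    have "y \<in> kernel (Hom T Y (so n A)) (Hom T X (so (n + - d) A)) (\<lambda>y. sa (- d) (y \<bullet>\<^bsub>T\<^esub> g))
      \<longleftrightarrow> y \<in> hom_set T Y (so n A) \<and> y \<bullet>\<^bsub>T\<^esub> g = Zer T (so d X) (so n A)" for y
    proof -
      have z: "sa (- d) (Zer T (so d X) (so n A)) = Zer T X (so (n + - d) A)"
        using sa_Zer[of "so d X" "so n A" "- d"] so_add X A by (simp add: add.commute)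
      show ?thesis unfolding kernel_def one_Hom
        using z sa_inj[OF comp_hom[OF g], of y "so n A" "Zer T (so d X) (so n A)" _ _ "- d"] zero_hom X A
        by (metis (mono_tags, lifting) mem_Collect_eq so_obj)
    qed
    then have "kernel (Hom T Y (so n A)) (Hom T X (so (n + - d) A)) (\<lambda>y. sa (- d) (y \<bullet>\<^bsub>T\<^esub> g))
       = {y \<in> hom_set T Y (so n A). y \<bullet>\<^bsub>T\<^esub> g = Zer T (so d X) (so n A)}" by blast
    also have "\<dots> = (\<lambda>c. c \<bullet>\<^bsub>T\<^esub> h) ` hom_set T (SigO T X) (so n A)"
      by (rule representable_exact[OF rotate(1)[OF tri f g h] g h so_obj[OF A]])
    also have "hom_set T (SigO T X) (so n A) = sa 1 ` hom_set T X (so (n + - 1) A)"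
    proof (intro subset_antisym subsetI)
      fix c assume c: "c \<in> hom_set T (SigO T X) (so n A)"
      have "sa (- 1) c \<in> hom_set T X (so (n + - 1) A)"
        using sa_hom[OF c, of "- 1"] SigO_eq[OF X] so_add X A by (simp add: add.commute)
      moreover have "c = sa 1 (sa (- 1) c)" using sa_inverse(2)[OF c, of 1] by simp
      ultimately show "c \<in> sa 1 ` hom_set T X (so (n + - 1) A)" by blast
    qed (use up in blast)
    finally show ?case by (simp add: image_image)
  qed
qed

text \<open>Applied contrapositively, to keep \<open>Hom*(Y, A)\<close> nonzero at \<open>p\<close>.
  If every element of \<open>Hom*(Y, A)\<close> is torsion, then for each \<open>x\<close> some
  multiple \<open>s x\<close> has a suspension vanishing on \<open>h\<close>; by exactness
  \<open>s x\<close> is then a multiple of \<open>r\<close>, which is the divisibility that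
  \<open>nakayama\<close> asks for.\<close>

lemma torsion_cone:
  assumes A: "A \<in> Obj T" and noeth: "gnoetherian R (Hom_star T \<phi> X A)"
    and p: "p \<in> Spec R" "r \<in> p"
    and tor: "\<And>k y. y \<in> hom_set T Y (so k A) \<Longrightarrow> torsion R p (Hom_star T \<phi> Y A) k y"
    and x: "x \<in> hom_set T X (so k A)"
  shows "torsion R p (Hom_star T \<phi> X A) k x"
proof -
  have Y: "Y \<in> Obj T" by (rule cone_obj)
  note f = phi_hom[OF r X]
  interpret graded_left_module R "Hom_star T \<phi> X A" by (rule Hom_star_module[OF X A])
  interpret module_at_prime R "Hom_star T \<phi> X A" p by unfold_locales (rule p(1))
  show ?thesis
  proof (rule nakayama[OF noeth r p(2)], unfold Hom_star_simps)
    show "x \<in> hom_set T X (so k A)" by (rule x)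
  next
    fix k x assume x: "x \<in> hom_set T X (so k A)"
    have sx: "sa 1 x \<in> hom_set T (SigO T X) (so (k + 1) A)"
      using sa_hom[OF x, of 1] SigO_eq[OF X] so_add[OF A] by (simp add: add.commute)
    obtain e s where s: "s \<in> grade R e" "s \<notin> p" and
      z: "sa (k + 1) (\<phi> e s A) \<bullet>\<^bsub>T\<^esub> (sa 1 x \<bullet>\<^bsub>T\<^esub> h) = Zer T Y (so (e + (k + 1)) A)"
      using tor[OF comp_hom[OF h sx]] unfolding torsion_def Hom_star_simps one_Hom by blast
    define y where "y = sa k (\<phi> e s A) \<bullet>\<^bsub>T\<^esub> x"
    have y: "y \<in> hom_set T X (so (e + k) A)" unfolding y_def by (rule comp_hom[OF x sa_phi_hom[OF s(1) A]])
    have sy: "sa 1 y \<in> hom_set T (SigO T X) (so (e + k + 1) A)"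
      using sa_hom[OF y, of 1] SigO_eq[OF X] so_add[OF A] by (simp add: add.commute add.left_commute)
    have "sa 1 y = sa (k + 1) (\<phi> e s A) \<bullet>\<^bsub>T\<^esub> sa 1 x"
      unfolding y_def using sa_comp[OF x sa_phi_hom[OF s(1) A], of 1]
        sa_add[OF hom_arr[OF phi_hom[OF s(1) A]], of 1 k] by (simp add: add.commute)
    then have yh: "sa 1 y \<bullet>\<^bsub>T\<^esub> h = Zer T Y (so (e + k + 1) A)"
      using comp_assoc[OF h sx sa_phi_hom[OF s(1) A]] z by (simp add: add.assoc)
    obtain kk where "(h, Neg T (SigA T (\<phi> d r X)), kk) \<in> Tri T"
      using rotate(3)[OF tri f g h] by blast
    then obtain c where c: "c \<in> hom_set T (SigO T (so d X)) (so (e + k + 1) A)" "sa 1 y = c \<bullet>\<^bsub>T\<^esub> Neg T (SigA T (\<phi> d r X))"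
      by (rule tri_factor[OF _ h rotate(2)[OF tri f g h] sy yh])
    \<comment> \<open>The rotated triangle carries a minus sign on the suspension of
      \<open>r\<close>; it is moved to the other factor before desuspending.\<close>
    define w' where "w' = Neg T (sa (- 1) c)"
    have c': "sa (- 1) c \<in> hom_set T (so d X) (so (e + k) A)"
      using sa_hom[OF c(1), of "- 1"] SigO_eq[of "so d X"] so_add X A by (simp add: add.commute)
    have w': "w' \<in> hom_set T (so d X) (so (e + k) A)" unfolding w'_def by (rule Neg_hom[OF c'])
    have "sa 1 (w' \<bullet>\<^bsub>T\<^esub> \<phi> d r X) = Neg T c \<bullet>\<^bsub>T\<^esub> SigA T (\<phi> d r X)"
      using sa_comp[OF f w', of 1] sa_Neg[OF c', of 1] sa_inverse(2)[OF c(1), of 1] SigA_eq[OF hom_arr[OF f]]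
      by (simp add: w'_def)
    also have "\<dots> = sa 1 y"
      unfolding c(2) using comp_Neg_left[OF susp_hom[OF f] c(1)] comp_Neg_right[OF susp_hom[OF f] c(1)] by simp
    finally have yw: "y = w' \<bullet>\<^bsub>T\<^esub> \<phi> d r X" using sa_inj[OF comp_hom[OF f w'] y] by metis
    define w where "w = sa (- d) w'"
    have w: "w \<in> hom_set T X (so (e + k - d) A)" "sa d w = w'"
      unfolding w_def using sa_hom[OF w', of "- d"] so_add X A sa_inverse(2)[OF w', of d] by (auto simp: algebra_simps)
    \<comment> \<open>So far \<open>r\<close> acts on the source \<open>X\<close>. Naturality moves
      it to a shift of \<open>A\<close>, and the sign from \<open>phi_shift\<close> is absorbed into
      the witness.\<close>
    have "y = \<phi> d r (so (e + k - d) A) \<bullet>\<^bsub>T\<^esub> w" using yw phi_natural[OF r w(1)] w(2) by simp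
    also have "\<dots> = signed ((e + k - d) * d) (sa (e + k - d) (\<phi> d r A)) \<bullet>\<^bsub>T\<^esub> w" unfolding phi_shift[OF r A] ..
    also have "\<dots> = sa (e + k - d) (\<phi> d r A) \<bullet>\<^bsub>T\<^esub> signed ((e + k - d) * d) w"
      using signed_comp_left[OF w(1) sa_phi_hom[OF r A]] signed_comp_right[OF w(1) sa_phi_hom[OF r A]] by simp
    finally show "\<exists>e s w. s \<in> grade R e \<and> s \<notin> p \<and> w \<in> hom_set T X (so (e + k - d) A) \<and>
        sa k (\<phi> e s A) \<bullet>\<^bsub>T\<^esub> x = sa (e + k - d) (\<phi> d r A) \<bullet>\<^bsub>T\<^esub> w"
      using s signed_hom[OF w(1)] unfolding y_def by blast
  qed
qed

end

text \<open>The induction carries the noetherian property because each new cone needs Nakayama's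
  lemma for its predecessor. Annihilation achieved by earlier generators persists in later cones by
  \<open>killed_cone\<close>.\<close>

lemma koszul_object:
  assumes A: "A \<in> Obj T" and p: "p \<in> Spec R" and fin: "finite H"
    and H: "\<And>d r. (d, r) \<in> H \<Longrightarrow> r \<in> grade R d \<and> r \<in> p"
    and noeth: "gnoetherian R (Hom_star T \<phi> A A)"
    and nt: "x \<in> hom_set T A (so k A)" "\<not> torsion R p (Hom_star T \<phi> A A) k x"
  shows "\<exists>X\<in>Obj T. gnoetherian R (Hom_star T \<phi> X A) \<and>
     (\<exists>k. \<exists>x\<in>hom_set T X (so k A). \<not> torsion R p (Hom_star T \<phi> X A) k x) \<and>
     (\<forall>(d, r)\<in>H. \<forall>q\<in>Spec R. r \<notin> q \<longrightarrow> killed q X)"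
  using fin H
proof (induction H rule: finite_induct)
  case empty
  then show ?case using A noeth nt by blast
next
  case (insert z H)
  obtain d r where z: "z = (d, r)" by fastforce
  have r: "r \<in> grade R d" "r \<in> p" using insert.prems z by blast+
  obtain X k x where X: "X \<in> Obj T" "gnoetherian R (Hom_star T \<phi> X A)" and
    x: "x \<in> hom_set T X (so k A)" "\<not> torsion R p (Hom_star T \<phi> X A) k x" and
    kX: "\<forall>(d, r)\<in>H. \<forall>q\<in>Spec R. r \<notin> q \<longrightarrow> killed q X"
    using insert.IH insert.prems by blast
  obtain g h where tri: "(\<phi> d r X, g, h) \<in> Tri T" using TR1_cone[OF hom_arr[OF phi_hom[OF r(1) X(1)]]] by blast
  obtain X' X'' Y where *: "\<phi> d r X \<in> hom_set T X' X''" "g \<in> hom_set T X'' Y" "h \<in> hom_set T Y (SigO T X')"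
    by (rule triE[OF tri])
  moreover have "X' = X" "X'' = so d X" using *(1) phi_hom[OF r(1) X(1)] by (auto simp: Hom_carrier)
  ultimately have gh: "g \<in> hom_set T (so d X) Y" "h \<in> hom_set T Y (SigO T X)" by auto
  note cone = r(1) X(1) tri gh
  have "\<forall>(d, r)\<in>insert z H. \<forall>q\<in>Spec R. r \<notin> q \<longrightarrow> killed q Y"
    using killed_cone[OF cone] kX z by blast
  moreover have "\<exists>k. \<exists>x\<in>hom_set T Y (so k A). \<not> torsion R p (Hom_star T \<phi> Y A) k x"
    using torsion_cone[OF cone A X(2) p r(2) _ x(1)] x(2) by blast
  ultimately show ?case using cone_obj[OF cone] gnoetherian_cone[OF cone A X(2)] by blast
qed

lemma killed_imp_localization_zero:
  assumes q: "q \<in> Spec R" and X: "X \<in> Obj T" and k: "killed q X"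
  shows "localization_zero R q (End_star T \<phi> X)"
proof -
  interpret graded_left_module R "Hom_star T \<phi> X X" by (rule Hom_star_module[OF X X])
  interpret module_at_prime R "Hom_star T \<phi> X X" q by unfold_locales (rule q)
  obtain e s where s: "s \<in> grade R e" "s \<notin> q" "\<phi> e s X = Zer T X (so e X)" using k unfolding killed_def by blast
  have "torsion R q (Hom_star T \<phi> X X) n x" if x: "x \<in> hom_set T X (so n X)" for n x
  proof -
    have "sa n (Zer T X (so e X)) = Zer T (so n X) (so (e + n) X)"
      using sa_Zer[OF X so_obj[OF X]] so_add[OF X] by (simp add: add.commute)
    then have "sa n (\<phi> e s X) \<bullet>\<^bsub>T\<^esub> x = Zer T X (so (e + n) X)"
      using s(3) comp_zero_left[OF so_obj[OF X] x] by simp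
    then show ?thesis unfolding torsion_def Hom_star_simps one_Hom using s by blast
  qed
  then show ?thesis unfolding End_star_def localization_zero_iff Hom_star_simps by blast
qed

text \<open>The identity of \<open>X\<close> is torsion, and a denominator annihilating the identity
  acts as zero on \<open>X\<close>.\<close>

lemma localization_zero_imp_killed:
  assumes q: "q \<in> Spec R" and X: "X \<in> Obj T" and z: "localization_zero R q (End_star T \<phi> X)"
  shows "killed q X"
proof -
  interpret graded_left_module R "Hom_star T \<phi> X X" by (rule Hom_star_module[OF X X])
  interpret module_at_prime R "Hom_star T \<phi> X X" q by unfold_locales (rule q)
  have i: "Idt T X \<in> hom_set T X (so 0 X)" using id_hom[OF X] by simp
  have "torsion R q (Hom_star T \<phi> X X) 0 (Idt T X)"
    using z i unfolding End_star_def localization_zero_iff Hom_star_simps by blast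
  then obtain e s where "s \<in> grade R e" "s \<notin> q" "\<phi> e s X \<bullet>\<^bsub>T\<^esub> Idt T X = Zer T X (so e X)"
    unfolding torsion_def Hom_star_simps one_Hom by auto
  then show ?thesis unfolding killed_def using comp_id[OF phi_hom[OF _ X]] by metis
qed

lemma killed_shift:
  assumes "X \<in> Obj T" "killed q X"
  shows "killed q (so m X)"
  using assms phi_vanish_shift unfolding killed_def by blast

text \<open>By naturality the action on the source of \<open>x\<close> becomes an action on a shift
  of the target \<open>A\<close>, where the element is zero.\<close>

lemma killed_imp_torsion:
  assumes A: "A \<in> Obj T" and X: "X \<in> Obj T" and k: "killed p A" and x: "x \<in> hom_set T (so (- n) X) A"
  shows "torsion R p (functor_star T \<phi> (representable T A) X) n x"
proof -
  obtain e s where s: "s \<in> grade R e" "s \<notin> p" "\<phi> e s A = Zer T A (so e A)" using k unfolding killed_def by blast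
  let ?Y = "so (- (e + n)) X"
  have Y: "?Y \<in> Obj T" using X by simp
  define y where "y = sa (- e) x"
  have y: "y \<in> hom_set T ?Y (so (- e) A)" "sa e y = x"
    unfolding y_def using sa_hom[OF x, of "- e"] so_add[OF X] sa_inverse(2)[OF x, of e] by auto
  have "x \<bullet>\<^bsub>T\<^esub> \<phi> e s ?Y = \<phi> e s (so (- e) A) \<bullet>\<^bsub>T\<^esub> y" using phi_natural[OF s(1) y(1)] y(2) by simp
  also have "\<dots> = Zer T ?Y A"
    unfolding phi_vanish_shift[OF s(1) A s(3)] using comp_zero_left[OF _ y(1)] so_add[OF A] A by simp
  finally show ?thesis unfolding torsion_def functor_star_simps one_Hom using s(1,2) by blast
qed

text \<open>The two graded modules are isomorphic up to signs, which do not affect vanishing. It is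
  enough to transport the equation, with the same denominator \<open>s\<close>, instead of the
  isomorphism.\<close>

lemma torsion_functor_star_imp_torsion_Hom_star:
  assumes A: "A \<in> Obj T" and X: "X \<in> Obj T" and x: "x \<in> hom_set T X (so k A)"
    and tor: "torsion R p (functor_star T \<phi> (representable T A) (so (- k) X)) 0 (sa (- k) x)"
  shows "torsion R p (Hom_star T \<phi> X A) k x"
proof -
  let ?Z = "so (- k) X" and ?y = "sa (- k) x"
  have Z: "?Z \<in> Obj T" using X by simp
  have y: "?y \<in> hom_set T ?Z A" using sa_hom[OF x, of "- k"] so_add[OF A] by simp
  obtain e s where s: "s \<in> grade R e" "s \<notin> p" and
    z: "?y \<bullet>\<^bsub>T\<^esub> \<phi> e s (so (- e) ?Z) = Zer T (so (- e) ?Z) A"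
    using tor unfolding torsion_def functor_star_simps one_Hom by auto
  have Ze: "so (- e) ?Z \<in> Obj T" "so e (so (- e) ?Z) = ?Z" using Z so_add[OF Z] by auto
  have p: "\<phi> e s (so (- e) ?Z) \<in> hom_set T (so (- e) ?Z) ?Z" using phi_hom[OF s(1) Ze(1)] Ze(2) by simp
  have "\<phi> e s A \<bullet>\<^bsub>T\<^esub> ?y = sa e ?y \<bullet>\<^bsub>T\<^esub> \<phi> e s ?Z" by (rule phi_natural[OF s(1) y, symmetric])
  also have "\<dots> = sa e ?y \<bullet>\<^bsub>T\<^esub> signed (e * e) (sa e (\<phi> e s (so (- e) ?Z)))"
    using phi_shift[OF s(1) Ze(1), of e] Ze(2) by simp
  also have "\<dots> = signed (e * e) (sa e ?y \<bullet>\<^bsub>T\<^esub> sa e (\<phi> e s (so (- e) ?Z)))"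
    by (rule signed_comp_right[OF sa_hom[OF p] sa_hom[OF y]])
  also have "\<dots> = signed (e * e) (sa e (Zer T (so (- e) ?Z) A))"
    unfolding sa_comp[OF p y, symmetric] z ..
  also have "\<dots> = Zer T ?Z (so e A)" using sa_Zer[OF Ze(1) A] signed_Zer Ze(2) Z A by simp
  finally have z': "\<phi> e s A \<bullet>\<^bsub>T\<^esub> ?y = Zer T ?Z (so e A)" .
  have "sa k (\<phi> e s A) \<bullet>\<^bsub>T\<^esub> x = sa k (\<phi> e s A \<bullet>\<^bsub>T\<^esub> ?y)"
    unfolding sa_comp[OF y phi_hom[OF s(1) A]] using sa_inverse(2)[OF x, of k] by simp
  also have "\<dots> = Zer T X (so (e + k) A)"
    unfolding z' using sa_Zer[OF Z so_obj[OF A]] so_add X A by (simp add: add.commute)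
  finally show ?thesis unfolding torsion_def Hom_star_simps one_Hom using s by blast
qed

end

section \<open>Colimits of abelian groups\<close>

lemma FactGroup_trivial_iff:
  assumes "group G" "subgroup H G"
  shows "carrier (G Mod H) = {\<one>\<^bsub>G Mod H\<^esub>} \<longleftrightarrow> carrier G \<subseteq> H"
proof -
  interpret group G by fact
  have "H #>\<^bsub>G\<^esub> a = H \<longleftrightarrow> a \<in> H" if "a \<in> carrier G" for a
    using coset_join1[OF _ that assms(2)] coset_join2[OF that assms(2)] subgroup.subset[OF assms(2)] by blast
  moreover have "carrier (G Mod H) = (\<lambda>a. H #>\<^bsub>G\<^esub> a) ` carrier G" "\<one>\<^bsub>G Mod H\<^esub> = H"
    by (auto simp: FactGroup_def RCOSETS_def)
  moreover have "(\<lambda>a. H #>\<^bsub>G\<^esub> a) ` carrier G = {H} \<longleftrightarrow> (\<forall>a\<in>carrier G. H #>\<^bsub>G\<^esub> a = H)"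
    using one_closed by blast
  ultimately show ?thesis by (simp add: subset_iff Ball_def)
qed

section \<open>Direct sums, relations and cocones\<close>

locale ab_family =
  fixes I :: "'i set" and D :: "'i \<Rightarrow> 'g monoid"
  assumes D: "\<And>i. i \<in> I \<Longrightarrow> comm_group (D i)"
begin

lemma D_group: "i \<in> I \<Longrightarrow> group (D i)"
  using D comm_group.axioms(2) by blast

lemma D_one: "i \<in> I \<Longrightarrow> \<one>\<^bsub>D i\<^esub> \<in> carrier (D i)"
  by (rule monoid.one_closed[OF group.is_monoid[OF D_group]])

lemma sum_carrier:
  "carrier (sum_group I D) = {x \<in> \<Pi>\<^sub>E i\<in>I. carrier (D i). finite {i \<in> I. x i \<noteq> \<one>\<^bsub>D i\<^esub>}}"
  by (rule carrier_sum_group) (rule D_group)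

lemma sum_is_group: "group (sum_group I D)"
  by (rule sum_group) (rule D_group)

lemma sum_inj_closed: "i \<in> I \<Longrightarrow> x \<in> carrier (D i) \<Longrightarrow> sum_inj I D i x \<in> carrier (sum_group I D)"
proof -
  assume i: "i \<in> I" and x: "x \<in> carrier (D i)"
  have "{j \<in> I. sum_inj I D i x j \<noteq> \<one>\<^bsub>D j\<^esub>} \<subseteq> {i}" by (auto simp: sum_inj_def)
  then have "finite {j \<in> I. sum_inj I D i x j \<noteq> \<one>\<^bsub>D j\<^esub>}" by (rule finite_subset) simp
  then show ?thesis
    using x D_one by (auto simp: sum_carrier sum_inj_def)
qed

lemma sum_inj_one: "sum_inj I D i \<one>\<^bsub>D i\<^esub> = \<one>\<^bsub>sum_group I D\<^esub>"
  unfolding sum_inj_def one_sum_group by (rule restrict_ext) simp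

text \<open>Induction on a finite set containing the support, splitting off one coordinate at a
  time.\<close>

lemma sum_group_subset:
  assumes H: "subgroup H (sum_group I D)"
    and inj: "\<And>i x. i \<in> I \<Longrightarrow> x \<in> carrier (D i) \<Longrightarrow> sum_inj I D i x \<in> H"
  shows "carrier (sum_group I D) \<subseteq> H"
proof -
  have *: "z \<in> H" if "finite J" "z \<in> carrier (sum_group I D)" "{i \<in> I. z i \<noteq> \<one>\<^bsub>D i\<^esub>} \<subseteq> J" for J z
    using that
  proof (induction J arbitrary: z rule: finite_induct)
    case empty
    have z: "z \<in> (\<Pi>\<^sub>E i\<in>I. carrier (D i))" using empty(1) unfolding sum_carrier by blast
    have "z = \<one>\<^bsub>sum_group I D\<^esub>"
      unfolding one_sum_group
    proof
      fix i show "z i = (\<lambda>i\<in>I. \<one>\<^bsub>D i\<^esub>) i"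
        using empty(2) PiE_arb[OF z, of i] by (cases "i \<in> I") auto
    qed
    then show ?case using subgroup.one_closed[OF H] by (simp only:)
  next
    case (insert j J)
    have z: "z \<in> (\<Pi>\<^sub>E i\<in>I. carrier (D i))" "finite {i \<in> I. z i \<noteq> \<one>\<^bsub>D i\<^esub>}"
      using insert.prems(1) by (auto simp: sum_carrier)
    show ?case
    proof (cases "j \<in> I")
      case False
      then have "{i \<in> I. z i \<noteq> \<one>\<^bsub>D i\<^esub>} \<subseteq> J" using insert.prems(2) by blast
      then show ?thesis using insert by blast
    next
      case j: True
      interpret Dj: group "D j" by (rule D_group[OF j])
      define z' where "z' = z(j := \<one>\<^bsub>D j\<^esub>)"
      have "{i \<in> I. z' i \<noteq> \<one>\<^bsub>D i\<^esub>} \<subseteq> {i \<in> I. z i \<noteq> \<one>\<^bsub>D i\<^esub>}" by (auto simp: z'_def)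
      then have "finite {i \<in> I. z' i \<noteq> \<one>\<^bsub>D i\<^esub>}" using z(2) finite_subset by blast
      moreover have "z' \<in> (\<Pi>\<^sub>E i\<in>I. carrier (D i))"
        using z(1) j unfolding z'_def by (auto simp: PiE_iff extensional_def)
      ultimately have z': "z' \<in> carrier (sum_group I D)" by (auto simp: sum_carrier)
      have "{i \<in> I. z' i \<noteq> \<one>\<^bsub>D i\<^esub>} \<subseteq> J" using insert.prems(2) by (auto simp: z'_def)
      then have "z' \<in> H" by (rule insert.IH[OF z'])
      moreover have zj: "z j \<in> carrier (D j)" using z(1) j by auto
      then have "sum_inj I D j (z j) \<in> H" by (rule inj[OF j])
      moreover have "z = z' \<otimes>\<^bsub>sum_group I D\<^esub> sum_inj I D j (z j)"
      proof
        fix i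
        show "z i = (z' \<otimes>\<^bsub>sum_group I D\<^esub> sum_inj I D j (z j)) i"
        proof (cases "i \<in> I")
          case True
          interpret Di: group "D i" by (rule D_group[OF True])
          show ?thesis using True PiE_mem[OF z(1) True] by (auto simp: z'_def sum_inj_def)
        next
          case False
          then show ?thesis using PiE_arb[OF z(1) False] by simp
        qed
      qed
      ultimately show ?thesis using subgroup.m_closed[OF H, of z' "sum_inj I D j (z j)"] by (simp only:)
    qed
  qed
  then show ?thesis using sum_carrier by blast
qed

text \<open>\<open>\<psi> z\<close> is the product of the \<open>t i (z i)\<close> over the support
  of \<open>z\<close>. The supports of two elements and of their product differ, so all three values
  are computed over the union \<open>J\<close>, where the extra factors are trivial.\<close>

lemma sum_group_universal:
  assumes G: "comm_group G" and t: "\<And>i. i \<in> I \<Longrightarrow> t i \<in> hom (D i) G"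
  obtains \<psi> where "\<psi> \<in> hom (sum_group I D) G"
    "\<And>i x. i \<in> I \<Longrightarrow> x \<in> carrier (D i) \<Longrightarrow> \<psi> (sum_inj I D i x) = t i x"
proof -
  interpret G: comm_group G by fact
  have t1: "t i \<one>\<^bsub>D i\<^esub> = \<one>\<^bsub>G\<^esub>" if "i \<in> I" for i using hom_one[OF t[OF that] D_group[OF that] G.is_group] .
  have tc: "t i x \<in> carrier G" if "i \<in> I" "x \<in> carrier (D i)" for i x using hom_in_carrier[OF t] that by blast
  define \<psi> where "\<psi> z = finprod G (\<lambda>i. t i (z i)) {i \<in> I. z i \<noteq> \<one>\<^bsub>D i\<^esub>}" for z
  have eq: "\<psi> z = finprod G (\<lambda>i. t i (z i)) J"
    if "z \<in> (\<Pi>\<^sub>E i\<in>I. carrier (D i))" "finite J" "J \<subseteq> I" "{i \<in> I. z i \<noteq> \<one>\<^bsub>D i\<^esub>} \<subseteq> J" for z J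
    unfolding \<psi>_def by (rule G.finprod_mono_neutral_cong_left) (use that t1 tc PiE_mem[OF that(1)] in auto)
  have "\<psi> \<in> hom (sum_group I D) G"
  proof (rule homI)
    fix z assume "z \<in> carrier (sum_group I D)"
    then have z: "z \<in> (\<Pi>\<^sub>E i\<in>I. carrier (D i))" unfolding sum_carrier by blast
    show "\<psi> z \<in> carrier G"
      unfolding \<psi>_def using PiE_mem[OF z] by (intro G.finprod_closed funcsetI tc) auto
  next
    fix z w assume "z \<in> carrier (sum_group I D)" "w \<in> carrier (sum_group I D)"
    then have z: "z \<in> (\<Pi>\<^sub>E i\<in>I. carrier (D i))" "finite {i \<in> I. z i \<noteq> \<one>\<^bsub>D i\<^esub>}"
      and w: "w \<in> (\<Pi>\<^sub>E i\<in>I. carrier (D i))" "finite {i \<in> I. w i \<noteq> \<one>\<^bsub>D i\<^esub>}"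
      by (auto simp: sum_carrier)
    define J where "J = {i \<in> I. z i \<noteq> \<one>\<^bsub>D i\<^esub>} \<union> {i \<in> I. w i \<noteq> \<one>\<^bsub>D i\<^esub>}"
    have J: "finite J" "J \<subseteq> I" unfolding J_def using z w by auto
    have c: "z i \<in> carrier (D i)" "w i \<in> carrier (D i)" if "i \<in> I" for i using z w that by auto
    define v where "v = z \<otimes>\<^bsub>sum_group I D\<^esub> w"
    have v: "v i = z i \<otimes>\<^bsub>D i\<^esub> w i" if "i \<in> I" for i unfolding v_def using that by simp
    have vc: "v \<in> (\<Pi>\<^sub>E i\<in>I. carrier (D i))"
      unfolding v_def using c D_group group.is_monoid by (auto intro!: monoid.m_closed)
    have vJ: "{i \<in> I. v i \<noteq> \<one>\<^bsub>D i\<^esub>} \<subseteq> J"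
    proof
      fix i assume "i \<in> {i \<in> I. v i \<noteq> \<one>\<^bsub>D i\<^esub>}"
      then have i: "i \<in> I" "z i \<otimes>\<^bsub>D i\<^esub> w i \<noteq> \<one>\<^bsub>D i\<^esub>" using v by auto
      interpret Di: group "D i" by (rule D_group[OF i(1)])
      show "i \<in> J" unfolding J_def using i by auto
    qed
    have "\<psi> v = finprod G (\<lambda>i. t i (v i)) J" by (rule eq[OF vc J vJ])
    also have "\<dots> = finprod G (\<lambda>i. t i (z i) \<otimes>\<^bsub>G\<^esub> t i (w i)) J"
      by (rule G.finprod_cong') (use J v hom_mult[OF t] c tc in auto)
    also have "\<dots> = finprod G (\<lambda>i. t i (z i)) J \<otimes>\<^bsub>G\<^esub> finprod G (\<lambda>i. t i (w i)) J"
      by (rule G.finprod_multf) (use J c tc in auto)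
    also have "\<dots> = \<psi> z \<otimes>\<^bsub>G\<^esub> \<psi> w" using eq[OF z(1) J] eq[OF w(1) J] unfolding J_def by simp
    finally show "\<psi> (z \<otimes>\<^bsub>sum_group I D\<^esub> w) = \<psi> z \<otimes>\<^bsub>G\<^esub> \<psi> w" unfolding v_def .
  qed
  moreover have "\<psi> (sum_inj I D i x) = t i x" if i: "i \<in> I" "x \<in> carrier (D i)" for i x
  proof -
    have "sum_inj I D i x \<in> (\<Pi>\<^sub>E i\<in>I. carrier (D i))"
      using sum_inj_closed[OF i] by (auto simp: sum_carrier)
    then have "\<psi> (sum_inj I D i x) = finprod G (\<lambda>j. t j (sum_inj I D i x j)) {i}"
      by (rule eq) (use i in \<open>auto simp: sum_inj_def\<close>)
    also have "\<dots> = t i x" using i tc by (simp add: sum_inj_def)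
    finally show ?thesis .
  qed
  ultimately show ?thesis using that by blast
qed

end

locale ab_diagram = ab_family I D for I :: "'i set" and D :: "'i \<Rightarrow> 'g monoid" +
  fixes E :: "'e set" and src tgt :: "'e \<Rightarrow> 'i" and d :: "'e \<Rightarrow> 'g \<Rightarrow> 'g"
  assumes E: "\<And>e. e \<in> E \<Longrightarrow> src e \<in> I \<and> tgt e \<in> I"
    and d: "\<And>e x. e \<in> E \<Longrightarrow> x \<in> carrier (D (src e)) \<Longrightarrow> d e x \<in> carrier (D (tgt e))"
begin

lemma colimit_rel_generators:
  "{sum_inj I D (tgt e) (d e x) \<otimes>\<^bsub>sum_group I D\<^esub> inv\<^bsub>sum_group I D\<^esub> (sum_inj I D (src e) x) |
        e x. e \<in> E \<and> x \<in> carrier (D (src e))} \<subseteq> carrier (sum_group I D)"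
proof clarify
  fix e x assume e: "e \<in> E" and x: "x \<in> carrier (D (src e))"
  interpret S: group "sum_group I D" by (rule sum_is_group)
  have "sum_inj I D (tgt e) (d e x) \<in> carrier (sum_group I D)" "sum_inj I D (src e) x \<in> carrier (sum_group I D)"
    using sum_inj_closed E[OF e] d[OF e x] x by blast+
  then show "sum_inj I D (tgt e) (d e x) \<otimes>\<^bsub>sum_group I D\<^esub> inv\<^bsub>sum_group I D\<^esub> (sum_inj I D (src e) x)
      \<in> carrier (sum_group I D)" by blast
qed

lemma colimit_rel_subgroup: "subgroup (colimit_rel I E src tgt D d) (sum_group I D)"
  unfolding colimit_rel_def
  by (rule group.generate_is_subgroup[OF sum_is_group colimit_rel_generators])

lemma ab_colimit_trivial_iff:
  "carrier (ab_colimit I E src tgt D d) = {\<one>\<^bsub>ab_colimit I E src tgt D d\<^esub>} \<longleftrightarrow>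
    carrier (sum_group I D) \<subseteq> colimit_rel I E src tgt D d"
  unfolding ab_colimit_def by (rule FactGroup_trivial_iff[OF sum_is_group colimit_rel_subgroup])

text \<open>The cocone extends to the direct sum, and compatibility with the arrows puts the
  generators of the relations into the kernel. Read contrapositively, an element with nonzero value
  under some cocone survives in the colimit.\<close>

lemma colimit_rel_cocone:
  assumes G: "comm_group G" and t: "\<And>i. i \<in> I \<Longrightarrow> t i \<in> hom (D i) G"
    and c: "\<And>e x. e \<in> E \<Longrightarrow> x \<in> carrier (D (src e)) \<Longrightarrow> t (tgt e) (d e x) = t (src e) x"
    and i: "i \<in> I" and x: "x \<in> carrier (D i)" and rel: "sum_inj I D i x \<in> colimit_rel I E src tgt D d"
  shows "t i x = \<one>\<^bsub>G\<^esub>"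
proof -
  interpret G: comm_group G by fact
  interpret S: group "sum_group I D" by (rule sum_is_group)
  obtain \<psi> where \<psi>: "\<psi> \<in> hom (sum_group I D) G"
    "\<And>i x. i \<in> I \<Longrightarrow> x \<in> carrier (D i) \<Longrightarrow> \<psi> (sum_inj I D i x) = t i x"
    using sum_group_universal[OF G t] by blast
  interpret \<psi>: group_hom "sum_group I D" G \<psi>
    by (intro group_hom.intro group_hom_axioms.intro S.is_group G.is_group \<psi>(1))
  have "colimit_rel I E src tgt D d \<subseteq> kernel (sum_group I D) G \<psi>"
    unfolding colimit_rel_def
  proof (rule S.generate_subgroup_incl[OF _ \<psi>.subgroup_kernel], clarify)
    fix e x assume e: "e \<in> E" and x: "x \<in> carrier (D (src e))"
    let ?a = "sum_inj I D (tgt e) (d e x)" and ?b = "sum_inj I D (src e) x"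
    have ab: "?a \<in> carrier (sum_group I D)" "?b \<in> carrier (sum_group I D)"
      using sum_inj_closed E[OF e] d[OF e x] x by blast+
    have "\<psi> ?a = \<psi> ?b" using \<psi>(2) E[OF e] d[OF e x] x c[OF e x] by simp
    then have "\<psi> (?a \<otimes>\<^bsub>sum_group I D\<^esub> inv\<^bsub>sum_group I D\<^esub> ?b) = \<one>\<^bsub>G\<^esub>"
      using \<psi>.hom_mult[OF ab(1) S.inv_closed[OF ab(2)]] \<psi>.hom_inv[OF ab(2)] \<psi>.hom_closed[OF ab(2)]
      by (simp del: mult_sum_group inv_sum_group)
    then show "?a \<otimes>\<^bsub>sum_group I D\<^esub> inv\<^bsub>sum_group I D\<^esub> ?b \<in> kernel (sum_group I D) G \<psi>"
      unfolding kernel_def using S.m_closed[OF ab(1) S.inv_closed[OF ab(2)]] by blast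
  qed
  then have "\<psi> (sum_inj I D i x) = \<one>\<^bsub>G\<^esub>" using rel unfolding kernel_def by blast
  then show ?thesis using \<psi>(2)[OF i x] by simp
qed

end

section \<open>The support of a representable functor\<close>

text \<open>Graded homomorphisms respect equality of fractions. It makes the arrow map of the
  localized functor well defined, with \<open>h\<close> being precomposition by the shifts of an
  arrow.\<close>

lemma fraction_eq_map:
  assumes "\<And>k x. x \<in> carrier (part M k) \<Longrightarrow> h k x \<in> carrier (part N k)"
    and "\<And>d k r x. r \<in> grade R d \<Longrightarrow> x \<in> carrier (part M k) \<Longrightarrow> h (d + k) (act M d k r x) = act N d k r (h k x)"
    and "((d, s, x), (d', s', x')) \<in> fraction_eq R p M n"
  shows "((d, s, h (d + n) x), (d', s', h (d' + n) x')) \<in> fraction_eq R p N n"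
proof -
  obtain k k' a a' where *: "(d, s, x) \<in> fractions R p M n" "(d', s', x') \<in> fractions R p M n"
    "a \<in> grade R k" "a' \<in> grade R k'" "k + d = k' + d'" "a \<otimes>\<^bsub>R\<^esub> s = a' \<otimes>\<^bsub>R\<^esub> s'" "a \<otimes>\<^bsub>R\<^esub> s \<notin> p"
    "act M k (d + n) a x = act M k' (d' + n) a' x'"
    using assms(3) unfolding fraction_eq_def by blast
  have x: "x \<in> carrier (part M (d + n))" "x' \<in> carrier (part M (d' + n))"
    using *(1,2) by (auto simp: fractions_def)
  have eq: "k + (d + n) = k' + (d' + n)" using *(5) by simp
  have "act N k (d + n) a (h (d + n) x) = h (k + (d + n)) (act M k (d + n) a x)"
    by (rule assms(2)[OF *(3) x(1), symmetric])
  also have "\<dots> = act N k' (d' + n) a' (h (d' + n) x')"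
    unfolding eq *(8) by (rule assms(2)[OF *(4) x(2)])
  finally have "act N k (d + n) a (h (d + n) x) = act N k' (d' + n) a' (h (d' + n) x')" .
  moreover have "(d, s, h (d + n) x) \<in> fractions R p N n" "(d', s', h (d' + n) x') \<in> fractions R p N n"
    using *(1,2) assms(1) by (auto simp: fractions_def)
  ultimately show ?thesis using *(3-7) unfolding fraction_eq_def by blast
qed

lemma full_subcategory_simps:
  "Obj (full_subcategory T S) = Obj T \<inter> S"
  "f \<in> Arr (full_subcategory T S) \<longleftrightarrow> f \<in> Arr T \<and> Dom T f \<in> S \<and> Cod T f \<in> S"
  "Dom (full_subcategory T S) = Dom T" "Cod (full_subcategory T S) = Cod T"
  "Cmp (full_subcategory T S) = Cmp T"
  by (auto simp: full_subcategory_def Let_def)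

lemma Hom_full_subcategory:
  "X \<in> S \<Longrightarrow> Y \<in> S \<Longrightarrow> Hom (full_subcategory T S) X Y = Hom T X Y"
  by (auto simp: full_subcategory_def Let_def Hom_def)

section \<open>The slice category over the localized representable functor\<close>

locale localized_representable = linear_triangulated_category R T \<phi> + graded_prime R p
  for R :: "'r graded_ring" and T :: "('o, 'a) tricat" and \<phi> and p +
  fixes A
  assumes A: "A \<in> Obj T"
begin

abbreviation M where "M X \<equiv> functor_star T \<phi> (representable T A) X"
abbreviation L where "L X \<equiv> localization R p (M X) 0"
abbreviation F where "F \<equiv> lower_star id id (functor_loc R T \<phi> p (representable T A))"
abbreviation Tp where "Tp \<equiv> torsion_subcategory R T \<phi> (Vset R p)"
abbreviation "I \<equiv> slice_obj Tp F"
abbreviation "E \<equiv> slice_arr Tp F"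
text \<open>Slice objects live over the torsion subcategory, but the colimit is evaluated at
  arbitrary objects \<open>C\<close> of \<open>T\<close>, so these groups are formed in
  \<open>T\<close>.\<close>

abbreviation "D C \<equiv> (\<lambda>(X, \<tau>). Hom T C X)"
abbreviation "slice_map \<equiv> (\<lambda>(_, \<alpha>, _) \<beta>. \<alpha> \<bullet>\<^bsub>T\<^esub> \<beta>)"

text \<open>The image of \<open>x\<close> under the canonical map from \<open>H_A\<close> to its
  localization at \<open>p\<close>, that is, \<open>x\<close> over the denominator
  \<open>1\<close>.\<close>

definition loc_class :: "'o \<Rightarrow> 'a \<Rightarrow> (int \<times> 'r \<times> 'a) set" where
  "loc_class X x = fraction_eq R p (M X) 0 `` {(0, \<one>\<^bsub>R\<^esub>, x)}"

lemma module_M: "X \<in> Obj T \<Longrightarrow> module_at_prime R (M X) p"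
  by (intro module_at_prime.intro functor_star_module A graded_prime_axioms)

lemma part_M: "part (M X) 0 = Hom T X A"
  by (simp add: functor_star_simps)

lemma loc_class_frac: "X \<in> Obj T \<Longrightarrow> loc_class X x = module_at_prime.frac R (M X) p 0 0 \<one>\<^bsub>R\<^esub> x"
  by (simp add: loc_class_def module_at_prime.frac_def[OF module_M])

lemma L_comm_group: "X \<in> Obj T \<Longrightarrow> comm_group (L X)"
  by (rule module_at_prime.localization_comm_group[OF module_M])

lemma fraction_M: "X \<in> Obj T \<Longrightarrow> x \<in> hom_set T X A \<Longrightarrow> (0, \<one>\<^bsub>R\<^esub>, x) \<in> fractions R p (M X) 0"
  by (rule module_at_prime.one_fraction[OF module_M]) (simp_all add: part_M)

lemma loc_class_closed: "x \<in> hom_set T X A \<Longrightarrow> loc_class X x \<in> carrier (L X)"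
  using module_at_prime.frac_closed[OF module_M fraction_M, of X] loc_class_frac[of X] hom_obj by metis

lemma loc_class_add:
  assumes "x \<in> hom_set T X A" "y \<in> hom_set T X A"
  shows "loc_class X (Add T x y) = loc_class X x \<otimes>\<^bsub>L X\<^esub> loc_class X y"
proof -
  have X: "X \<in> Obj T" using hom_obj[OF assms(1)] by simp
  have "x \<otimes>\<^bsub>part (M X) (0 + 0)\<^esub> y = Add T x y" by (simp add: part_M Hom_def)
  then show ?thesis
    using module_at_prime.frac_mult[OF module_M[OF X] fraction_M[OF X assms(1)] fraction_M[OF X assms(2)]]
    unfolding loc_class_frac[OF X] by simp
qed

lemma loc_class_eq_one_iff:
  "x \<in> hom_set T X A \<Longrightarrow> loc_class X x = \<one>\<^bsub>L X\<^esub> \<longleftrightarrow> torsion R p (M X) 0 x"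
  using module_at_prime.frac_one_eq_one_iff[OF module_M, of X x 0] loc_class_frac[of X] hom_obj[of x X A] part_M by simp

text \<open>Naturality of the canonical map to the localization. The union defining the arrow map
  runs over all representatives of the class; it is constant by \<open>fraction_eq_map\<close> and
  not empty because \<open>x\<close> over \<open>1\<close> occurs.\<close>

lemma FArr_loc_class:
  assumes f: "f \<in> hom_set T X Y" and x: "x \<in> hom_set T Y A"
  shows "FArr F f (loc_class Y x) = loc_class X (x \<bullet>\<^bsub>T\<^esub> f)"
proof -
  have X: "X \<in> Obj T" and Y: "Y \<in> Obj T" and Df: "Dom T f = X" using hom_obj[OF f] f by (auto simp: Hom_carrier)
  let ?h = "\<lambda>k y. y \<bullet>\<^bsub>T\<^esub> sa (- k) f"
  have fk: "sa (- k) f \<in> hom_set T (so (- k) X) (so (- k) Y)" for k by (rule sa_hom[OF f])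
  have eq: "((d, s, ?h d y), (d', s', ?h d' y')) \<in> fraction_eq R p (M X) 0"
    if "((d, s, y), (d', s', y')) \<in> fraction_eq R p (M Y) 0" for d s y d' s' y'
  proof -
    have "((d, s, ?h (d + 0) y), (d', s', ?h (d' + 0) y')) \<in> fraction_eq R p (M X) 0"
    proof (rule fraction_eq_map[OF _ _ that], unfold functor_star_simps)
      fix k y assume "y \<in> hom_set T (so (- k) Y) A"
      then show "?h k y \<in> hom_set T (so (- k) X) A" by (rule comp_hom[OF fk])
    next
      fix e k r y assume r: "r \<in> grade R e" and y: "y \<in> hom_set T (so (- k) Y) A"
      let ?f = "sa (- (e + k)) f"
      have *: "sa e ?f = sa (- k) f" using sa_add[OF hom_arr[OF f], of e "- (e + k)"] by simp
      have "sa (- k) f \<bullet>\<^bsub>T\<^esub> \<phi> e r (so (- (e + k)) X) = \<phi> e r (so (- (e + k)) Y) \<bullet>\<^bsub>T\<^esub> ?f"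
        using phi_natural[OF r fk[of "e + k"]] unfolding * .
      then show "(y \<bullet>\<^bsub>T\<^esub> \<phi> e r (so (- (e + k)) Y)) \<bullet>\<^bsub>T\<^esub> ?f
          = (y \<bullet>\<^bsub>T\<^esub> sa (- k) f) \<bullet>\<^bsub>T\<^esub> \<phi> e r (so (- (e + k)) X)"
        using comp_assoc[OF fk phi_so_hom[OF r Y] y] comp_assoc[OF phi_so_hom[OF r X] fk y] by simp
    qed
    then show ?thesis by simp
  qed
  have self: "(0, \<one>\<^bsub>R\<^esub>, x) \<in> loc_class Y x"
    unfolding loc_class_def using module_at_prime.fraction_eq_refl[OF module_M[OF Y] fraction_M[OF Y x]] by simp
  have cls: "fraction_eq R p (M X) 0 `` {(d, s, ?h d y)} = loc_class X (x \<bullet>\<^bsub>T\<^esub> f)" if "(d, s, y) \<in> loc_class Y x" for d s y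
  proof -
    have "((0, \<one>\<^bsub>R\<^esub>, x), (d, s, y)) \<in> fraction_eq R p (M Y) 0" using that by (simp add: loc_class_def)
    from eq[OF this] have "((0, \<one>\<^bsub>R\<^esub>, x \<bullet>\<^bsub>T\<^esub> f), (d, s, ?h d y)) \<in> fraction_eq R p (M X) 0" by simp
    then show ?thesis
      unfolding loc_class_def using equiv_class_eq[OF module_at_prime.equiv_fraction_eq[OF module_M[OF X]]] by metis
  qed
  have "FArr F f (loc_class Y x) = (\<Union>(d, s, y)\<in>loc_class Y x. fraction_eq R p (M X) 0 `` {(d, s, ?h d y)})"
    by (simp add: lower_star_def functor_loc_def Df representable_def)
  also have "\<dots> = (\<Union>z\<in>loc_class Y x. loc_class X (x \<bullet>\<^bsub>T\<^esub> f))"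
    by (rule SUP_cong[OF refl]) (use cls in auto)
  also have "\<dots> = loc_class X (x \<bullet>\<^bsub>T\<^esub> f)" using self by blast
  finally show ?thesis .
qed

lemma F_simps: "FObj F X = L X"
  by (simp add: lower_star_def functor_loc_def)

lemma Tp_obj: "X \<in> Obj Tp \<longleftrightarrow> X \<in> Obj T \<and> (\<forall>q\<in>Spec R - Vset R p. localization_zero R q (End_star T \<phi> X))"
  by (auto simp: torsion_subcategory_def full_subcategory_simps)

lemma Tp_Hom:
  assumes "X \<in> Obj Tp" "Y \<in> Obj Tp"
  shows "Hom Tp X Y = Hom T X Y"
  using assms[unfolded Tp_obj] unfolding torsion_subcategory_def by (intro Hom_full_subcategory) auto

lemma Tp_arr: "f \<in> Arr Tp \<Longrightarrow> f \<in> hom_set T (Dom T f) (Cod T f) \<and> Dom T f \<in> Obj Tp \<and> Cod T f \<in> Obj Tp"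
  unfolding Tp_obj unfolding torsion_subcategory_def by (simp add: full_subcategory_simps Hom_carrier)

lemma Tp_simps: "Dom Tp = Dom T" "Cod Tp = Cod T" "Cmp Tp = Cmp T"
  by (simp_all add: torsion_subcategory_def full_subcategory_simps)

lemma representable_Tp: "FObj (representable Tp X) C = Hom Tp C X" "FArr (representable Tp X) f \<beta> = \<beta> \<bullet>\<^bsub>T\<^esub> f"
  by (simp_all add: representable_def Tp_simps)

lemma slice_objD:
  assumes "(X, \<tau>) \<in> I"
  shows "X \<in> Obj Tp" "X \<in> Obj T" "C \<in> Obj Tp \<Longrightarrow> \<tau> C \<in> hom (Hom T C X) (L C)"
proof -
  show X: "X \<in> Obj Tp" using assms by (simp add: slice_obj_def)
  then show "X \<in> Obj T" by (simp add: Tp_obj)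
  assume C: "C \<in> Obj Tp"
  have "\<tau> \<in> nat_trans Tp (representable Tp X) F" using assms by (simp add: slice_obj_def)
  then have "\<tau> C \<in> hom (FObj (representable Tp X) C) (FObj F C)" using C unfolding nat_trans_def by blast
  then show "\<tau> C \<in> hom (Hom T C X) (L C)" using Tp_Hom[OF C X] by (simp add: representable_Tp F_simps)
qed

lemma slice_arrD:
  assumes "((X, \<tau>), \<alpha>, (X', \<tau>')) \<in> E"
  shows "(X, \<tau>) \<in> I" "(X', \<tau>') \<in> I" "\<alpha> \<in> hom_set T X X'"
    "C \<in> Obj Tp \<Longrightarrow> \<beta> \<in> hom_set T C X \<Longrightarrow> \<tau> C \<beta> = \<tau>' C (\<alpha> \<bullet>\<^bsub>T\<^esub> \<beta>)"
proof -
  show I: "(X, \<tau>) \<in> I" "(X', \<tau>') \<in> I" using assms by (simp_all add: slice_arr_def)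
  note X = slice_objD(1)[OF I(1)] slice_objD(1)[OF I(2)]
  show "\<alpha> \<in> hom_set T X X'" using assms Tp_Hom[OF X] by (simp add: slice_arr_def)
  assume "C \<in> Obj Tp" "\<beta> \<in> hom_set T C X"
  then show "\<tau> C \<beta> = \<tau>' C (\<alpha> \<bullet>\<^bsub>T\<^esub> \<beta>)" using assms Tp_Hom[OF _ X(1)] by (simp add: slice_arr_def Tp_simps)
qed

lemma slice_arrI:
  assumes I: "(X, \<tau>) \<in> I" "(X', \<tau>') \<in> I" and "\<alpha> \<in> hom_set T X X'"
    "\<And>C \<beta>. C \<in> Obj Tp \<Longrightarrow> \<beta> \<in> hom_set T C X \<Longrightarrow> \<tau> C \<beta> = \<tau>' C (\<alpha> \<bullet>\<^bsub>T\<^esub> \<beta>)"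
  shows "((X, \<tau>), \<alpha>, (X', \<tau>')) \<in> E"
proof -
  note X = slice_objD(1)[OF I(1)] slice_objD(1)[OF I(2)]
  show ?thesis using assms Tp_Hom[OF X] Tp_Hom[OF _ X(1)] by (simp add: slice_arr_def Tp_simps)
qed

text \<open>The natural transformation that corresponds under the Yoneda lemma to the class of
  \<open>x\<close>. The restrictions of the domains make it extensional, as \<open>nat_trans\<close>
  demands.\<close>

definition yoneda :: "'o \<Rightarrow> 'a \<Rightarrow> 'o \<Rightarrow> 'a \<Rightarrow> (int \<times> 'r \<times> 'a) set" where
  "yoneda X x = (\<lambda>C\<in>Obj Tp. \<lambda>\<beta>\<in>hom_set T C X. loc_class C (x \<bullet>\<^bsub>T\<^esub> \<beta>))"

lemma yoneda_slice:
  assumes X: "X \<in> Obj Tp" and x: "x \<in> hom_set T X A"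
  shows "(X, yoneda X x) \<in> I"
proof -
  have "yoneda X x \<in> nat_trans Tp (representable Tp X) F"
    unfolding nat_trans_def
  proof (intro CollectI conjI PiE_I ballI)
    fix C assume C: "C \<in> Obj Tp"
    have "yoneda X x C \<in> hom (Hom T C X) (L C)"
    proof (rule homI)
      fix \<beta> assume b: "\<beta> \<in> hom_set T C X"
      show "yoneda X x C \<beta> \<in> carrier (L C)" using loc_class_closed[OF comp_hom[OF b x]] b C by (simp add: yoneda_def)
    next
      fix \<beta> \<gamma> assume b: "\<beta> \<in> hom_set T C X" "\<gamma> \<in> hom_set T C X"
      have "\<beta> \<otimes>\<^bsub>Hom T C X\<^esub> \<gamma> = Add T \<beta> \<gamma>" by (simp add: Hom_def)
      then show "yoneda X x C (\<beta> \<otimes>\<^bsub>Hom T C X\<^esub> \<gamma>) = yoneda X x C \<beta> \<otimes>\<^bsub>L C\<^esub> yoneda X x C \<gamma>"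
        using loc_class_add[OF comp_hom[OF b(1) x] comp_hom[OF b(2) x]] comp_add_right[OF b x] b Add_hom[OF b] C
        by (simp add: yoneda_def)
    qed
    moreover have "yoneda X x C \<in> extensional (hom_set T C X)" using C by (simp add: yoneda_def)
    ultimately show "yoneda X x C \<in> hom (FObj (representable Tp X) C) (FObj F C) \<inter> extensional (carrier (FObj (representable Tp X) C))"
      using Tp_Hom[OF C X] by (simp add: representable_Tp F_simps)
  next
    fix C assume "C \<notin> Obj Tp" then show "yoneda X x C = undefined" by (simp add: yoneda_def)
  next
    fix f \<beta> assume "f \<in> Arr Tp" and b: "\<beta> \<in> carrier (FObj (representable Tp X) (Cod Tp f))"
    then have f: "f \<in> hom_set T (Dom T f) (Cod T f)" "Dom T f \<in> Obj Tp" "Cod T f \<in> Obj Tp" using Tp_arr by auto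
    have b: "\<beta> \<in> hom_set T (Cod T f) X" using b Tp_Hom[OF f(3) X] by (simp add: representable_Tp Tp_simps)
    have "yoneda X x (Dom T f) (\<beta> \<bullet>\<^bsub>T\<^esub> f) = FArr F f (yoneda X x (Cod T f) \<beta>)"
      using FArr_loc_class[OF f(1) comp_hom[OF b x]] comp_assoc[OF f(1) b x] comp_hom[OF f(1) b] f b
      by (simp add: yoneda_def)
    then show "yoneda X x (Dom Tp f) (FArr (representable Tp X) f \<beta>) = FArr F f (yoneda X x (Cod Tp f) \<beta>)"
      by (simp add: representable_Tp Tp_simps)
  qed
  then show ?thesis using X by (simp add: slice_obj_def)
qed

lemma Gamma_p_simps:
  "FObj (Gamma_p R T \<phi> p (representable T A)) C = ab_colimit I E fst (snd \<circ> snd) (D C) slice_map"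
  by (simp add: Gamma_p_def Gamma_V_def upper_star_def representable_def)

lemma slice_diagram:
  assumes C: "C \<in> Obj T"
  shows "ab_diagram I (D C) E fst (snd \<circ> snd) slice_map"
proof (intro ab_diagram.intro ab_family.intro ab_diagram_axioms.intro)
  fix i assume "i \<in> I" then show "comm_group (D C i)" using slice_objD(2) hom_group[OF C] by (cases i) simp
next
  fix e assume "e \<in> E" then show "fst e \<in> I \<and> (snd \<circ> snd) e \<in> I" using slice_arrD(1,2) by (cases e) auto
next
  fix e x assume "e \<in> E" "x \<in> carrier (D C (fst e))"
  then show "slice_map e x \<in> carrier (D C ((snd \<circ> snd) e))" using slice_arrD(3) comp_hom by (cases e) auto
qed

lemma Gamma_p_zero_iff:
  assumes C: "C \<in> Obj T"
  shows "carrier (FObj (Gamma_p R T \<phi> p (representable T A)) C) = {\<one>\<^bsub>FObj (Gamma_p R T \<phi> p (representable T A)) C\<^esub>}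
    \<longleftrightarrow> carrier (sum_group I (D C)) \<subseteq> colimit_rel I E fst (snd \<circ> snd) (D C) slice_map"
  unfolding Gamma_p_simps by (rule ab_diagram.ab_colimit_trivial_iff[OF slice_diagram[OF C]])

text \<open>If \<open>H\<^sub>A\<close> vanishes at \<open>p\<close>, the zero object is terminal in the slice category.\<close>

lemma Gamma_p_zero:
  assumes k: "killed p A"
  shows "is_zero_functor T (Gamma_p R T \<phi> p (representable T A))"
  unfolding is_zero_functor_def
proof
  fix C assume C: "C \<in> Obj T"
  have triv: "carrier (L X) = {\<one>\<^bsub>L X\<^esub>}" if X: "X \<in> Obj T" for X
    by (rule module_at_prime.localization_trivial[OF module_M[OF X]])
      (use killed_imp_torsion[OF A X k] in \<open>simp add: functor_star_simps\<close>)
  obtain N where N: "is_zero_object T N" using zero_object by blast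
  then have No: "N \<in> Obj T" by (simp add: is_zero_object_def)
  have NX: "f = Zer T X N" if "f \<in> hom_set T X N" for f X
    using that N zero_hom[OF _ No, of X] hom_obj[OF that] unfolding is_zero_object_def by blast
  \<comment> \<open>The identity of a zero object is zero, so the ring element \<open>1\<close>
    annihilates it at every prime; hence \<open>N\<close> lies in the torsion subcategory.\<close>
  have "killed q N" if "q \<in> Spec R" for q
  proof -
    interpret q: graded_prime R q by unfold_locales (rule that)
    show ?thesis unfolding killed_def
      using grade_one q.one_notin phi_one_at[OF No] NX[OF id_hom[OF No]] by (intro exI[of _ 0] exI[of _ "\<one>\<^bsub>R\<^esub>"]) simp
  qed
  then have Np: "N \<in> Obj Tp" unfolding Tp_obj using No killed_imp_localization_zero by blast
  define i0 where "i0 = (N, yoneda N (Zer T N A))"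
  have i0: "i0 \<in> I" unfolding i0_def by (rule yoneda_slice[OF Np zero_hom[OF No A]])
  let ?G = "sum_group I (D C)" and ?H = "colimit_rel I E fst (snd \<circ> snd) (D C) slice_map"
  interpret ab_diagram I "D C" E fst "snd \<circ> snd" slice_map by (rule slice_diagram[OF C])
  interpret G: group ?G by (rule sum_is_group)
  have "sum_inj I (D C) i \<beta> \<in> ?H" if i: "i \<in> I" and b: "\<beta> \<in> carrier (D C i)" for i \<beta>
  proof -
    obtain X \<tau> where i': "i = (X, \<tau>)" by (cases i)
    have X: "X \<in> Obj T" "(X, \<tau>) \<in> I" using i i' slice_objD(2) by auto
    have b': "\<beta> \<in> hom_set T C X" using b i' by simp
    \<comment> \<open>Compatibility of this arrow is automatic: both sides lie in a localization
      that has only one element.\<close>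
    have "((X, \<tau>), Zer T X N, i0) \<in> E"
      unfolding i0_def
    proof (rule slice_arrI[OF X(2) i0[unfolded i0_def] zero_hom[OF X(1) No]])
      fix C' \<gamma> assume C': "C' \<in> Obj Tp" and g: "\<gamma> \<in> hom_set T C' X"
      have "\<tau> C' \<gamma> \<in> carrier (L C')" by (rule hom_in_carrier[OF slice_objD(3)[OF X(2) C'] g])
      moreover have "yoneda N (Zer T N A) C' (Zer T X N \<bullet>\<^bsub>T\<^esub> \<gamma>) \<in> carrier (L C')"
        by (rule hom_in_carrier[OF slice_objD(3)[OF i0[unfolded i0_def] C'] comp_hom[OF g zero_hom[OF X(1) No]]])
      moreover have "C' \<in> Obj T" using C' by (simp add: Tp_obj)
      ultimately show "\<tau> C' \<gamma> = yoneda N (Zer T N A) C' (Zer T X N \<bullet>\<^bsub>T\<^esub> \<gamma>)" using triv by auto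
    qed
    then have e: "(i, Zer T X N, i0) \<in> E" unfolding i' .
    \<comment> \<open>The arrow sends \<open>\<beta>\<close> to zero, so the relation that it
      imposes is the negative of \<open>\<beta>\<close> placed at index \<open>i\<close>.\<close>
    have "slice_map (i, Zer T X N, i0) \<beta> = \<one>\<^bsub>D C i0\<^esub>"
      using NX[OF comp_hom[OF b' zero_hom[OF X(1) No]]] by (simp add: i0_def one_Hom)
    moreover have "sum_inj I (D C) i0 (slice_map (i, Zer T X N, i0) \<beta>) \<otimes>\<^bsub>?G\<^esub> inv\<^bsub>?G\<^esub> (sum_inj I (D C) i \<beta>) \<in> ?H"
      unfolding colimit_rel_def
      by (rule generate.incl, rule CollectI, rule exI[of _ "(i, Zer T X N, i0)"], rule exI[of _ \<beta>])
        (use e b in \<open>simp only: comp_apply fst_conv snd_conv simp_thms\<close>)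
    ultimately have "\<one>\<^bsub>?G\<^esub> \<otimes>\<^bsub>?G\<^esub> inv\<^bsub>?G\<^esub> (sum_inj I (D C) i \<beta>) \<in> ?H"
      using sum_inj_one[of i0] by (simp only:)
    moreover have c: "sum_inj I (D C) i \<beta> \<in> carrier ?G" by (rule sum_inj_closed[OF i b])
    ultimately have "inv\<^bsub>?G\<^esub> (sum_inj I (D C) i \<beta>) \<in> ?H" using G.l_one[OF G.inv_closed[OF c]] by (simp only:)
    from subgroup.m_inv_closed[OF colimit_rel_subgroup this] show ?thesis using G.inv_inv[OF c] by (simp only:)
  qed
  then have "carrier ?G \<subseteq> ?H" by (rule sum_group_subset[OF colimit_rel_subgroup])
  then show "carrier (FObj (Gamma_p R T \<phi> p (representable T A)) C) = {\<one>\<^bsub>FObj (Gamma_p R T \<phi> p (representable T A)) C\<^esub>}"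
    unfolding Gamma_p_zero_iff[OF C] .
qed

text \<open>Evaluating the slice at \<open>X\<close> maps the colimit to \<open>(H\<^sub>A)\<^sub>p(X)\<close>.\<close>

lemma Gamma_p_nonzero:
  assumes X: "X \<in> Obj Tp" and x: "x \<in> hom_set T X A" and nt: "\<not> torsion R p (M X) 0 x"
  shows "\<not> is_zero_functor T (Gamma_p R T \<phi> p (representable T A))"
proof
  assume z: "is_zero_functor T (Gamma_p R T \<phi> p (representable T A))"
  have Xo: "X \<in> Obj T" using X by (simp add: Tp_obj)
  \<comment> \<open>The class that survives is the identity of \<open>X\<close>, placed at the slice
    object that corresponds to \<open>x\<close>.\<close>
  let ?i = "(X, yoneda X x)"
  have i: "?i \<in> I" by (rule yoneda_slice[OF X x])
  have id: "Idt T X \<in> carrier (D X ?i)" using id_hom[OF Xo] by simp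
  interpret ab_diagram I "D X" E fst "snd \<circ> snd" slice_map by (rule slice_diagram[OF Xo])
  have "sum_inj I (D X) ?i (Idt T X) \<in> carrier (sum_group I (D X))"
    by (rule sum_inj_closed[OF i id])
  then have rel: "sum_inj I (D X) ?i (Idt T X) \<in> colimit_rel I E fst (snd \<circ> snd) (D X) slice_map"
    using z Xo Gamma_p_zero_iff[OF Xo] unfolding is_zero_functor_def by blast
  \<comment> \<open>Evaluation at \<open>X\<close> is a cocone precisely because slice arrows
    commute with the transformations; it is available since \<open>X\<close> itself lies in the
    torsion subcategory.\<close>
  have "(snd ?i) X (Idt T X) = \<one>\<^bsub>L X\<^esub>"
  proof (rule colimit_rel_cocone[OF L_comm_group[OF Xo], where t = "\<lambda>i. snd i X"])
    fix i assume "i \<in> I" then show "snd i X \<in> hom (D X i) (L X)" using slice_objD(3)[OF _ X] by (cases i) simp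
  next
    fix e \<beta> assume e: "e \<in> E" "\<beta> \<in> carrier (D X (fst e))"
    obtain Y \<tau> \<alpha> Y' \<tau>' where e': "e = ((Y, \<tau>), \<alpha>, (Y', \<tau>'))" by (metis surj_pair)
    show "snd ((snd \<circ> snd) e) X (slice_map e \<beta>) = snd (fst e) X \<beta>"
      using slice_arrD(4)[OF e(1)[unfolded e'] X, of \<beta>] e(2) unfolding e' by simp
  qed (use i id rel in auto)
  moreover have "snd ?i X (Idt T X) = loc_class X x" using X id_hom[OF Xo] comp_id[OF x] by (simp add: yoneda_def)
  ultimately show False using loc_class_eq_one_iff[OF x] nt by simp
qed

end

text \<open>The finite list consists of the nonzero components of finitely many generators. A prime
  that does not contain \<open>p\<close> omits a member of the list, and the cone on this member is
  what annihilates the Koszul object there.\<close>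

lemma (in noetherian_graded_commutative_ring) Spec_homogeneous_generators:
  assumes p: "p \<in> Spec R"
  obtains H where "finite H" "\<And>d r. (d, r) \<in> H \<Longrightarrow> r \<in> grade R d \<and> r \<in> p"
    "\<And>q. q \<in> Spec R \<Longrightarrow> (\<And>d r. (d, r) \<in> H \<Longrightarrow> r \<in> q) \<Longrightarrow> p \<subseteq> q"
proof -
  have hp: "homogeneous_ideal R p" using p by (simp add: Spec_def)
  obtain G where G: "finite G" "G \<subseteq> carrier R" "p = Idl G" using homogeneous_finitely_generated[OF hp] by blast
  define H where "H = (\<Union>g\<in>G. (\<lambda>n. (n, hcomp R g n)) ` {n. hcomp R g n \<noteq> \<zero>})"
  have "G \<subseteq> p" using G genideal_self by blast
  then have 1: "r \<in> grade R d \<and> r \<in> p" if "(d, r) \<in> H" for d r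
    using that hp hcomp_grade G(2) unfolding H_def homogeneous_ideal_def by blast
  have 2: "p \<subseteq> q" if q: "q \<in> Spec R" and H: "\<And>d r. (d, r) \<in> H \<Longrightarrow> r \<in> q" for q
  proof -
    have hq: "homogeneous_ideal R q" using q by (simp add: Spec_def)
    then interpret q: ideal q R by (simp add: homogeneous_ideal_def)
    have "hcomp R g n \<in> q" if "g \<in> G" for g n
      using H[of n "hcomp R g n"] that q.zero_closed unfolding H_def by (cases "hcomp R g n = \<zero>") auto
    then have "G \<subseteq> q" using homogeneous_ideal_iff[OF hq] G(2) by blast
    then show ?thesis unfolding G(3) by (rule genideal_minimal[OF q.is_ideal])
  qed
  have "finite H" unfolding H_def using G hcomp_finite by blast
  then show ?thesis using 1 2 by (rule that)
qed

lemma (in localized_representable) Gamma_p_nonzero_if_finitely_generated: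
  assumes R: "noetherian_graded_commutative_ring R"
    and fg: "finitely_generated R (End_star T \<phi> A)" and nz: "\<not> localization_zero R p (End_star T \<phi> A)"
  shows "\<not> is_zero_functor T (Gamma_p R T \<phi> p (representable T A))"
proof -
  interpret noetherian_graded_commutative_ring R by fact
  have N: "gnoetherian R (Hom_star T \<phi> A A)"
    by (rule finitely_generated_imp_gnoetherian[OF R Hom_star_module[OF A A] fg[unfolded End_star_def]])
  interpret H: module_at_prime R "Hom_star T \<phi> A A" p
    by (intro module_at_prime.intro Hom_star_module A graded_prime_axioms)
  obtain n x0 where x0: "x0 \<in> hom_set T A (so n A)" "\<not> torsion R p (Hom_star T \<phi> A A) n x0"
    using nz unfolding End_star_def H.localization_zero_iff Hom_star_simps by blast
  obtain H where H: "finite H" "\<And>d r. (d, r) \<in> H \<Longrightarrow> r \<in> grade R d \<and> r \<in> p"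
    "\<And>q. q \<in> Spec R \<Longrightarrow> (\<And>d r. (d, r) \<in> H \<Longrightarrow> r \<in> q) \<Longrightarrow> p \<subseteq> q"
    using Spec_homogeneous_generators[OF in_Spec] by blast
  have "\<exists>X\<in>Obj T. gnoetherian R (Hom_star T \<phi> X A) \<and>
     (\<exists>k. \<exists>x\<in>hom_set T X (so k A). \<not> torsion R p (Hom_star T \<phi> X A) k x) \<and>
     (\<forall>(d, r)\<in>H. \<forall>q\<in>Spec R. r \<notin> q \<longrightarrow> killed q X)"
    by (rule koszul_object[OF A in_Spec H(1) _ N x0]) (rule H(2))
  then obtain X where X: "X \<in> Obj T"
    and nt: "\<exists>k. \<exists>x\<in>hom_set T X (so k A). \<not> torsion R p (Hom_star T \<phi> X A) k x"
    and "\<forall>(d, r)\<in>H. \<forall>q\<in>Spec R. r \<notin> q \<longrightarrow> killed q X"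
    by (elim bexE conjE)
  then have kX: "killed q X" if "(d, r) \<in> H" "q \<in> Spec R" "r \<notin> q" for d r q using that by blast
  obtain k x where x: "x \<in> hom_set T X (so k A)" "\<not> torsion R p (Hom_star T \<phi> X A) k x"
    using nt by (elim exE bexE)
  \<comment> \<open>The element that is not torsion has degree \<open>k\<close>, whereas
    \<open>Gamma_p_nonzero\<close> expects degree zero. Replacing \<open>X\<close> by its shift
    corrects the degree and preserves annihilation.\<close>
  have "killed q (so (- k) X)" if q: "q \<in> Spec R - Vset R p" for q
  proof -
    have "\<not> p \<subseteq> q" using q by (simp add: Vset_def)
    then obtain d r where "(d, r) \<in> H" "r \<notin> q" using H(3)[of q] q by blast
    then show ?thesis using kX[of d r q] killed_shift[OF X] q by blast
  qed
  then have X': "so (- k) X \<in> Obj Tp"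
    unfolding Tp_obj using killed_imp_localization_zero so_obj[OF X] by blast
  have x': "sa (- k) x \<in> hom_set T (so (- k) X) A" using sa_hom[OF x(1), of "- k"] so_add[OF A] by simp
  show ?thesis
    by (rule Gamma_p_nonzero[OF X' x']) (use torsion_functor_star_imp_torsion_Hom_star[OF A X x(1)] x(2) in blast)
qed

theorem proposition4p2:
  fixes R :: "'r graded_ring"
    and T :: "('o, 'a) tricat"
    and \<phi> :: "int \<Rightarrow> 'r \<Rightarrow> 'o \<Rightarrow> 'a"
    and A :: 'o
  assumes "noetherian_graded_commutative_ring R"
    and "linear_triangulated_category R T \<phi>"
    and "A \<in> Obj T"
  shows "Supp R T \<phi> (representable T A)
           \<subseteq> {p \<in> Spec R. \<not> localization_zero R p (End_star T \<phi> A)} \<and>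
         (finitely_generated R (End_star T \<phi> A) \<longrightarrow>
           Supp R T \<phi> (representable T A)
           = {p \<in> Spec R. \<not> localization_zero R p (End_star T \<phi> A)})"
proof -
  interpret linear_triangulated_category R T \<phi> by fact
  have loc: "localized_representable R T \<phi> p A" if "p \<in> Spec R" for p
    by unfold_locales (use that assms(3) in auto)
  have "\<not> localization_zero R p (End_star T \<phi> A)" if p: "p \<in> Supp R T \<phi> (representable T A)" for p
  proof
    assume z: "localization_zero R p (End_star T \<phi> A)"
    have S: "p \<in> Spec R" using p by (simp add: Supp_def)
    have "is_zero_functor T (Gamma_p R T \<phi> p (representable T A))"
      by (rule localized_representable.Gamma_p_zero[OF loc[OF S] localization_zero_imp_killed[OF S assms(3) z]])
    then show False using p by (simp add: Supp_def)
  qed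
  then have sub: "Supp R T \<phi> (representable T A)
      \<subseteq> {p \<in> Spec R. \<not> localization_zero R p (End_star T \<phi> A)}" by (auto simp: Supp_def)
  have "p \<in> Supp R T \<phi> (representable T A)"
    if "finitely_generated R (End_star T \<phi> A)" "p \<in> Spec R" "\<not> localization_zero R p (End_star T \<phi> A)" for p
    using localized_representable.Gamma_p_nonzero_if_finitely_generated[OF loc[OF that(2)] assms(1) that(1,3)] that(2)
    by (simp add: Supp_def)
  with sub show ?thesis by blast
qed

end
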